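(* Let $n\ge 2$ and let $V\in L^\infty_{loc}(\mathbb R^n\setminus\{0\})$ be a positive homogeneous function of order $\alpha\in\mathbb R$ on $\mathbb R^n\setminus\{0\}$. Let $u$ be a bounded real-valued weak solution, not identically zero, to $-\Delta u=Vu$ on $\mathbb R^n$. If $\alpha>-2$ when $n=2$, or $\alpha\ge n-4$ when $n\ge 3$, then $u$ must change sign near $\infty$.
   Context: $V$ is a positive homogeneous function of order $\alpha$ if $V>0$ on $\mathbb R^n\setminus\{0\}$ and $V(tx)=t^\alpha V(x)$ for all $t>0$ and $x\ne 0$. A weak solution is a solution in the sense of distributions. "$u$ changes sign near $\infty$" means that there is no $R'>0$ such that $u\ge 0$ almost everywhere on $\{|x|>R'\}$ or $u\le 0$ almost everywhere on $\{|x|>R'\}$. *)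

theory Defs
  imports "HOL-Analysis.Analysis"
begin

definition partial_derivative ::
    "'n::finite \<Rightarrow> (real ^ 'n \<Rightarrow> real) \<Rightarrow> real ^ 'n \<Rightarrow> real" where
  "partial_derivative i f x = frechet_derivative f (at x) (axis i 1)"

primrec continuously_differentiable ::
    "nat \<Rightarrow> (real ^ 'n::finite \<Rightarrow> real) \<Rightarrow> bool" where
  "continuously_differentiable 0 f \<longleftrightarrow> continuous_on UNIV f"
| "continuously_differentiable (Suc k) f \<longleftrightarrow>
     (\<forall>x. f differentiable (at x)) \<and>
     (\<forall>i. continuously_differentiable k (partial_derivative i f))"

definition smooth :: "(real ^ 'n::finite \<Rightarrow> real) \<Rightarrow> bool" where
  "smooth f \<longleftrightarrow> (\<forall>k. continuously_differentiable k f)"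

definition test_function :: "(real ^ 'n::finite \<Rightarrow> real) \<Rightarrow> bool" where
  "test_function \<phi> \<longleftrightarrow> smooth \<phi> \<and> compact (closure {x. \<phi> x \<noteq> 0})"

definition laplacian :: "(real ^ 'n::finite \<Rightarrow> real) \<Rightarrow> real ^ 'n \<Rightarrow> real" where
  "laplacian f x = (\<Sum>i\<in>UNIV. partial_derivative i (partial_derivative i f) x)"

definition locally_integrable :: "(real ^ 'n::finite \<Rightarrow> real) \<Rightarrow> bool" where
  "locally_integrable f \<longleftrightarrow> (\<forall>K. compact K \<longrightarrow> set_integrable lebesgue K f)"

definition essentially_bounded :: "(real ^ 'n::finite \<Rightarrow> real) \<Rightarrow> bool" where
  "essentially_bounded f \<longleftrightarrow>
     f \<in> borel_measurable lebesgue \<and> (\<exists>C. AE x in lebesgue. \<bar>f x\<bar> \<le> C)"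

definition locally_essentially_bounded_on ::
    "(real ^ 'n::finite) set \<Rightarrow> (real ^ 'n \<Rightarrow> real) \<Rightarrow> bool" where
  "locally_essentially_bounded_on S f \<longleftrightarrow>
     f \<in> borel_measurable (lebesgue_on S) \<and>
     (\<forall>K. compact K \<and> K \<subseteq> S \<longrightarrow> (\<exists>C. AE x in lebesgue. x \<in> K \<longrightarrow> \<bar>f x\<bar> \<le> C))"

text \<open>The value at the origin is unconstrained: such a function lives on the punctured space.\<close>

definition positive_homogeneous :: "real \<Rightarrow> (real ^ 'n::finite \<Rightarrow> real) \<Rightarrow> bool" where
  "positive_homogeneous \<alpha> V \<longleftrightarrow>
     (\<forall>x. x \<noteq> 0 \<longrightarrow> V x > 0) \<and>
     (\<forall>t>0. \<forall>x. x \<noteq> 0 \<longrightarrow> V (t *\<^sub>R x) = t powr \<alpha> * V x)"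

text \<open>Solutions of \<open>-\<Delta>u = Vu\<close> in the sense of distributions on the whole space. The local
  integrability conditions say that \<open>u\<close> and \<open>Vu\<close> are distributions, so that the two integrals
  below converge. Test functions need not vanish near the origin.\<close>

definition weak_solution ::
    "(real ^ 'n::finite \<Rightarrow> real) \<Rightarrow> (real ^ 'n \<Rightarrow> real) \<Rightarrow> bool" where
  "weak_solution V u \<longleftrightarrow>
     locally_integrable u \<and> locally_integrable (\<lambda>x. V x * u x) \<and>
     (\<forall>\<phi>. test_function \<phi> \<longrightarrow>
        - (LINT x|lebesgue. u x * laplacian \<phi> x) = (LINT x|lebesgue. V x * u x * \<phi> x))"

definition changes_sign_near_infinity :: "(real ^ 'n::finite \<Rightarrow> real) \<Rightarrow> bool" where
  "changes_sign_near_infinity u \<longleftrightarrow>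
     \<not> (\<exists>R>0. (AE x in lebesgue. norm x > R \<longrightarrow> u x \<ge> 0) \<or>
              (AE x in lebesgue. norm x > R \<longrightarrow> u x \<le> 0))"

end

theory Submission
  imports Defs
begin

text \<open>Suppose that a bounded solution \<open>u\<close> does not change sign near infinity; replacing \<open>u\<close> by \<open>- u\<close> if
  necessary, \<open>u \<ge> 0\<close> for \<open>|x| > R\<close>. The claim is that then \<open>u = 0\<close> almost everywhere. Both alternatives
  for \<open>\<alpha>\<close> give \<open>\<alpha> > - 2\<close>, and the proof rests on the positivity of \<open>\<kappa> = \<alpha> + 2\<close>, the exponent by
  which the potential beats the Laplacian under dilations. There are two steps.

  \<^emph>\<open>The solution vanishes near infinity.\<close> Where \<open>u \<ge> 0\<close>, the equation makes \<open>u\<close> superharmonic, so on a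
  ball well inside this region \<open>u\<close> is bounded below by a fixed multiple of its average over the ball
  (\<open>superharmonic_lower_bound\<close>). Testing the equation on the ball \<open>B\<close> of radius \<open>t\<close> about \<open>t y\<close> with a
  bump function \<open>\<phi>\<close> adapted to \<open>B\<close> gives
  \<open>t^(-2) \<integral>\<^sub>B u \<ge> c \<integral> V u \<phi> \<ge> c' t\<^sup>\<alpha> \<integral>\<^sub>B u\<close>, where the last step uses homogeneity and \<open>\<integral> V \<phi> > 0\<close>.
  For large \<open>t\<close> this forces \<open>\<integral>\<^sub>B u = 0\<close> (\<open>vanishes_on_far_balls\<close>); since finitely many directions \<open>y\<close>
  suffice, \<open>u\<close> vanishes outside a ball (\<open>vanishes_near_infinity\<close>).

  \<^emph>\<open>A solution with compact support vanishes.\<close> This is unique continuation from infinity, with a potential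
  bounded by \<open>C |x|\<^sup>\<alpha>\<close>. For smooth \<open>f\<close> with support in the ball of radius \<open>\<rho>\<close> the Carleman inequality
  \<open>\<kappa>\<^sup>2 (s + 2)\<^sup>2 \<integral> |x|^(s + 2\<kappa>) f\<^sup>2 \<le> \<rho>^(2\<kappa>) \<integral> |x|^(s + 4) (\<Delta>f)\<^sup>2\<close> holds (\<open>carleman_estimate\<close>). It follows from a
  Rellich identity, that is, the divergence theorem for an explicit vector field built with the radial
  multiplier \<open>x \<cdot> \<nabla>f + \<mu> f\<close>, and from a Hardy inequality. For \<open>f = u\<close> the right-hand side is at most \<open>C\<^sup>2 \<rho>^(2\<kappa>)\<close>
  times the integral on the left, so the integral is \<open>0\<close> once \<open>s\<close> is large
  (\<open>compactly_supported_solution_eq_0\<close>).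

  Both steps need classical derivatives of \<open>u\<close>. They are applied to mollifications of \<open>u\<close>, whose Laplacian is
  minus the mollification of \<open>V u\<close> because the mollifying kernel is an admissible test function, and
  the inequalities pass to the limit because mollifications converge in \<open>L\<^sup>1\<close>.\<close>

section \<open>Smooth bump functions as test functions\<close>

text \<open>The functions \<open>s^(-k) exp (- 1/s)\<close>, extended by \<open>0\<close> to \<open>s \<le> 0\<close>. The powers are carried along
  because the derivative of such a function is a combination of two others with larger \<open>k\<close>, so that smoothness of all
  of them is proved at once.\<close>

definition exp_cutoff :: "nat \<Rightarrow> real \<Rightarrow> real" where
  "exp_cutoff k s = (if s > 0 then exp (- inverse s) * inverse s ^ k else 0)"

lemma exp_cutoff_nonneg: "exp_cutoff k s \<ge> 0"
  by (simp add: exp_cutoff_def)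

lemma exp_cutoff_pos: "s > 0 \<Longrightarrow> exp_cutoff k s > 0"
  by (simp add: exp_cutoff_def)

lemma exp_cutoff_eq_0: "s \<le> 0 \<Longrightarrow> exp_cutoff k s = 0"
  by (simp add: exp_cutoff_def)

lemma exp_cutoff_tendsto_0: "(exp_cutoff k \<longlongrightarrow> 0) (at 0)"
proof -
  have lim: "((\<lambda>s::real. inverse s ^ k / exp (inverse s)) \<longlongrightarrow> 0) (at_right 0)"
    using filterlim_compose[OF tendsto_power_div_exp_0[of k] filterlim_inverse_at_top_right] .
  have r: "(exp_cutoff k \<longlongrightarrow> 0) (at_right 0)"
    by (rule Lim_transform_eventually[OF lim])
      (auto simp: exp_cutoff_def eventually_at_filter exp_minus field_simps)
  have l: "(exp_cutoff k \<longlongrightarrow> 0) (at_left 0)"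
    by (rule Lim_transform_eventually[OF tendsto_const])
      (auto simp: exp_cutoff_def eventually_at_filter)
  show ?thesis using l r by (simp add: filterlim_split_at)
qed

lemma exp_cutoff_div: "exp_cutoff k s / s = exp_cutoff (Suc k) s"
  by (simp add: exp_cutoff_def field_simps)

text \<open>Only the origin needs an argument: there the difference quotient of index \<open>k\<close> is the function of
  index \<open>k + 1\<close>, which tends to \<open>0\<close>.\<close>

lemma DERIV_exp_cutoff:
  "(exp_cutoff k has_real_derivative (exp_cutoff (k + 2) s - real k * exp_cutoff (k + 1) s)) (at s)"
proof -
  consider "s > 0" | "s < 0" | "s = 0" by linarith
  then show ?thesis
  proof cases
    case 1
    have d: "((\<lambda>s. exp (- inverse s) * inverse s ^ k) has_real_derivative
        (exp_cutoff (k + 2) s - real k * exp_cutoff (k + 1) s)) (at s)"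
    proof -
      have "real k * inverse s ^ (k - Suc 0) * inverse s * inverse s = real k * inverse s ^ (k + 1)"
        by (cases k) auto
      then show ?thesis
        using 1 by (auto intro!: derivative_eq_intros simp: exp_cutoff_def algebra_simps power2_eq_square)
    qed
    show ?thesis
      by (rule DERIV_cong_ev[THEN iffD1, OF refl _ refl d])
        (use 1 eventually_nhds_in_open[of "{0<..}" s] in \<open>auto simp: exp_cutoff_def elim!: eventually_mono\<close>)
  next
    case 2
    have d: "((\<lambda>s. 0) has_real_derivative
        (exp_cutoff (k + 2) s - real k * exp_cutoff (k + 1) s)) (at s)"
      using 2 by (simp add: exp_cutoff_def)
    show ?thesis
      by (rule DERIV_cong_ev[THEN iffD1, OF refl _ refl d])
        (use 2 eventually_nhds_in_open[of "{..<0}" s] in \<open>auto simp: exp_cutoff_def elim!: eventually_mono\<close>)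
  next
    case 3
    have "((\<lambda>h. (exp_cutoff k (0 + h) - exp_cutoff k 0) / h) \<longlongrightarrow> 0) (at 0)"
      using exp_cutoff_tendsto_0[of "Suc k"] by (simp add: exp_cutoff_eq_0 exp_cutoff_div)
    then show ?thesis using 3 by (simp add: DERIV_def exp_cutoff_eq_0)
  qed
qed

text \<open>This quadratic function is positive exactly on the ball of radius \<open>r > 0\<close> about \<open>y\<close>, so composing a cutoff with it
  produces functions supported in that ball.\<close>

definition ball_profile :: "real ^ 'n::finite \<Rightarrow> real \<Rightarrow> real ^ 'n \<Rightarrow> real" where
  "ball_profile y r x = 1 - ((x - y) \<bullet> (x - y)) / r\<^sup>2"

lemma ball_profile_le_0: "r > 0 \<Longrightarrow> x \<notin> ball y r \<Longrightarrow> ball_profile y r x \<le> 0"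
  unfolding ball_profile_def mem_ball dist_norm
  by (simp add: field_simps dot_square_norm norm_minus_commute)

lemma ball_profile_pos: "r > 0 \<Longrightarrow> x \<in> ball y r \<Longrightarrow> ball_profile y r x > 0"
  unfolding ball_profile_def mem_ball dist_norm
  by (simp add: field_simps dot_square_norm norm_minus_commute power_strict_mono)

lemma ball_profile_commute: "ball_profile y r x = ball_profile x r y"
  unfolding ball_profile_def by (simp add: dot_square_norm norm_minus_commute)

lemma has_derivative_ball_profile [derivative_intros]:
  "(ball_profile y r has_derivative (\<lambda>h. - (2 / r\<^sup>2) * ((x - y) \<bullet> h))) (at x)"
  unfolding ball_profile_def divide_inverse
  by (rule derivative_eq_intros refl | simp add: fun_eq_iff inner_commute algebra_simps)+

lemma partial_derivative_eq:
  assumes "(f has_derivative f') (at x)"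
  shows "partial_derivative i f x = f' (axis i 1)"
  using assms unfolding partial_derivative_def by (metis frechet_derivative_at)

text \<open>A class of functions that is closed under partial derivatives. Every member is therefore smooth, although
  no closed form of the higher derivatives is ever written down.\<close>

inductive bump_term :: "real ^ 'n::finite \<Rightarrow> real \<Rightarrow> (real ^ 'n \<Rightarrow> real) \<Rightarrow> bool" for y r where
  bump_term_cutoff: "bump_term y r (\<lambda>x. exp_cutoff k (ball_profile y r x))"
| bump_term_coord: "bump_term y r f \<Longrightarrow> bump_term y r (\<lambda>x. (x - y) $ i * f x)"
| bump_term_scale: "bump_term y r f \<Longrightarrow> bump_term y r (\<lambda>x. c * f x)"
| bump_term_add: "bump_term y r f \<Longrightarrow> bump_term y r g \<Longrightarrow> bump_term y r (\<lambda>x. f x + g x)"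

lemma has_derivative_bump:
  "((\<lambda>x. exp_cutoff k (ball_profile y r x)) has_derivative
    (\<lambda>h. (exp_cutoff (k + 2) (ball_profile y r x) - real k * exp_cutoff (k + 1) (ball_profile y r x))
          * (- (2 / r\<^sup>2) * ((x - y) \<bullet> h)))) (at x)"
  using has_derivative_compose[OF has_derivative_ball_profile DERIV_exp_cutoff[unfolded has_field_derivative_def]]
  by (simp add: mult_ac)

lemma bump_term_cong: "bump_term y r f \<Longrightarrow> (\<And>x. g x = f x) \<Longrightarrow> bump_term y r g"
proof -
  assume "bump_term y r f" "\<And>x. g x = f x"
  moreover from this have "g = f" by auto
  ultimately show ?thesis by simp
qed

lemma bump_term_differentiable:
  assumes "bump_term y r f"
  shows "(\<forall>x. f differentiable (at x)) \<and> (\<forall>i. bump_term y r (partial_derivative i f))"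
  using assms
proof induction
  case (bump_term_cutoff k)
  let ?H = "\<lambda>k x. exp_cutoff k (ball_profile y r x)"
  have "bump_term y r (partial_derivative i (?H k))" for i
  proof -
    have "bump_term y r (\<lambda>x. (- (2 / r\<^sup>2)) * ((x - y) $ i * (?H (k + 2) x + (- real k) * ?H (k + 1) x)))"
      by (intro bump_term.intros)
    then show ?thesis
      by (rule bump_term_cong)
        (simp add: partial_derivative_eq[OF has_derivative_bump] inner_axis algebra_simps add_divide_distrib diff_divide_distrib)
  qed
  then show ?case using has_derivative_bump differentiable_def by blast
next
  case (bump_term_coord f j)
  then have d: "\<And>x. (f has_derivative frechet_derivative f (at x)) (at x)"
    using frechet_derivative_works by blast
  have D: "((\<lambda>x. (x - y) $ j * f x) has_derivative
     (\<lambda>h. (x - y) $ j * frechet_derivative f (at x) h + h $ j * f x)) (at x)" for x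
    by (rule derivative_eq_intros d refl
        | (rule bounded_linear.has_derivative[OF bounded_linear_vec_nth]) | simp)+
  have "bump_term y r (partial_derivative i (\<lambda>x. (x - y) $ j * f x))" for i
  proof -
    have "bump_term y r (\<lambda>x. (x - y) $ j * partial_derivative i f x + (if i = j then 1 else 0) * f x)"
      using bump_term_coord by (intro bump_term.intros) auto
    then show ?thesis
      by (rule bump_term_cong)
       (subst partial_derivative_eq[OF D], simp add: partial_derivative_eq[OF d] axis_def)
  qed
  then show ?case using D differentiable_def by blast
next
  case (bump_term_scale f c)
  then have d: "\<And>x. (f has_derivative frechet_derivative f (at x)) (at x)"
    using frechet_derivative_works by blast
  have D: "((\<lambda>x. c * f x) has_derivative (\<lambda>h. c * frechet_derivative f (at x) h)) (at x)" for x
    by (rule derivative_eq_intros d refl)+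
  have "bump_term y r (partial_derivative i (\<lambda>x. c * f x))" for i
  proof -
    have "bump_term y r (\<lambda>x. c * partial_derivative i f x)"
      using bump_term_scale by (intro bump_term.intros) auto
    then show ?thesis
      by (rule bump_term_cong)
       (simp add: partial_derivative_eq[OF D] partial_derivative_eq[OF d] axis_def)
  qed
  then show ?case using D differentiable_def by blast
next
  case (bump_term_add f g)
  then have d: "\<And>x. (f has_derivative frechet_derivative f (at x)) (at x)"
     "\<And>x. (g has_derivative frechet_derivative g (at x)) (at x)"
    using frechet_derivative_works by blast+
  have D: "((\<lambda>x. f x + g x) has_derivative
      (\<lambda>h. frechet_derivative f (at x) h + frechet_derivative g (at x) h)) (at x)" for x
    by (rule derivative_eq_intros d refl)+
  have "bump_term y r (partial_derivative i (\<lambda>x. f x + g x))" for i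
  proof -
    have "bump_term y r (\<lambda>x. partial_derivative i f x + partial_derivative i g x)"
      using bump_term_add by (intro bump_term.intros) auto
    then show ?thesis
      by (rule bump_term_cong)
       (simp add: partial_derivative_eq[OF D] partial_derivative_eq[OF d(1)] partial_derivative_eq[OF d(2)] axis_def)
  qed
  then show ?case using D differentiable_def by blast
qed

lemma bump_term_continuous: "bump_term y r f \<Longrightarrow> continuous_on UNIV f"
  by (meson bump_term_differentiable continuous_at_imp_continuous_on differentiable_imp_continuous_within)

lemma bump_term_continuously_differentiable:
  "bump_term y r f \<Longrightarrow> continuously_differentiable k f"
proof (induction k arbitrary: f)
  case 0
  then show ?case using bump_term_continuous by auto
next
  case (Suc k)
  then show ?case using bump_term_differentiable[OF Suc.prems] by auto
qed

lemma bump_term_outside: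
  assumes "bump_term y r f" "r > 0" "x \<notin> ball y r"
  shows "f x = 0"
  using assms by induction (auto simp: exp_cutoff_eq_0 ball_profile_le_0)

lemma bump_term_test_function:
  assumes "bump_term y r f" "r > 0"
  shows "test_function f"
proof -
  have "{x. f x \<noteq> 0} \<subseteq> cball y r"
    using bump_term_outside[OF assms] ball_subset_cball by blast
  then have "closure {x. f x \<noteq> 0} \<subseteq> cball y r"
    by (simp add: closure_minimal)
  then have "compact (closure {x. f x \<noteq> 0})"
    by (meson bounded_cball bounded_subset closed_closure compact_eq_bounded_closed)
  then show ?thesis
    using bump_term_continuously_differentiable[OF assms(1)] by (simp add: test_function_def smooth_def)
qed

text \<open>The standard bump function on the ball of radius \<open>r\<close> about \<open>y\<close>, followed by its first and second
  partial derivatives. The second derivatives are kept in explicit form because their symmetry in \<open>i\<close> and \<open>j\<close> is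
  needed in the Rellich identity.\<close>

definition bump :: "real ^ 'n::finite \<Rightarrow> real \<Rightarrow> real ^ 'n \<Rightarrow> real" where
  "bump y r x = exp_cutoff 0 (ball_profile y r x)"

definition bump1 :: "'n \<Rightarrow> real ^ 'n::finite \<Rightarrow> real \<Rightarrow> real ^ 'n \<Rightarrow> real" where
  "bump1 i y r x = - (2 / r\<^sup>2) * ((x - y) $ i * exp_cutoff 2 (ball_profile y r x))"

definition bump2 :: "'n \<Rightarrow> 'n \<Rightarrow> real ^ 'n::finite \<Rightarrow> real \<Rightarrow> real ^ 'n \<Rightarrow> real" where
  "bump2 i j y r x = - (2 / r\<^sup>2) * (if i = j then 1 else 0) * exp_cutoff 2 (ball_profile y r x)
     + (2 / r\<^sup>2)\<^sup>2 * ((x - y) $ i * ((x - y) $ j * (exp_cutoff 4 (ball_profile y r x)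
                                 + (- 2) * exp_cutoff 3 (ball_profile y r x))))"

lemma bump_term_bump: "bump_term y r (bump y r)"
  unfolding bump_def[abs_def] by (rule bump_term.intros)

lemma bump_term_bump1: "bump_term y r (bump1 i y r)"
  unfolding bump1_def[abs_def] by (intro bump_term.intros)

lemma bump_term_bump2: "bump_term y r (bump2 i j y r)"
  unfolding bump2_def[abs_def] mult.assoc by (intro bump_term.intros)

lemma bump2_sym: "bump2 i j y r x = bump2 j i y r x"
  unfolding bump2_def by auto

lemma has_derivative_bump0: 
  "(bump y r has_derivative (\<lambda>h. \<Sum>i\<in>UNIV. bump1 i y r x * h $ i)) (at x)"
  unfolding bump_def[abs_def]
  by (rule has_derivative_eq_rhs[OF has_derivative_bump])
    (simp add: fun_eq_iff bump1_def inner_vec_def sum_distrib_left algebra_simps numeral_2_eq_2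
      add_divide_distrib diff_divide_distrib)

lemma has_derivative_bump1:
  fixes i :: "'n::finite"
  shows
  "(bump1 i y r has_derivative (\<lambda>h. \<Sum>j\<in>UNIV. bump2 i j y r x * h $ j)) (at x)"
proof -
  have D: "(bump1 i y r has_derivative
     (\<lambda>h. - (2 / r\<^sup>2) * ((x - y) $ i * ((exp_cutoff 4 (ball_profile y r x) - 2 * exp_cutoff 3 (ball_profile y r x))
          * (- (2 / r\<^sup>2) * ((x - y) \<bullet> h))) + h $ i * exp_cutoff 2 (ball_profile y r x)))) (at x)"
    unfolding bump1_def[abs_def]
    by (rule derivative_eq_intros has_derivative_bump[of 2] refl
        | (rule bounded_linear.has_derivative[OF bounded_linear_vec_nth]) | simp)+
  show ?thesis
  proof (rule has_derivative_eq_rhs[OF D], rule ext)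
    fix h :: "real ^ 'n"
    define a where "a = 2 / r\<^sup>2"
    define p where "p = exp_cutoff 4 (ball_profile y r x) - 2 * exp_cutoff 3 (ball_profile y r x)"
    define q where "q = exp_cutoff 2 (ball_profile y r x)"
    have "(\<Sum>j\<in>UNIV. bump2 i j y r x * h $ j)
      = (\<Sum>j\<in>UNIV. (if i = j then - a * q * h $ j else 0) + a\<^sup>2 * (x - y) $ i * p * ((x - y) $ j * h $ j))"
      unfolding bump2_def a_def[symmetric] q_def[symmetric]
      by (rule sum.cong) (auto simp: p_def algebra_simps)
    also have "\<dots> = - a * q * h $ i + a\<^sup>2 * (x - y) $ i * p * ((x - y) \<bullet> h)"
      by (simp add: sum.distrib inner_vec_def sum_distrib_left)
    finally show "- (2 / r\<^sup>2) * ((x - y) $ i * ((exp_cutoff 4 (ball_profile y r x) - 2 * exp_cutoff 3 (ball_profile y r x))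
          * (- (2 / r\<^sup>2) * ((x - y) \<bullet> h))) + h $ i * exp_cutoff 2 (ball_profile y r x))
        = (\<Sum>j\<in>UNIV. bump2 i j y r x * h $ j)"
      unfolding a_def[symmetric] q_def[symmetric] p_def[symmetric]
      by (simp add: algebra_simps power2_eq_square)
  qed
qed

lemma laplacian_bump: "laplacian (bump y r) x = (\<Sum>i\<in>UNIV. bump2 i i y r x)"
proof -
  have "partial_derivative i (bump y r) = bump1 i y r" for i
    by (auto simp: fun_eq_iff partial_derivative_eq[OF has_derivative_bump0] axis_def if_distrib cong: if_cong)
  moreover have "partial_derivative i (bump1 i y r) x = bump2 i i y r x" for i
    by (auto simp: partial_derivative_eq[OF has_derivative_bump1] axis_def if_distrib cong: if_cong)
  ultimately show ?thesis
    unfolding laplacian_def by simp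
qed

lemma bump_commute: "bump y r x = bump x r y"
  unfolding bump_def by (metis ball_profile_commute)
lemma bump2_commute: "bump2 i j y r x = bump2 i j x r y"
  unfolding bump2_def ball_profile_commute[of y r x] by (simp add: algebra_simps)

section \<open>The divergence theorem for compactly supported fields\<close>

lemma integrable_continuous_support:
  fixes f :: "'a::euclidean_space \<Rightarrow> real"
  assumes "continuous_on UNIV f" "\<And>x. norm x > r \<Longrightarrow> f x = 0"
  shows "integrable lborel f"
proof -
  have "integrable lborel (\<lambda>x. indicator (cball 0 r) x *\<^sub>R f x)"
    by (rule borel_integrable_compact) (auto intro: continuous_on_subset[OF assms(1)])
  also have "(\<lambda>x. indicator (cball 0 r) x *\<^sub>R f x) = f"
    using assms(2) by (auto simp: fun_eq_iff indicator_def)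
  finally show ?thesis .
qed

lemma
  fixes f :: "'a::euclidean_space \<Rightarrow> real"
  assumes "c \<noteq> 0"
  shows integrable_affine: "integrable lborel f \<Longrightarrow> integrable lborel (\<lambda>x. f (t + c *\<^sub>R x))"
    and integral_affine: "f \<in> borel_measurable borel \<Longrightarrow>
      (\<integral>x. f (t + c *\<^sub>R x) \<partial>lborel) = (\<integral>x. f x \<partial>lborel) / \<bar>c\<bar> ^ DIM('a)"
proof -
  let ?T = "\<lambda>x. t + c *\<^sub>R x"
  have T: "?T \<in> lborel \<rightarrow>\<^sub>M borel" by simp
  have cp: "\<bar>c\<bar> ^ DIM('a) > 0" using assms by simp
  show "integrable lborel (\<lambda>x. f (?T x))" if i: "integrable lborel f"
  proof -
    have fm: "f \<in> borel_measurable borel" using borel_measurable_integrable[OF i] by simp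
    have "integrable (density (distr lborel borel ?T) (\<lambda>_. \<bar>c\<bar> ^ DIM('a))) f"
      using i by (subst lborel_affine[OF assms, of t, symmetric])
    then have "integrable (distr lborel borel ?T) (\<lambda>x. \<bar>c\<bar> ^ DIM('a) *\<^sub>R f x)"
      using fm by (subst (asm) integrable_density) auto
    then have "integrable (distr lborel borel ?T) f"
      using cp by simp
    then show ?thesis using fm by (subst (asm) integrable_distr_eq[OF T]) auto
  qed
  show "(\<integral>x. f (?T x) \<partial>lborel) = (\<integral>x. f x \<partial>lborel) / \<bar>c\<bar> ^ DIM('a)" if fm: "f \<in> borel_measurable borel"
  proof -
    have "(\<integral>x. f x \<partial>lborel) = (\<integral>x. f x \<partial>density (distr lborel borel ?T) (\<lambda>_. \<bar>c\<bar> ^ DIM('a)))"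
      by (subst lborel_affine[OF assms, of t, symmetric]) simp
    also have "\<dots> = (\<integral>x. \<bar>c\<bar> ^ DIM('a) *\<^sub>R f x \<partial>distr lborel borel ?T)"
      using fm by (subst integral_density) auto
    also have "\<dots> = \<bar>c\<bar> ^ DIM('a) * (\<integral>x. f (?T x) \<partial>lborel)"
      using fm by (subst integral_distr[OF T]) auto
    finally show ?thesis using cp by (simp add: field_simps)
  qed
qed

text \<open>Lebesgue measure is translation invariant, so the difference quotients of \<open>F\<close> in the direction \<open>e\<close> have
  integral \<open>0\<close>. The mean value theorem bounds them uniformly, and they all live in a fixed ball, so dominated
  convergence gives the same for the derivative.\<close>

lemma
  fixes F :: "'a::euclidean_space \<Rightarrow> real"
  assumes der: "\<And>x. (F has_derivative F' x) (at x)"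
    and cont: "continuous_on UNIV (\<lambda>x. F' x e)"
    and supp: "\<And>x. norm x > r \<Longrightarrow> F x = 0"
  shows integrable_directional_derivative: "integrable lborel (\<lambda>x. F' x e)"
    and integral_directional_derivative_eq_0: "(\<integral>x. F' x e \<partial>lborel) = 0"
proof -
  have supp': "F' x e = 0" if "norm x > r" for x
  proof -
    have "open {x::'a. norm x > r}" by (simp add: open_Collect_less continuous_on_norm)
    then have "((\<lambda>x. 0) has_derivative F' x) (at x)"
      by (rule has_derivative_transform_within_open[OF der]) (use that supp in auto)
    then have "F' x = (\<lambda>h. 0)"
      by (rule has_derivative_unique) (rule has_derivative_const)
    then show ?thesis by simp
  qed
  show int: "integrable lborel (\<lambda>x. F' x e)"
    by (rule integrable_continuous_support[OF cont supp'])
  have Fcont: "continuous_on UNIV F"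
    using der by (intro has_derivative_continuous_on)
  have Fint: "integrable lborel F"
    by (rule integrable_continuous_support[OF Fcont supp])
  have [measurable]: "F \<in> borel_measurable borel" "(\<lambda>x. F' x e) \<in> borel_measurable borel"
    using Fcont cont by (auto intro: borel_measurable_continuous_onI)
  obtain B where B: "\<And>x. \<bar>F' x e\<bar> \<le> B" "B \<ge> 0"
  proof -
    have "bounded ((\<lambda>x. F' x e) ` cball 0 r)"
      by (intro compact_imp_bounded compact_continuous_image continuous_on_subset[OF cont]) auto
    then obtain B where "\<forall>x\<in>cball 0 r. \<bar>F' x e\<bar> \<le> B"
      by (auto simp: bounded_iff)
    then have "\<bar>F' x e\<bar> \<le> max B 0" for x using supp'[of x] by (cases "norm x \<le> r") (force simp: max_def)+
    then show ?thesis using that by (metis max.cobounded2)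
  qed
  define s where "s k x = (F (x + inverse (real (Suc k)) *\<^sub>R e) - F x) / inverse (real (Suc k))" for k x
  have lim: "(\<lambda>k. s k x) \<longlonglongrightarrow> F' x e" for x
  proof -
    have "((\<lambda>t. F (x + t *\<^sub>R e)) has_derivative (\<lambda>t. F' x (t *\<^sub>R e))) (at 0)"
      by (rule has_derivative_compose[of "\<lambda>t. x + t *\<^sub>R e" "\<lambda>t. t *\<^sub>R e" _ _ F "F' x"])
        (use der[of x] in \<open>auto intro!: derivative_eq_intros\<close>)
    moreover have "F' x (t *\<^sub>R e) = F' x e * t" for t
      using der[of x, THEN has_derivative_bounded_linear] by (simp add: linear_simps)
    ultimately have "((\<lambda>t. F (x + t *\<^sub>R e)) has_real_derivative F' x e) (at 0)"
      by (simp add: has_field_derivative_def)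
    then have "((\<lambda>t. (F (x + t *\<^sub>R e) - F x) / t) \<longlongrightarrow> F' x e) (at 0)"
      by (simp add: DERIV_def)
    moreover have "filterlim (\<lambda>k. inverse (real (Suc k))) (at 0) sequentially"
      using LIMSEQ_inverse_real_of_nat by (simp add: filterlim_at)
    ultimately show ?thesis unfolding s_def by (rule filterlim_compose)
  qed
  have bound: "norm (s k x) \<le> B * indicator (cball 0 (r + norm e)) x" for k x
  proof -
    define h where "h = inverse (real (Suc k))"
    have h: "0 < h" "h \<le> 1" by (auto simp: h_def field_simps)
    show ?thesis
    proof (cases "norm x \<le> r + norm e")
      case True
      have "((\<lambda>t. F (x + t *\<^sub>R e)) has_real_derivative F' (x + t *\<^sub>R e) e) (at t)" for t
      proof -
        have "((\<lambda>t. F (x + t *\<^sub>R e)) has_derivative (\<lambda>s. F' (x + t *\<^sub>R e) (s *\<^sub>R e))) (at t)"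
          by (rule has_derivative_compose[of "\<lambda>t. x + t *\<^sub>R e" "\<lambda>t. t *\<^sub>R e" _ _ F "F' (x + t *\<^sub>R e)"])
            (use der[of "x + t *\<^sub>R e"] in \<open>auto intro!: derivative_eq_intros\<close>)
        moreover have "F' (x + t *\<^sub>R e) (s *\<^sub>R e) = F' (x + t *\<^sub>R e) e * s" for s
          using der[of "x + t *\<^sub>R e", THEN has_derivative_bounded_linear] by (simp add: linear_simps)
        ultimately show ?thesis by (simp add: has_field_derivative_def)
      qed
      from MVT2[OF h(1) this] obtain z where
        "F (x + h *\<^sub>R e) - F (x + 0 *\<^sub>R e) = (h - 0) * F' (x + z *\<^sub>R e) e" by blast
      then have "s k x = F' (x + z *\<^sub>R e) e"
        unfolding s_def h_def[symmetric] using h by simp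
      then show ?thesis using B True by simp
    next
      case False
      have "norm (h *\<^sub>R e) \<le> norm e" using h by (simp add: mult_left_le_one_le)
      then have "norm (x + h *\<^sub>R e) > r" using False norm_diff_ineq[of x "h *\<^sub>R e"] by linarith
      moreover have "norm x > r" using False norm_ge_zero[of e] by linarith
      ultimately show ?thesis using supp False unfolding s_def h_def[symmetric] by simp
    qed
  qed
  have "(\<lambda>k. \<integral>x. s k x \<partial>lborel) \<longlonglongrightarrow> (\<integral>x. F' x e \<partial>lborel)"
  proof (rule integral_dominated_convergence[where w="\<lambda>x. B * indicator (cball 0 (r + norm e)) x"])
    show "integrable lborel (\<lambda>x. B * indicator (cball 0 (r + norm e)) x :: real)"
      by (intro integrable_mult_right integrable_real_indicator) 
        (use emeasure_bounded_finite[OF bounded_cball] in \<open>auto simp: infinity_ennreal_def\<close>)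
  qed (use lim bound in \<open>auto simp: s_def\<close>)
  moreover have "(\<integral>x. s k x \<partial>lborel) = 0" for k
  proof -
    define h where "h = inverse (real (Suc k))"
    have "integrable lborel (\<lambda>x. F (x + h *\<^sub>R e))" "(\<integral>x. F (x + h *\<^sub>R e) \<partial>lborel) = (\<integral>x. F x \<partial>lborel)"
      using integrable_affine[of 1 F "h *\<^sub>R e"] integral_affine[of 1 F "h *\<^sub>R e"] Fint
      by (simp_all add: add.commute)
    then show ?thesis using Fint unfolding s_def h_def[symmetric] by simp
  qed
  ultimately show "(\<integral>x. F' x e \<partial>lborel) = 0" by (simp add: LIMSEQ_const_iff)
qed

lemma divergence_theorem_compact_support:
  fixes F :: "'n::finite \<Rightarrow> real ^ 'n \<Rightarrow> real"
  assumes "\<And>i x. (F i has_derivative F' i x) (at x)"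
    and "\<And>i. continuous_on UNIV (\<lambda>x. F' i x (axis i 1))"
    and "\<And>i x. norm x > r \<Longrightarrow> F i x = 0"
  shows "(\<integral>x. (\<Sum>i\<in>UNIV. F' i x (axis i 1)) \<partial>lborel) = 0"
  using integrable_directional_derivative[OF assms(1-3)]
    integral_directional_derivative_eq_0[OF assms(1-3)] by simp

text \<open>For \<open>s > 1\<close> the formula is also right at the origin, where both sides are \<open>0\<close>. Thus weights with large
  exponent can be used on the whole space, without cutting out a neighbourhood of the origin.\<close>

lemma has_derivative_norm_powr:
  fixes x :: "'a::real_inner"
  assumes "s > 1"
  shows "((\<lambda>x. norm x powr s) has_derivative (\<lambda>h. s * norm x powr (s - 2) * (x \<bullet> h))) (at x)"
proof (cases "x = 0")
  case False
  have "((\<lambda>x. norm x powr s) has_derivative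
      (\<lambda>h. (norm x powr s) * ((0::real) * ln (norm x) + (sgn x \<bullet> h) * s / norm x))) (at x)"
    by (rule has_derivative_powr) (use False in \<open>auto intro!: derivative_eq_intros has_derivative_norm simp: inner_commute\<close>)
  moreover have "norm x powr s = norm x powr (s - 2) * norm x * norm x"
    using False by (simp add: powr_diff powr_numeral power2_eq_square)
  ultimately show ?thesis
    using False by (elim has_derivative_eq_rhs) (simp add: fun_eq_iff sgn_div_norm field_simps)
next
  case True
  have "((\<lambda>h::'a. norm h powr (s - 1)) \<longlongrightarrow> 0) (at 0)"
    using assms by (intro tendsto_eq_intros tendsto_powr'[where a=0 and b="s - 1", simplified]) (auto intro!: tendsto_eq_intros)
  then have "((\<lambda>h::'a. norm (norm h powr s) / norm h) \<longlongrightarrow> 0) (at 0)"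
    by (rule Lim_transform_eventually) (auto simp: eventually_at_filter powr_diff)
  then show ?thesis
    using True assms by (simp add: has_derivative_at)
qed

lemma continuous_norm_powr:
  "s > 1 \<Longrightarrow> continuous_on UNIV (\<lambda>x::'a::real_inner. norm x powr s)"
  by (rule has_derivative_continuous_on, rule has_derivative_norm_powr)

section \<open>The Rellich identity and the Carleman estimate\<close>

text \<open>A twice continuously differentiable function with its first and second partial derivatives \<open>D\<close> and \<open>DD\<close>, all
  supported in the ball of radius \<open>rad\<close> about the origin. The derivatives are parameters since mollification provides
  them as explicit integrals.\<close>

locale compact_C2 =
  fixes f :: "real ^ 'n::finite \<Rightarrow> real" and D :: "'n \<Rightarrow> real ^ 'n \<Rightarrow> real"
    and DD :: "'n \<Rightarrow> 'n \<Rightarrow> real ^ 'n \<Rightarrow> real" and rad :: real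
  assumes f_deriv: "(f has_derivative (\<lambda>h. \<Sum>i\<in>UNIV. D i x * h $ i)) (at x)"
    and D_deriv: "(D i has_derivative (\<lambda>h. \<Sum>j\<in>UNIV. DD i j x * h $ j)) (at x)"
    and DD_cont: "continuous_on UNIV (DD i j)"
    and DD_sym: "DD i j x = DD j i x"
    and f_support: "norm x > rad \<Longrightarrow> f x = 0"
    and D_support: "norm x > rad \<Longrightarrow> D i x = 0"
    and DD_support: "norm x > rad \<Longrightarrow> DD i j x = 0"
begin

definition "lap x = (\<Sum>i\<in>UNIV. DD i i x)"
definition "grad_sq x = (\<Sum>i\<in>UNIV. (D i x)\<^sup>2)"
definition "euler x = (\<Sum>i\<in>UNIV. x $ i * D i x)"

lemma f_cont: "continuous_on UNIV f"
  using f_deriv by (rule has_derivative_continuous_on)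

lemma D_cont: "continuous_on UNIV (D i)"
  using D_deriv by (rule has_derivative_continuous_on)

lemma cont_intros:
  assumes "continuous_on UNIV g"
  shows "continuous_on UNIV (\<lambda>x. f (g x))" "continuous_on UNIV (\<lambda>x. D i (g x))" "continuous_on UNIV (\<lambda>x. DD i j (g x))"
  using continuous_on_compose2[OF f_cont assms] continuous_on_compose2[OF D_cont assms] 
    continuous_on_compose2[OF DD_cont assms] by auto

lemma lap_cont: "continuous_on UNIV lap"
  unfolding lap_def[abs_def] by (intro continuous_intros DD_cont)

lemma euler_cont: "continuous_on UNIV euler"
  unfolding euler_def[abs_def] by (intro continuous_intros D_cont)

lemma euler_deriv: "(euler has_derivative (\<lambda>h. \<Sum>i\<in>UNIV. x $ i * (\<Sum>j\<in>UNIV. DD i j x * h $ j) + h $ i * D i x)) (at x)"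
  unfolding euler_def[abs_def]
  by (rule derivative_eq_intros D_deriv refl | (rule bounded_linear.has_derivative[OF bounded_linear_vec_nth]) | simp)+

lemma grad_sq_deriv: "(grad_sq has_derivative (\<lambda>h. \<Sum>i\<in>UNIV. 2 * D i x * (\<Sum>j\<in>UNIV. DD i j x * h $ j))) (at x)"
  unfolding grad_sq_def[abs_def]
  by (rule derivative_eq_intros D_deriv refl | simp add: fun_eq_iff mult_ac)+

text \<open>Write \<open>w = |x|\<^sup>s\<close>, \<open>q = |x|^(s + 2)\<close> and \<open>G = x \<cdot> \<nabla>f + \<mu> f\<close>. The integrand is the divergence of
  \<open>q G \<nabla>f - q |\<nabla>f|\<^sup>2 x / 2 + \<mu> (s + 2) w f\<^sup>2 x / 2\<close>. In the divergence, the Hessian terms of the first two summands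
  cancel by symmetry of second derivatives, and \<open>\<mu>\<close> is chosen so that the terms with \<open>|\<nabla>f|\<^sup>2\<close> cancel as well.
  In logarithmic polar coordinates \<open>\<tau> = ln |x|\<close>, the identity says that for \<open>v = exp (\<mu> \<tau>) f\<close> the part of the
  conjugated Laplacian that is symmetric is orthogonal to \<open>\<partial>\<^sub>\<tau> v\<close>.\<close>

lemma rellich_identity:
  assumes "s > 3"
  defines "\<mu> \<equiv> (s + real CARD('n)) / 2"
  shows "(\<integral>x. norm x powr (s + 2) * (euler x + \<mu> * f x) * lap x
      + (s + 2) * norm x powr s * (euler x + \<mu> * f x)\<^sup>2 \<partial>lborel) = 0"
proof -
  define w where "w t x = norm x powr t" for t and x :: "real ^ 'n"
  define n where "n = real CARD('n)"
  define G where "G x = euler x + \<mu> * f x" for x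
  define G' where "G' x h = (\<Sum>i\<in>UNIV. x $ i * (\<Sum>j\<in>UNIV. DD i j x * h $ j) + h $ i * D i x)
     + \<mu> * (\<Sum>i\<in>UNIV. D i x * h $ i)" for x h :: "real ^ 'n"
  have w_deriv: "(w t has_derivative (\<lambda>h. t * w (t - 2) x * (x \<bullet> h))) (at x)" if "t > 1" for t x
    unfolding w_def[abs_def] by (rule has_derivative_norm_powr[OF that])
  have G_deriv: "(G has_derivative G' x) (at x)" for x
    unfolding G_def[abs_def] G'_def[abs_def] by (intro derivative_intros euler_deriv f_deriv)
  define F where "F i x = w (s + 2) x * (G x * D i x) - (1/2) * (w (s + 2) x * (grad_sq x * x $ i))
     + (1/2 * \<mu> * (s + 2)) * (w s x * ((f x)\<^sup>2 * x $ i))" for i x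
  define F' where "F' i x h = 
     w (s + 2) x * (G x * (\<Sum>j\<in>UNIV. DD i j x * h $ j) + G' x h * D i x) + ((s + 2) * w s x * (x \<bullet> h)) * (G x * D i x)
     - (1/2) * (w (s + 2) x * (grad_sq x * h $ i + (\<Sum>k\<in>UNIV. 2 * D k x * (\<Sum>j\<in>UNIV. DD k j x * h $ j)) * x $ i)
         + ((s + 2) * w s x * (x \<bullet> h)) * (grad_sq x * x $ i))
     + (1/2 * \<mu> * (s + 2)) * (w s x * ((f x)\<^sup>2 * h $ i + 2 * f x * (\<Sum>j\<in>UNIV. D j x * h $ j) * x $ i)
         + (s * w (s - 2) x * (x \<bullet> h)) * ((f x)\<^sup>2 * x $ i))" for i x h
  have F_deriv: "(F i has_derivative F' i x) (at x)" for i x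
  proof -
    have 1: "(w (s + 2) has_derivative (\<lambda>h. (s + 2) * w s x * (x \<bullet> h))) (at x)"
      "(w s has_derivative (\<lambda>h. s * w (s - 2) x * (x \<bullet> h))) (at x)"
      using w_deriv[of "s + 2"] w_deriv[of s] assms by auto
    have 2: "((\<lambda>x. x $ i) has_derivative (\<lambda>h. h $ i)) (at x)"
      by (rule bounded_linear.has_derivative[OF bounded_linear_vec_nth]) simp
    have 3: "((\<lambda>x. (f x)\<^sup>2) has_derivative (\<lambda>h. 2 * f x * (\<Sum>j\<in>UNIV. D j x * h $ j))) (at x)"
      by (rule has_derivative_eq_rhs[OF has_derivative_power[OF f_deriv]]) (simp add: fun_eq_iff)
    show ?thesis
      unfolding F_def[abs_def] F'_def[abs_def]
      by (intro has_derivative_add has_derivative_diff has_derivative_mult_right has_derivative_mult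
          1 2 3 G_deriv D_deriv grad_sq_deriv)
  qed
  have w_cont: "continuous_on UNIV (w t)" if "t > 1" for t
    unfolding w_def[abs_def] by (rule continuous_norm_powr[OF that])
  have G_cont: "continuous_on UNIV G"
    unfolding G_def[abs_def] by (intro continuous_intros euler_cont f_cont)
  have grad_cont: "continuous_on UNIV grad_sq"
    unfolding grad_sq_def[abs_def] by (intro continuous_intros D_cont)
  have F'_cont: "continuous_on UNIV (\<lambda>x. F' i x h)" for i h
    unfolding F'_def[abs_def] G'_def[abs_def]
    by (intro continuous_intros w_cont G_cont D_cont DD_cont f_cont grad_cont) (use assms in auto)
  have "(\<integral>x. (\<Sum>i\<in>UNIV. F' i x (axis i 1)) \<partial>lborel) = 0"
    by (rule divergence_theorem_compact_support[where r=rad and F=F, OF F_deriv F'_cont])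
      (simp add: F_def f_support D_support grad_sq_def)
  moreover have "(\<Sum>i\<in>UNIV. F' i x (axis i 1)) = w (s + 2) x * G x * lap x + (s + 2) * w s x * (G x)\<^sup>2" for x
  proof -
    have w2: "w t x * (x \<bullet> x) = w (t + 2) x" for t
      by (cases "x = 0") (simp_all add: w_def powr_add powr_numeral power2_eq_square dot_square_norm)
    have ax: "(\<Sum>j\<in>UNIV. g j * (axis i 1 :: real ^ 'n) $ j) = g i" for g :: "'n \<Rightarrow> real" and i
      by (simp add: axis_def if_distrib cong: if_cong)
    have ax': "(\<Sum>j\<in>UNIV. (axis i 1 :: real ^ 'n) $ j * g j) = g i" for g :: "'n \<Rightarrow> real" and i
      by (simp add: axis_def if_distrib if_distribR cong: if_cong)
    define M where "M = (\<Sum>i\<in>UNIV. \<Sum>k\<in>UNIV. x $ k * DD k i x * D i x)"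
    have G'a: "G' x (axis i 1) = (\<Sum>k\<in>UNIV. x $ k * DD k i x) + D i x + \<mu> * D i x" for i
      by (simp add: G'_def ax ax' sum.distrib)
    (* The summands are brought into a form with coefficients c1, ..., c6 that do not depend on i. *)
    have gen: "(\<Sum>i\<in>UNIV. c1 * DD i i x + c2 * (\<Sum>k\<in>UNIV. x $ k * DD k i x * D i x) + c3 * (D i x)\<^sup>2
        + c4 * (x $ i * D i x) + c5 - c2 * (\<Sum>k\<in>UNIV. x $ i * DD k i x * D k x) + c6 * (x $ i * x $ i))
      = c1 * lap x + c2 * M + c3 * grad_sq x + c4 * euler x + n * c5
        - c2 * (\<Sum>i\<in>UNIV. \<Sum>k\<in>UNIV. x $ i * DD k i x * D k x) + c6 * (x \<bullet> x)" for c1 c2 c3 c4 c5 c6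
      by (simp add: sum.distrib sum_subtractf M_def grad_sq_def lap_def euler_def inner_vec_def n_def
          sum_distrib_left[symmetric])
    have "(\<Sum>i\<in>UNIV. F' i x (axis i 1)) = (\<Sum>i\<in>UNIV.
        (w (s + 2) x * G x) * DD i i x + w (s + 2) x * (\<Sum>k\<in>UNIV. x $ k * DD k i x * D i x)
        + (w (s + 2) x * (1 + \<mu>)) * (D i x)\<^sup>2
        + ((s + 2) * w s x * G x + \<mu> * (s + 2) * w s x * f x) * (x $ i * D i x)
        + (1/2 * \<mu> * (s + 2) * w s x * (f x)\<^sup>2 - (1/2) * w (s + 2) x * grad_sq x)
        - w (s + 2) x * (\<Sum>k\<in>UNIV. x $ i * DD k i x * D k x)
        + (1/2 * \<mu> * (s + 2) * s * w (s - 2) x * (f x)\<^sup>2 - (1/2) * (s + 2) * w s x * grad_sq x) * (x $ i * x $ i))"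
    proof (rule sum.cong[OF refl])
      fix i
      define P where "P = (\<Sum>k\<in>UNIV. x $ k * DD k i x * D i x)"
      define Q where "Q = (\<Sum>k\<in>UNIV. x $ i * DD k i x * D k x)"
      have h1: "G' x (axis i 1) * D i x = P + (1 + \<mu>) * (D i x)\<^sup>2"
        by (simp add: G'a P_def algebra_simps power2_eq_square sum_distrib_left sum_distrib_right)
      have h2: "(\<Sum>k\<in>UNIV. 2 * D k x * DD k i x) * x $ i = 2 * Q"
        by (simp add: Q_def algebra_simps sum_distrib_left)
      have "F' i x (axis i 1) = w (s + 2) x * (G x * DD i i x + G' x (axis i 1) * D i x) + ((s + 2) * w s x * x $ i) * (G x * D i x)
        - (1/2) * (w (s + 2) x * (grad_sq x + (\<Sum>k\<in>UNIV. 2 * D k x * DD k i x) * x $ i)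
         + ((s + 2) * w s x * x $ i) * (grad_sq x * x $ i))
         + (1/2 * \<mu> * (s + 2)) * (w s x * ((f x)\<^sup>2 + 2 * f x * D i x * x $ i)
         + (s * w (s - 2) x * x $ i) * ((f x)\<^sup>2 * x $ i))"
        by (simp only: F'_def ax inner_axis) simp
      then show "F' i x (axis i 1) = (w (s + 2) x * G x) * DD i i x + w (s + 2) x * P
        + (w (s + 2) x * (1 + \<mu>)) * (D i x)\<^sup>2
        + ((s + 2) * w s x * G x + \<mu> * (s + 2) * w s x * f x) * (x $ i * D i x)
        + (1/2 * \<mu> * (s + 2) * w s x * (f x)\<^sup>2 - (1/2) * w (s + 2) x * grad_sq x)
        - w (s + 2) x * Q
        + (1/2 * \<mu> * (s + 2) * s * w (s - 2) x * (f x)\<^sup>2 - (1/2) * (s + 2) * w s x * grad_sq x) * (x $ i * x $ i)"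
        unfolding h1 h2 by (simp add: field_simps)
    qed
    also note gen
    also have "(\<Sum>i\<in>UNIV. \<Sum>k\<in>UNIV. x $ i * DD k i x * D k x) = M"
      unfolding M_def by (subst sum.swap) (simp add: DD_sym)
    finally have *: "(\<Sum>i\<in>UNIV. F' i x (axis i 1)) = w (s + 2) x * G x * lap x + w (s + 2) x * (1 + \<mu>) * grad_sq x
        + ((s + 2) * w s x * G x + \<mu> * (s + 2) * w s x * f x) * euler x
        + n * (1/2 * \<mu> * (s + 2) * w s x * (f x)\<^sup>2 - (1/2) * w (s + 2) x * grad_sq x)
        + (1/2 * \<mu> * (s + 2) * s * (w (s - 2) x * (x \<bullet> x)) * (f x)\<^sup>2 - (1/2) * (s + 2) * (w s x * (x \<bullet> x)) * grad_sq x)"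
      by (simp add: algebra_simps)
    have ws: "w (s - 2) x * (x \<bullet> x) = w s x" using w2[of "s - 2"] by simp
    have n: "n = 2 * \<mu> - s" by (simp add: \<mu>_def n_def field_simps)
    have e: "euler x = G x - \<mu> * f x" by (simp add: G_def)
    show ?thesis
      unfolding * w2[of s] ws n e by (simp add: field_simps power2_eq_square)
  qed
  ultimately show ?thesis by (simp add: w_def G_def)
qed


text \<open>The Rellich identity and the Cauchy-Schwarz inequality, in the form of completing a square, give
  \<open>(s + 2)\<^sup>2 \<integral> |x|\<^sup>s G\<^sup>2 \<le> \<integral> |x|^(s + 4) (\<Delta>f)\<^sup>2\<close>. The multiplier is \<open>G = |x|^(-\<mu>) x \<cdot> \<nabla>(|x|\<^sup>\<mu> f)\<close>,
  so a Hardy inequality with the additional weight \<open>|x|^(2\<kappa>)\<close> recovers \<open>f\<close> from \<open>G\<close>. The gain of \<open>|x|^(2\<kappa>)\<close> costs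
  only a factor that depends on the support, while the factor \<open>(s + 2)\<^sup>2\<close> can be made as large as desired.\<close>

lemma carleman_estimate:
  assumes "s > 3" "\<kappa> > 0"
  shows "(\<kappa> * (s + 2))\<^sup>2 * (\<integral>x. norm x powr (s + 2 * \<kappa>) * (f x)\<^sup>2 \<partial>lborel)
    \<le> rad powr (2 * \<kappa>) * (\<integral>x. norm x powr (s + 4) * (lap x)\<^sup>2 \<partial>lborel)"
proof -
  define w where "w t x = norm x powr t" for t and x :: "real ^ 'n"
  define \<mu> where "\<mu> = (s + real CARD('n)) / 2"
  define G where "G x = euler x + \<mu> * f x" for x
  have w_nonneg: "w t x \<ge> 0" for t x by (simp add: w_def)
  have w_cont: "continuous_on UNIV (w t)" if "t > 1" for t
    unfolding w_def[abs_def] by (rule continuous_norm_powr[OF that])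
  have G_cont: "continuous_on UNIV G"
    unfolding G_def[abs_def] by (intro continuous_intros euler_cont f_cont)
  have G_support: "G x = 0" if "norm x > rad" for x
    using that by (simp add: G_def euler_def f_support D_support)
  have lap_support: "lap x = 0" if "norm x > rad" for x
    using that by (simp add: lap_def DD_support)
  have int: "integrable lborel (\<lambda>x. w t x * (G x)\<^sup>2)" "integrable lborel (\<lambda>x. w t x * (f x)\<^sup>2)"
    "integrable lborel (\<lambda>x. w t x * (lap x)\<^sup>2)" "integrable lborel (\<lambda>x. w t x * G x * lap x)"
    "integrable lborel (\<lambda>x. w t x * f x * G x)" if "t > 1" for t
    by (rule integrable_continuous_support[where r=rad],
      (intro continuous_intros w_cont[OF that] G_cont f_cont lap_cont)[],
      simp add: G_support f_support lap_support)+
  let ?p = "s + 2"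
  have "?p / 2 * (\<integral>x. w s x * (G x)\<^sup>2 \<partial>lborel) - 1 / (2 * ?p) * (\<integral>x. w (s + 4) x * (lap x)\<^sup>2 \<partial>lborel)
      = (\<integral>x. ?p / 2 * (w s x * (G x)\<^sup>2) - 1 / (2 * ?p) * (w (s + 4) x * (lap x)\<^sup>2) \<partial>lborel)"
    using assms int(1)[of s] int(3)[of "s + 4"] by simp
  also have "\<dots> \<le> (\<integral>x. w ?p x * G x * lap x + ?p * w s x * (G x)\<^sup>2 \<partial>lborel)"
  proof (rule integral_mono)
    show "integrable lborel (\<lambda>x. ?p / 2 * (w s x * (G x)\<^sup>2) - 1 / (2 * ?p) * (w (s + 4) x * (lap x)\<^sup>2))"
      using assms int(1)[of s] int(3)[of "s + 4"] by simp
    show "integrable lborel (\<lambda>x. w ?p x * G x * lap x + ?p * w s x * (G x)\<^sup>2)"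
      using assms int(1)[of s] int(4)[of "?p"] by (simp add: mult.assoc)
    fix x
    define a b where "a = norm x" and "b = lap x"
    have e: "w ?p x = w s x * a\<^sup>2" "w (s + 4) x = w s x * (a\<^sup>2)\<^sup>2"
      by (cases "x = 0"; simp add: w_def powr_add powr_numeral a_def)+
    have "0 \<le> 1 / (2 * ?p) * (w s x * (?p * G x + a\<^sup>2 * b)\<^sup>2)"
      using assms w_nonneg by simp
    also have "\<dots> = (w s x * a\<^sup>2) * G x * b + ?p / 2 * (w s x * (G x)\<^sup>2) + 1 / (2 * ?p) * (w s x * (a\<^sup>2)\<^sup>2 * b\<^sup>2)"
    proof -
      have "?p \<noteq> 0" using assms by simp
      then obtain p where "p = ?p" "p \<noteq> 0" by blast
      then show ?thesis
        unfolding \<open>p = ?p\<close>[symmetric] by (simp add: power2_eq_square) (simp add: field_simps)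
    qed
    finally show "?p / 2 * (w s x * (G x)\<^sup>2) - 1 / (2 * ?p) * (w (s + 4) x * (lap x)\<^sup>2)
        \<le> w ?p x * G x * lap x + ?p * w s x * (G x)\<^sup>2"
      unfolding e b_def[symmetric] by (simp add: field_simps)
  qed
  also have "\<dots> = 0"
    using rellich_identity[OF assms(1)] by (simp add: w_def G_def \<mu>_def)
  finally have A: "?p\<^sup>2 * (\<integral>x. w s x * (G x)\<^sup>2 \<partial>lborel) \<le> (\<integral>x. w (s + 4) x * (lap x)\<^sup>2 \<partial>lborel)"
    using assms by (simp add: field_simps power2_eq_square)
  (* Hardy inequality: the divergence of |x|^t f^2 x, where t = s + 2 kappa. *)
  define t where "t = s + 2 * \<kappa>"
  have t: "t > 3" using assms by (simp add: t_def)
  define F where "F i x = w t x * ((f x)\<^sup>2 * x $ i)" for i x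
  define F' where "F' i x h = w t x * ((f x)\<^sup>2 * h $ i + 2 * f x * (\<Sum>j\<in>UNIV. D j x * h $ j) * x $ i)
         + (t * w (t - 2) x * (x \<bullet> h)) * ((f x)\<^sup>2 * x $ i)" for i x h
  have F_deriv: "(F i has_derivative F' i x) (at x)" for i x
  proof -
    have 1: "(w t has_derivative (\<lambda>h. t * w (t - 2) x * (x \<bullet> h))) (at x)"
      unfolding w_def[abs_def] using t by (intro has_derivative_norm_powr) simp
    have 2: "((\<lambda>x. x $ i) has_derivative (\<lambda>h. h $ i)) (at x)"
      by (rule bounded_linear.has_derivative[OF bounded_linear_vec_nth]) simp
    have 3: "((\<lambda>x. (f x)\<^sup>2) has_derivative (\<lambda>h. 2 * f x * (\<Sum>j\<in>UNIV. D j x * h $ j))) (at x)"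
      by (rule has_derivative_eq_rhs[OF has_derivative_power[OF f_deriv]]) (simp add: fun_eq_iff)
    show ?thesis
      unfolding F_def[abs_def] F'_def[abs_def]
      by (intro has_derivative_mult 1 2 3)
  qed
  have F'_cont: "continuous_on UNIV (\<lambda>x. F' i x h)" for i h
    unfolding F'_def[abs_def]
    by (intro continuous_intros w_cont D_cont f_cont) (use t in auto)
  have "(\<integral>x. (\<Sum>i\<in>UNIV. F' i x (axis i 1)) \<partial>lborel) = 0"
    by (rule divergence_theorem_compact_support[where r=rad and F=F, OF F_deriv F'_cont])
      (simp add: F_def f_support)
  moreover have "(\<Sum>i\<in>UNIV. F' i x (axis i 1)) = 2 * (w t x * f x * G x) + 2 * \<kappa> * (w t x * (f x)\<^sup>2)" for x
  proof -
    have w2: "w (t - 2) x * (x \<bullet> x) = w t x"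
      by (cases "x = 0") (simp_all add: w_def powr_diff powr_numeral power2_eq_square dot_square_norm)
    have ax: "(\<Sum>j\<in>UNIV. g j * (axis i 1 :: real ^ 'n) $ j) = g i" for g :: "'n \<Rightarrow> real" and i
      by (simp add: axis_def if_distrib cong: if_cong)
    have gen: "(\<Sum>i\<in>UNIV. c1 + c2 * (x $ i * D i x) + c3 * (x $ i * x $ i))
        = real CARD('n) * c1 + c2 * euler x + c3 * (x \<bullet> x)" for c1 c2 c3
      by (simp add: sum.distrib sum_distrib_left[symmetric] euler_def inner_vec_def)
    have "(\<Sum>i\<in>UNIV. F' i x (axis i 1)) = (\<Sum>i\<in>UNIV. w t x * (f x)\<^sup>2 + (2 * w t x * f x) * (x $ i * D i x)
        + (t * w (t - 2) x * (f x)\<^sup>2) * (x $ i * x $ i))"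
      by (rule sum.cong[OF refl]) (simp add: F'_def ax inner_axis algebra_simps)
    also have "\<dots> = real CARD('n) * (w t x * (f x)\<^sup>2) + (2 * w t x * f x) * euler x + t * (w (t - 2) x * (x \<bullet> x)) * (f x)\<^sup>2"
      unfolding gen by simp
    also have "\<dots> = 2 * (w t x * f x * G x) + 2 * \<kappa> * (w t x * (f x)\<^sup>2)"
      unfolding w2 by (simp add: G_def \<mu>_def t_def field_simps power2_eq_square)
    finally show ?thesis .
  qed
  ultimately have hardy0: "(\<integral>x. 2 * (w t x * f x * G x) + 2 * \<kappa> * (w t x * (f x)\<^sup>2) \<partial>lborel) = 0"
    by simp
  have "\<kappa> * (\<integral>x. w t x * (f x)\<^sup>2 \<partial>lborel) - (1 / \<kappa>) * (rad powr (2 * \<kappa>) * (\<integral>x. w s x * (G x)\<^sup>2 \<partial>lborel))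
     = (\<integral>x. \<kappa> * (w t x * (f x)\<^sup>2) - (1 / \<kappa>) * (rad powr (2 * \<kappa>) * (w s x * (G x)\<^sup>2)) \<partial>lborel)"
    using assms t int(1)[of s] int(2)[of t] by simp
  also have "\<dots> \<le> (\<integral>x. 2 * (w t x * f x * G x) + 2 * \<kappa> * (w t x * (f x)\<^sup>2) \<partial>lborel)"
  proof (rule integral_mono)
    show "integrable lborel (\<lambda>x. \<kappa> * (w t x * (f x)\<^sup>2) - (1 / \<kappa>) * (rad powr (2 * \<kappa>) * (w s x * (G x)\<^sup>2)))"
      using assms t int(1)[of s] int(2)[of t] by simp
    show "integrable lborel (\<lambda>x. 2 * (w t x * f x * G x) + 2 * \<kappa> * (w t x * (f x)\<^sup>2))"
      using assms t int(5)[of t] int(2)[of t] by simp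
    fix x
    have *: "w t x * (G x)\<^sup>2 \<le> rad powr (2 * \<kappa>) * (w s x * (G x)\<^sup>2)"
    proof (cases "norm x > rad")
      case False
      then have "norm x powr (2 * \<kappa>) \<le> rad powr (2 * \<kappa>)"
        using assms by (intro powr_mono2) auto
      then have "w s x * norm x powr (2 * \<kappa>) * (G x)\<^sup>2 \<le> w s x * rad powr (2 * \<kappa>) * (G x)\<^sup>2"
        by (intro mult_right_mono mult_left_mono) (auto simp: w_nonneg)
      then show ?thesis by (simp add: w_def t_def powr_add mult_ac)
    qed (simp add: G_support)
    have "0 \<le> w t x * (\<kappa> * f x + G x)\<^sup>2 / \<kappa>" using assms w_nonneg by simp
    also have "\<dots> = 2 * (w t x * f x * G x) + \<kappa> * (w t x * (f x)\<^sup>2) + (1 / \<kappa>) * (w t x * (G x)\<^sup>2)"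
      using assms by (simp add: field_simps power2_eq_square)
    finally have "\<kappa> * (w t x * (f x)\<^sup>2) - (1 / \<kappa>) * (w t x * (G x)\<^sup>2) \<le> 2 * (w t x * f x * G x) + 2 * \<kappa> * (w t x * (f x)\<^sup>2)"
      by simp
    moreover have "(1 / \<kappa>) * (w t x * (G x)\<^sup>2) \<le> (1 / \<kappa>) * (rad powr (2 * \<kappa>) * (w s x * (G x)\<^sup>2))"
      using * assms by (intro mult_left_mono) auto
    ultimately show "\<kappa> * (w t x * (f x)\<^sup>2) - (1 / \<kappa>) * (rad powr (2 * \<kappa>) * (w s x * (G x)\<^sup>2))
        \<le> 2 * (w t x * f x * G x) + 2 * \<kappa> * (w t x * (f x)\<^sup>2)" by linarith
  qed
  also note hardy0
  finally have B: "\<kappa>\<^sup>2 * (\<integral>x. w t x * (f x)\<^sup>2 \<partial>lborel) \<le> rad powr (2 * \<kappa>) * (\<integral>x. w s x * (G x)\<^sup>2 \<partial>lborel)"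
    using assms by (simp add: field_simps power2_eq_square)
  have "(\<kappa> * ?p)\<^sup>2 * (\<integral>x. w t x * (f x)\<^sup>2 \<partial>lborel) \<le> ?p\<^sup>2 * (rad powr (2 * \<kappa>) * (\<integral>x. w s x * (G x)\<^sup>2 \<partial>lborel))"
    using mult_left_mono[OF B, of "?p\<^sup>2"] by (simp add: power_mult_distrib mult_ac)
  also have "\<dots> \<le> rad powr (2 * \<kappa>) * (\<integral>x. w (s + 4) x * (lap x)\<^sup>2 \<partial>lborel)"
    using mult_left_mono[OF A, of "rad powr (2 * \<kappa>)"] by (simp add: mult_ac)
  finally show ?thesis by (simp add: w_def t_def)
qed

section \<open>A lower bound for superharmonic functions\<close>

text \<open>The weight \<open>\<eta>\<close> satisfies \<open>\<nabla>K = - 2 z \<eta>\<close> for the bump function \<open>K\<close> on the unit ball. Hence, after an integration by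
  parts, the derivative of \<open>t \<mapsto> \<integral> f (y + t z) \<eta> z dz\<close> is \<open>t / 2\<close> times the integral of \<open>\<Delta>f (y + t z) K z\<close>, which is
  nonpositive. Comparing \<open>t = r\<close> with \<open>t = 0\<close> gives the claim.\<close>

lemma superharmonic_mean_value:
  fixes y :: "real ^ 'n"
  defines "\<eta> \<equiv> (\<lambda>z::real ^ 'n. exp_cutoff 2 (ball_profile 0 1 z))"
  assumes "r > 0" and superharmonic: "\<And>x. x \<in> ball y r \<Longrightarrow> lap x \<le> 0"
  shows "(\<integral>z. f (y + r *\<^sub>R z) * \<eta> z \<partial>lborel) \<le> f y * (\<integral>z. \<eta> z \<partial>lborel)"
proof -
  have bump_term_eta: "bump_term 0 1 \<eta>" unfolding \<eta>_def by (rule bump_term.intros)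
  note \<eta>_cont = bump_term_continuous[OF bump_term_eta]
  have \<eta>_supp: "\<eta> z = 0" if "norm z \<ge> 1" for z
    using bump_term_outside[OF bump_term_eta, of z] that by simp
  let ?c = "cbox (- One) (One :: real ^ 'n)"
  have supp_c: "\<eta> z = 0" if "z \<notin> ?c" for z
  proof (rule \<eta>_supp, rule ccontr)
    assume "\<not> 1 \<le> norm z"
    then have "\<bar>z \<bullet> b\<bar> \<le> 1" if "b \<in> Basis" for b using Basis_le_norm[OF that, of z] by linarith
    then have "z \<in> ?c" by (auto simp: mem_box abs_le_iff)
    with that show False by simp
  qed
  have HK: "integral ?c (\<lambda>z. g z * \<eta> z) = (\<integral>z. g z * \<eta> z \<partial>lborel)" 
      and LI: "integrable lborel (\<lambda>z. g z * \<eta> z)" if "continuous_on UNIV g" for g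
  proof -
    show i: "integrable lborel (\<lambda>z. g z * \<eta> z)"
      by (rule integrable_continuous_support[where r=1]) (auto intro!: continuous_intros that \<eta>_cont \<eta>_supp)
    have "integral UNIV (\<lambda>z. g z * \<eta> z) = (\<integral>z. g z * \<eta> z \<partial>lborel)"
      using has_integral_integral_lborel[OF i] by blast
    moreover have "integral ?c (\<lambda>z. g z * \<eta> z) = integral UNIV (\<lambda>z. g z * \<eta> z)"
      by (subst integral_restrict_UNIV[symmetric], rule arg_cong[where f="integral UNIV"]) (auto simp: fun_eq_iff supp_c)
    ultimately show "integral ?c (\<lambda>z. g z * \<eta> z) = (\<integral>z. g z * \<eta> z \<partial>lborel)" by simp
  qed
  define m where "m t = (\<integral>z. f (y + t *\<^sub>R z) * \<eta> z \<partial>lborel)" for t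
  have m_deriv: "(m has_real_derivative (\<integral>z. (\<Sum>i\<in>UNIV. D i (y + t *\<^sub>R z) * z $ i) * \<eta> z \<partial>lborel)) (at t)" for t
  proof -
    have "((\<lambda>t. integral ?c (\<lambda>z. f (y + t *\<^sub>R z) * \<eta> z)) has_real_derivative
       integral ?c (\<lambda>z. (\<Sum>i\<in>UNIV. D i (y + t *\<^sub>R z) * z $ i) * \<eta> z)) (at t within UNIV)"
    proof (rule leibniz_rule_field_derivative[where fx="\<lambda>t z. (\<Sum>i\<in>UNIV. D i (y + t *\<^sub>R z) * z $ i) * \<eta> z"])
      fix t and z :: "real ^ 'n"
      have "((\<lambda>t. f (y + t *\<^sub>R z)) has_derivative (\<lambda>h. \<Sum>i\<in>UNIV. D i (y + t *\<^sub>R z) * (h *\<^sub>R z) $ i)) (at t)"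
        by (rule has_derivative_compose[of "\<lambda>t. y + t *\<^sub>R z" "\<lambda>h. h *\<^sub>R z", OF _ f_deriv]) (auto intro!: derivative_eq_intros)
      then have "((\<lambda>t. f (y + t *\<^sub>R z)) has_real_derivative (\<Sum>i\<in>UNIV. D i (y + t *\<^sub>R z) * z $ i)) (at t)"
        by (rule has_derivative_imp_has_field_derivative) (simp add: sum_distrib_left mult_ac)
      then show "((\<lambda>t. f (y + t *\<^sub>R z) * \<eta> z) has_real_derivative (\<Sum>i\<in>UNIV. D i (y + t *\<^sub>R z) * z $ i) * \<eta> z) (at t within UNIV)"
        by (simp add: DERIV_cmult_right)
    next
      fix t
      show "(\<lambda>z. f (y + t *\<^sub>R z) * \<eta> z) integrable_on ?c"
        by (intro integrable_continuous continuous_intros continuous_on_subset[OF \<eta>_cont]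
           continuous_on_compose2[OF f_cont]) auto
    next
      show "continuous_on (UNIV \<times> ?c) (\<lambda>(t, z). (\<Sum>i\<in>UNIV. D i (y + t *\<^sub>R z) * z $ i) * \<eta> z)"
        unfolding case_prod_beta
        by (intro continuous_intros continuous_on_compose2[OF \<eta>_cont] continuous_on_compose2[OF D_cont]) auto
    qed auto
    moreover have "continuous_on UNIV (\<lambda>z. f (y + t *\<^sub>R z))" for t
      by (intro cont_intros continuous_intros)
    moreover have "continuous_on UNIV (\<lambda>z. (\<Sum>i\<in>UNIV. D i (y + t *\<^sub>R z) * z $ i))" for t
      by (intro cont_intros continuous_intros)
    ultimately show ?thesis by (simp add: HK m_def[abs_def])
  qed
  have m'_le: "(\<integral>z. (\<Sum>i\<in>UNIV. D i (y + t *\<^sub>R z) * z $ i) * \<eta> z \<partial>lborel) \<le> 0" if t: "0 \<le> t" "t \<le> r" for t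
  proof -
    define F' where "F' i z h = D i (y + t *\<^sub>R z) * (\<Sum>j\<in>UNIV. bump1 j 0 1 z * h $ j)
        + (\<Sum>j\<in>UNIV. DD i j (y + t *\<^sub>R z) * (t *\<^sub>R h) $ j) * bump 0 1 z" for i z h
    have F_deriv: "((\<lambda>z. D i (y + t *\<^sub>R z) * bump 0 1 z) has_derivative F' i z) (at z)" for i z
      unfolding F'_def[abs_def]
      by (intro has_derivative_mult has_derivative_bump0
            has_derivative_compose[of "\<lambda>z. y + t *\<^sub>R z" "\<lambda>h. t *\<^sub>R h", OF _ D_deriv])
         (auto intro!: derivative_eq_intros)
    have "(\<integral>z. (\<Sum>i\<in>UNIV. F' i z (axis i 1)) \<partial>lborel) = 0"
    proof (rule divergence_theorem_compact_support[where r=1, OF F_deriv])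
      show "continuous_on UNIV (\<lambda>z. F' i z (axis i 1))" for i
        unfolding F'_def by (intro continuous_intros cont_intros bump_term_continuous[OF bump_term_bump]
           bump_term_continuous[OF bump_term_bump1])
      show "D i (y + t *\<^sub>R z) * bump 0 1 z = 0" if "norm z > 1" for i z
        using bump_term_outside[OF bump_term_bump, of 1 z 0] that by simp
    qed
    moreover have "(\<Sum>i\<in>UNIV. F' i z (axis i 1)) = - 2 * ((\<Sum>i\<in>UNIV. D i (y + t *\<^sub>R z) * z $ i) * \<eta> z)
        + t * (lap (y + t *\<^sub>R z) * bump 0 1 z)" for z
    proof -
      have ax: "(\<Sum>j\<in>UNIV. g j * (axis i 1 :: real ^ 'n) $ j) = g i" for g :: "'n \<Rightarrow> real" and i
        by (simp add: axis_def if_distrib cong: if_cong)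
      have ax2: "(\<Sum>j\<in>UNIV. g j * (t *\<^sub>R axis i 1 :: real ^ 'n) $ j) = t * g i" for g :: "'n \<Rightarrow> real" and i
        using ax[of g i] by (simp add: mult.left_commute[of _ t] sum_distrib_left[symmetric])
      have "F' i z (axis i 1) = D i (y + t *\<^sub>R z) * bump1 i 0 1 z + t * DD i i (y + t *\<^sub>R z) * bump 0 1 z" for i
        unfolding F'_def ax ax2 ..
      then have "F' i z (axis i 1) = - 2 * (D i (y + t *\<^sub>R z) * z $ i * \<eta> z) + t * (DD i i (y + t *\<^sub>R z) * bump 0 1 z)" for i
        by (simp add: bump1_def \<eta>_def)
      then show ?thesis
        by (simp add: sum_subtractf sum_negf sum_distrib_left sum_distrib_right lap_def)
    qed
    moreover have "continuous_on UNIV (\<lambda>z. (\<Sum>i\<in>UNIV. D i (y + t *\<^sub>R z) * z $ i))"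
      by (intro cont_intros continuous_intros)
    then have i1: "integrable lborel (\<lambda>z. (\<Sum>i\<in>UNIV. D i (y + t *\<^sub>R z) * z $ i) * \<eta> z)"
      by (rule LI)
    have i2: "integrable lborel (\<lambda>z. lap (y + t *\<^sub>R z) * bump 0 1 z)"
      by (rule integrable_continuous_support[where r=1])
        (auto intro!: continuous_intros bump_term_continuous[OF bump_term_bump] 
          continuous_on_compose2[OF lap_cont] bump_term_outside[OF bump_term_bump])
    ultimately have "- 2 * (\<integral>z. (\<Sum>i\<in>UNIV. D i (y + t *\<^sub>R z) * z $ i) * \<eta> z \<partial>lborel)
        + t * (\<integral>z. lap (y + t *\<^sub>R z) * bump 0 1 z \<partial>lborel) = 0"
      using i1 i2 by simp
    moreover have "(\<integral>z. lap (y + t *\<^sub>R z) * bump 0 1 z \<partial>lborel) \<le> 0"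
    proof -
      have "lap (y + t *\<^sub>R z) * bump 0 1 z \<le> 0" for z
      proof (cases "norm z < 1")
        case True
        have "norm (t *\<^sub>R z) < r"
        proof -
          have "t * norm z \<le> r * norm z" using t by (intro mult_right_mono) auto
          also have "\<dots> < r" using True \<open>r > 0\<close> by simp
          finally show ?thesis using t by simp
        qed
        then show ?thesis using superharmonic[of "y + t *\<^sub>R z"]
          by (simp add: bump_def exp_cutoff_nonneg mult_nonpos_nonneg dist_norm)
      qed (use bump_term_outside[OF bump_term_bump, of 1 z 0] in simp)
      then have "(\<integral>z. - (lap (y + t *\<^sub>R z) * bump 0 1 z) \<partial>lborel) \<ge> 0"
        by (intro integral_nonneg_AE) auto
      then show ?thesis by simp
    qed
    then have "t * (\<integral>z. lap (y + t *\<^sub>R z) * bump 0 1 z \<partial>lborel) \<le> 0"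
      using t by (simp add: mult_nonneg_nonpos)
    ultimately show ?thesis by linarith
  qed
  have "m r \<le> m 0"
    using DERIV_nonpos_imp_nonincreasing[of 0 r m] m_deriv m'_le \<open>r > 0\<close> by force
  then show ?thesis by (simp add: m_def)
qed

text \<open>For \<open>y\<close> in the ball of radius \<open>r\<close> about \<open>y0\<close>, that ball lies in the ball of radius \<open>2 r\<close> about \<open>y\<close>. The mean
  value inequality is applied at \<open>y\<close> with radius \<open>4 r\<close>; then the points in question correspond to \<open>|z| < 1/2\<close>, where
  the weight is at least \<open>exp (- 4/3)\<close>.\<close>

lemma superharmonic_lower_bound:
  fixes y0 y :: "real ^ 'n"
  assumes "r > 0" and lap: "\<And>x. x \<in> ball y0 (5 * r) \<Longrightarrow> lap x \<le> 0"
    and nonneg: "\<And>x. x \<in> ball y0 (5 * r) \<Longrightarrow> f x \<ge> 0" and y: "y \<in> ball y0 r"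
  shows "exp (- 4 / 3) / (4 * r) ^ CARD('n) * (\<integral>x. indicator (ball y0 r) x * f x \<partial>lborel)
     \<le> f y * (\<integral>z. exp_cutoff 2 (ball_profile 0 1 (z :: real ^ 'n)) \<partial>lborel)"
proof -
  let ?\<eta> = "\<lambda>z::real ^ 'n. exp_cutoff 2 (ball_profile 0 1 z)"
  have sub: "x \<in> ball y0 (5 * r)" if "x \<in> ball y (4 * r)" for x
    using y that dist_triangle[of y0 x y] by simp
  have bump_term_eta: "bump_term 0 1 ?\<eta>" by (rule bump_term.intros)
  have cont: "continuous_on UNIV (\<lambda>z. f (y + (4 * r) *\<^sub>R z) * ?\<eta> z)"
    by (intro continuous_intros cont_intros bump_term_continuous[OF bump_term_eta])
  have int: "integrable lborel (\<lambda>z. f (y + (4 * r) *\<^sub>R z) * ?\<eta> z)"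
    by (rule integrable_continuous_support[where r=1, OF cont]) (simp add: bump_term_outside[OF bump_term_eta])
  have fi: "integrable lborel (\<lambda>x. exp (- 4 / 3) * (indicator (ball y0 r) x * f x))"
    using integrable_mult_indicator[of "ball y0 r" lborel f] integrable_continuous_support[OF f_cont f_support] by simp
  have "exp (- 4 / 3) / (4 * r) ^ CARD('n) * (\<integral>x. indicator (ball y0 r) x * f x \<partial>lborel)
     = (\<integral>x. exp (- 4 / 3) * (indicator (ball y0 r) x * f x) \<partial>lborel) / \<bar>4 * r\<bar> ^ DIM(real ^ 'n)"
    using assms by simp
  also have "\<dots> = (\<integral>z. exp (- 4 / 3) * (indicator (ball y0 r) (y + (4 * r) *\<^sub>R z) * f (y + (4 * r) *\<^sub>R z)) \<partial>lborel)"
    using borel_measurable_integrable[OF fi] assms by (subst integral_affine) auto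
  also have "\<dots> \<le> (\<integral>z. f (y + (4 * r) *\<^sub>R z) * ?\<eta> z \<partial>lborel)"
  proof (rule integral_mono[OF _ int])
    show "integrable lborel (\<lambda>z. exp (- 4 / 3) * (indicator (ball y0 r) (y + (4 * r) *\<^sub>R z) * f (y + (4 * r) *\<^sub>R z)))"
      using integrable_affine[OF _ fi, of "4 * r" y] assms by simp
    fix z :: "real ^ 'n"
    show "exp (- 4 / 3) * (indicator (ball y0 r) (y + (4 * r) *\<^sub>R z) * f (y + (4 * r) *\<^sub>R z)) \<le> f (y + (4 * r) *\<^sub>R z) * ?\<eta> z"
    proof (cases "y + (4 * r) *\<^sub>R z \<in> ball y0 r")
      case True
      have "dist y (y + (4 * r) *\<^sub>R z) < 2 * r"
        using y True dist_triangle[of y "y + (4 * r) *\<^sub>R z" y0] by (simp add: dist_commute)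
      then have "norm z < 1 / 2" using assms by (simp add: dist_norm)
      then have "(norm z)\<^sup>2 < (1 / 2)\<^sup>2" by (intro power_strict_mono) auto
      then have p: "ball_profile 0 1 z > 3 / 4" "ball_profile 0 1 z \<le> 1"
        by (auto simp: ball_profile_def dot_square_norm power2_eq_square)
      define p where "p = ball_profile 0 1 z"
      have pp: "p > 3/4" "p \<le> 1" using p by (auto simp: p_def)
      have "inverse p \<le> inverse (3/4)" using pp by (intro le_imp_inverse_le) auto
      then have "exp (- 4 / 3) \<le> exp (- inverse p)" by simp
      moreover have "1 \<le> inverse p ^ 2" using pp by (intro one_le_power) (simp add: one_le_inverse)
      ultimately have "exp (- 4 / 3) * 1 \<le> exp (- inverse p) * inverse p ^ 2"
        by (intro mult_mono) auto
      then have "exp (- 4 / 3) \<le> ?\<eta> z" using pp by (simp add: exp_cutoff_def p_def[symmetric])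
      moreover have "f (y + (4 * r) *\<^sub>R z) \<ge> 0" using True assms by (intro nonneg) auto
      ultimately show ?thesis using True by (simp add: mult.commute mult_right_mono)
    next
      case False
      have "f (y + (4 * r) *\<^sub>R z) * ?\<eta> z \<ge> 0"
      proof (cases "norm z < 1")
        case True
        then have "y + (4 * r) *\<^sub>R z \<in> ball y (4 * r)" using assms by (simp add: dist_norm)
        then show ?thesis using nonneg sub by (simp add: exp_cutoff_nonneg)
      qed (use bump_term_outside[OF bump_term_eta, of z] in simp)
      then show ?thesis using False by simp
    qed
  qed
  also have "\<dots> \<le> f y * (\<integral>z. ?\<eta> z \<partial>lborel)"
    by (rule superharmonic_mean_value) (use assms sub lap in auto)
  finally show ?thesis .
qed

end

section \<open>Mollification\<close>

lemma abs_integral_le: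
  fixes f g :: "'a \<Rightarrow> real"
  assumes "integrable M f" "integrable M g" "\<And>x. \<bar>f x\<bar> \<le> g x"
  shows "\<bar>\<integral>x. f x \<partial>M\<bar> \<le> (\<integral>x. g x \<partial>M)"
proof -
  have "(\<integral>x. \<bar>f x\<bar> \<partial>M) \<le> (\<integral>x. g x \<partial>M)"
    using assms by (intro integral_mono integrable_abs) auto
  then show ?thesis by (rule order_trans[OF integral_abs_bound])
qed

lemma bump_term_bounded:
  assumes "bump_term y r f" "r > 0"
  obtains B where "B \<ge> 0" "\<And>x. \<bar>f x\<bar> \<le> B"
proof -
  have "bounded (f ` cball y r)"
    by (intro compact_imp_bounded compact_continuous_image
        continuous_on_subset[OF bump_term_continuous[OF assms(1)]]) auto
  then obtain B where B: "\<forall>x\<in>cball y r. \<bar>f x\<bar> \<le> B" by (auto simp: bounded_iff)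
  have "\<bar>f x\<bar> \<le> max B 0" for x
    using B bump_term_outside[OF assms, of x] by (cases "x \<in> cball y r") (force simp: max_def)+
  then show ?thesis using that[of "max B 0"] by simp
qed

lemma bump_term_lipschitz:
  fixes f :: "real ^ 'n::finite \<Rightarrow> real"
  assumes "bump_term y r f" "r > 0"
  obtains L where "L \<ge> 0" "\<And>x z. \<bar>f x - f z\<bar> \<le> L * norm (x - z)"
proof -
  have "\<exists>B. B \<ge> 0 \<and> (\<forall>x. \<bar>partial_derivative i f x\<bar> \<le> B)" for i
    using bump_term_bounded[of y r "partial_derivative i f"] bump_term_differentiable[OF assms(1)] assms(2)
    by metis
  then obtain B where B: "\<And>i. B i \<ge> 0" "\<And>i x. \<bar>partial_derivative i f x\<bar> \<le> B i" by metis
  have D: "(f has_derivative frechet_derivative f (at x)) (at x)" for x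
    using bump_term_differentiable[OF assms(1)] frechet_derivative_works by blast
  have bd: "onorm (frechet_derivative f (at x)) \<le> (\<Sum>i\<in>UNIV. B i)" for x
  proof (rule onorm_bound)
    fix h :: "real ^ 'n"
    have "h = (\<Sum>i\<in>UNIV. h $ i *\<^sub>R axis i 1)"
      by (simp add: basis_expansion scalar_mult_eq_scaleR[symmetric])
    then have "frechet_derivative f (at x) h = frechet_derivative f (at x) (\<Sum>i\<in>UNIV. h $ i *\<^sub>R axis i 1)"
      by simp
    also have "\<dots> = (\<Sum>i\<in>UNIV. h $ i * partial_derivative i f x)"
      using has_derivative_bounded_linear[OF D[of x]] has_derivative_linear[OF D[of x]]
      by (simp add: linear_sum linear_scale partial_derivative_def)
    also have "norm \<dots> \<le> (\<Sum>i\<in>UNIV. norm h * B i)"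
      unfolding real_norm_def
      by (rule order_trans[OF sum_abs], rule sum_mono)
        (auto simp: abs_mult intro!: mult_mono B component_le_norm_cart)
    finally show "norm (frechet_derivative f (at x) h) \<le> (\<Sum>i\<in>UNIV. B i) * norm h"
      by (simp add: sum_distrib_left mult.commute)
  qed (simp add: sum_nonneg B)
  have "\<bar>f x - f z\<bar> \<le> (\<Sum>i\<in>UNIV. B i) * norm (x - z)" for x z
    using differentiable_bound[of UNIV f "\<lambda>x. frechet_derivative f (at x)" "\<Sum>i\<in>UNIV. B i" x z] D bd by simp
  then show ?thesis using that[of "\<Sum>i\<in>UNIV. B i"] by (simp add: sum_nonneg B)
qed

definition convolution :: "(real ^ 'n::finite \<Rightarrow> real) \<Rightarrow> (real ^ 'n \<Rightarrow> real) \<Rightarrow> real ^ 'n \<Rightarrow> real" where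
  "convolution u k x = (\<integral>y. u y * k (x - y) \<partial>lborel)"

context
  fixes u k :: "real ^ 'n::finite \<Rightarrow> real" and r :: real
  assumes u: "integrable lborel u" and k: "bump_term 0 r k" and r: "r > 0"
begin

lemma [measurable]:
   "u \<in> borel_measurable borel" "k \<in> borel_measurable borel"
  using borel_measurable_integrable[OF u] bump_term_continuous[OF k]
  by (auto intro: borel_measurable_continuous_onI)

lemma integrable_convolution_kernel: "integrable lborel (\<lambda>y. u y * k (x - y))"
proof -
  obtain B where B: "B \<ge> 0" "\<And>x. \<bar>k x\<bar> \<le> B" using bump_term_bounded[OF k r] by metis
  show ?thesis
  proof (rule Bochner_Integration.integrable_bound[of _ "\<lambda>y. B * u y"])
    have "norm (u y * k (x - y)) \<le> norm (B * u y)" for y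
      using mult_left_mono[OF B(2)[of "x - y"], of "\<bar>u y\<bar>"] B(1) by (simp add: abs_mult mult.commute)
    then show "AE y in lborel. norm (u y * k (x - y)) \<le> norm (B * u y)" by simp
  qed (use u in auto)
qed

lemma convolution_continuous: "continuous_on UNIV (convolution u k)"
proof -
  obtain L where L: "L \<ge> 0" "\<And>x z. \<bar>k x - k z\<bar> \<le> L * norm (x - z)" using bump_term_lipschitz[OF k r] by metis
  have "dist (convolution u k x) (convolution u k z) \<le> (L * (\<integral>y. \<bar>u y\<bar> \<partial>lborel)) * dist x z" for x z
  proof -
    have "convolution u k x - convolution u k z = (\<integral>y. u y * (k (x - y) - k (z - y)) \<partial>lborel)"
      using integrable_convolution_kernel by (simp add: convolution_def algebra_simps)
    also have "\<bar>\<dots>\<bar> \<le> (\<integral>y. (L * norm (x - z)) * \<bar>u y\<bar> \<partial>lborel)"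
    proof (rule abs_integral_le)
      show "integrable lborel (\<lambda>y. u y * (k (x - y) - k (z - y)))"
        using integrable_convolution_kernel by (simp add: right_diff_distrib)
      show "\<bar>u y * (k (x - y) - k (z - y))\<bar> \<le> L * norm (x - z) * \<bar>u y\<bar>" for y
        using mult_left_mono[OF L(2)[of "x - y" "z - y"], of "\<bar>u y\<bar>"] by (simp add: abs_mult mult_ac)
    qed (use u in simp)
    finally show ?thesis by (simp add: dist_norm mult_ac)
  qed
  then have "(L * (\<integral>y. \<bar>u y\<bar> \<partial>lborel))-lipschitz_on UNIV (convolution u k)"
    using L(1) by (intro lipschitz_onI) auto
  then show ?thesis by (rule lipschitz_on_continuous_on)
qed

lemma convolution_outside:
  assumes "\<And>x. norm x > R \<Longrightarrow> u x = 0" "norm x > R + r"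
  shows "convolution u k x = 0"
proof -
  have "u y * k (x - y) = 0" for y
  proof (cases "norm y > R")
    case False
    then have "norm (x - y) > r" using assms(2) norm_triangle_ineq2[of x y] by linarith
    then show ?thesis using bump_term_outside[OF k r, of "x - y"] by simp
  qed (simp add: assms)
  then have "(\<lambda>y. u y * k (x - y)) = (\<lambda>y. 0)" by blast
  then show ?thesis by (simp add: convolution_def)
qed

text \<open>Lipschitz continuity of the derivatives of \<open>k\<close> gives a Taylor expansion with a remainder that is quadratic
  in \<open>h\<close>, uniformly in the base point. Integrating it against the integrable function \<open>u\<close> differentiates the
  convolution.\<close>

lemma convolution_has_derivative:
  assumes der: "\<And>x. (k has_derivative (\<lambda>h. \<Sum>i\<in>UNIV. k' i x * h $ i)) (at x)"
    and k': "\<And>i. bump_term 0 r (k' i)"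
    and k'_conv: "\<And>i x. integrable lborel (\<lambda>y. u y * k' i (x - y))"
  shows "(convolution u k has_derivative (\<lambda>h. \<Sum>i\<in>UNIV. convolution u (k' i) x * h $ i)) (at x)"
proof -
  have "\<exists>L. L \<ge> 0 \<and> (\<forall>x z. \<bar>k' i x - k' i z\<bar> \<le> L * norm (x - z))" for i
    using bump_term_lipschitz[OF k' r] by metis
  then obtain L where L: "\<And>i. L i \<ge> 0" "\<And>i x z. \<bar>k' i x - k' i z\<bar> \<le> L i * norm (x - z)" by metis
  define C where "C = (\<Sum>i\<in>UNIV. L i)"
  have C: "C \<ge> 0" by (simp add: C_def sum_nonneg L)
  have taylor: "\<bar>k (z + h) - k z - (\<Sum>i\<in>UNIV. k' i z * h $ i)\<bar> \<le> C * (norm h)\<^sup>2" for z h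
  proof -
    have "((\<lambda>t. k (z + t *\<^sub>R h)) has_real_derivative (\<Sum>i\<in>UNIV. k' i (z + t *\<^sub>R h) * h $ i)) (at t)" for t
    proof -
      have "((\<lambda>t. k (z + t *\<^sub>R h)) has_derivative (\<lambda>s. \<Sum>i\<in>UNIV. k' i (z + t *\<^sub>R h) * (s *\<^sub>R h) $ i)) (at t)"
        by (rule has_derivative_compose[of "\<lambda>t. z + t *\<^sub>R h" "\<lambda>s. s *\<^sub>R h", OF _ der]) (auto intro!: derivative_eq_intros)
      then show ?thesis
        by (rule has_derivative_imp_has_field_derivative) (simp add: sum_distrib_left mult_ac)
    qed
    from MVT2[OF zero_less_one this] obtain t where t: "0 < t" "t < 1"
      "k (z + h) - k z = (\<Sum>i\<in>UNIV. k' i (z + t *\<^sub>R h) * h $ i)" by auto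
    have "k (z + h) - k z - (\<Sum>i\<in>UNIV. k' i z * h $ i) = (\<Sum>i\<in>UNIV. (k' i (z + t *\<^sub>R h) - k' i z) * h $ i)"
      unfolding t(3) by (simp add: sum_subtractf[symmetric] left_diff_distrib)
    also have "\<bar>\<dots>\<bar> \<le> (\<Sum>i\<in>UNIV. L i * (norm h)\<^sup>2)"
    proof (rule order_trans[OF sum_abs], rule sum_mono)
      fix i
      have "\<bar>k' i (z + t *\<^sub>R h) - k' i z\<bar> \<le> L i * (t * norm h)" using L(2)[of i "z + t *\<^sub>R h" z] t by simp
      also have "\<dots> \<le> L i * norm h" using L(1) t by (intro mult_left_mono) (auto simp: mult_left_le_one_le)
      finally show "\<bar>(k' i (z + t *\<^sub>R h) - k' i z) * h $ i\<bar> \<le> L i * (norm h)\<^sup>2"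
        using mult_mono[of "\<bar>k' i (z + t *\<^sub>R h) - k' i z\<bar>" "L i * norm h" "\<bar>h $ i\<bar>" "norm h"] L(1)
        by (simp add: abs_mult component_le_norm_cart power2_eq_square mult.assoc)
    qed
    finally show ?thesis by (simp add: C_def sum_distrib_right)
  qed
  let ?L = "\<lambda>h. \<Sum>i\<in>UNIV. convolution u (k' i) x * h $ i"
  let ?U = "\<integral>y. \<bar>u y\<bar> \<partial>lborel"
  have U: "?U \<ge> 0" by simp
  have est: "\<bar>convolution u k (x + h) - convolution u k x - ?L h\<bar> \<le> C * ?U * (norm h)\<^sup>2" for h
  proof -
    have i1: "integrable lborel (\<lambda>y. \<Sum>i\<in>UNIV. u y * k' i (x - y) * h $ i)"
      by (intro Bochner_Integration.integrable_sum integrable_mult_left k'_conv)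
    have "?L h = (\<integral>y. (\<Sum>i\<in>UNIV. u y * k' i (x - y) * h $ i) \<partial>lborel)"
      by (subst Bochner_Integration.integral_sum) (auto simp: convolution_def k'_conv)
    then have "convolution u k (x + h) - convolution u k x - ?L h
      = (\<integral>y. u y * k (x + h - y) - u y * k (x - y) - (\<Sum>i\<in>UNIV. u y * k' i (x - y) * h $ i) \<partial>lborel)"
      using i1 integrable_convolution_kernel by (simp add: convolution_def)
    also have "\<bar>\<dots>\<bar> \<le> (\<integral>y. (C * (norm h)\<^sup>2) * \<bar>u y\<bar> \<partial>lborel)"
    proof (rule abs_integral_le)
      show "integrable lborel (\<lambda>y. u y * k (x + h - y) - u y * k (x - y) - (\<Sum>i\<in>UNIV. u y * k' i (x - y) * h $ i))"
        using i1 integrable_convolution_kernel by simp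
      fix y
      have "u y * k (x + h - y) - u y * k (x - y) - (\<Sum>i\<in>UNIV. u y * k' i (x - y) * h $ i)
        = u y * (k ((x - y) + h) - k (x - y) - (\<Sum>i\<in>UNIV. k' i (x - y) * h $ i))"
        by (simp add: algebra_simps sum_distrib_left)
      then show "\<bar>u y * k (x + h - y) - u y * k (x - y) - (\<Sum>i\<in>UNIV. u y * k' i (x - y) * h $ i)\<bar>
          \<le> C * (norm h)\<^sup>2 * \<bar>u y\<bar>"
        using mult_left_mono[OF taylor[of "x - y" h], of "\<bar>u y\<bar>"] by (simp add: abs_mult mult_ac)
    qed (use u in simp)
    finally show ?thesis by (simp add: mult_ac)
  qed
  show ?thesis
    unfolding has_derivative_at
  proof
    show "bounded_linear ?L"
      by (intro bounded_linear_sum bounded_linear_const_mult bounded_linear_vec_nth)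
    have lim: "((\<lambda>h::real ^ 'n. C * ?U * norm h) \<longlongrightarrow> 0) (at 0)"
      by (auto intro!: tendsto_eq_intros)
    show "(\<lambda>h. norm (convolution u k (x + h) - convolution u k x - ?L h) / norm h) \<midarrow>0\<rightarrow> 0"
    proof (rule Lim_null_comparison[OF _ lim], rule always_eventually, rule allI)
      fix h
      show "norm (norm (convolution u k (x + h) - convolution u k x - ?L h) / norm h) \<le> C * ?U * norm h"
        using est[of h] U C by (cases "h = 0") (auto simp: divide_simps power2_eq_square mult_ac)
    qed
  qed
qed

text \<open>Young's inequality for \<open>L\<^sup>1\<close>, which is Fubini's theorem for \<open>u y * k (x - y)\<close>.\<close>

lemma
  assumes k_nonneg: "\<And>x. k x \<ge> 0"
  shows integrable_convolution: "integrable lborel (convolution u k)"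
    and integral_abs_convolution_le:
      "(\<integral>x. \<bar>convolution u k x\<bar> \<partial>lborel) \<le> (\<integral>x. k x \<partial>lborel) * (\<integral>x. \<bar>u x\<bar> \<partial>lborel)"
proof -
  have ki: "integrable lborel (\<lambda>x. k (x - y))" and kI: "(\<integral>x. k (x - y) \<partial>lborel) = (\<integral>x. k x \<partial>lborel)" for y
  proof -
    have i: "integrable lborel k"
      by (rule integrable_continuous_support[where r=r, OF bump_term_continuous[OF k]])
        (use bump_term_outside[OF k r] in simp)
    show "integrable lborel (\<lambda>x. k (x - y))" "(\<integral>x. k (x - y) \<partial>lborel) = (\<integral>x. k x \<partial>lborel)"
      using integrable_affine[of 1 k "- y"] integral_affine[of 1 k "- y"] i by simp_all
  qed
  let ?f = "\<lambda>(y, x). u y * k (x - y)"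
  have prod: "integrable (lborel \<Otimes>\<^sub>M lborel) ?f"
  proof (rule lborel_pair.Fubini_integrable)
    show "?f \<in> borel_measurable (lborel \<Otimes>\<^sub>M lborel)" by measurable
    have "(\<integral>x. norm (case (y, x) of (y, x) \<Rightarrow> u y * k (x - y)) \<partial>lborel) = \<bar>u y\<bar> * (\<integral>x. k x \<partial>lborel)" for y
      using kI[of y] k_nonneg by (simp add: abs_mult)
    then show "integrable lborel (\<lambda>y. \<integral>x. norm (case (y, x) of (y, x) \<Rightarrow> u y * k (x - y)) \<partial>lborel)"
      using u by simp
    show "AE y in lborel. integrable lborel (\<lambda>x. case (y, x) of (y, x) \<Rightarrow> u y * k (x - y))"
      using ki by simp
  qed
  have prod': "integrable (lborel \<Otimes>\<^sub>M lborel) (\<lambda>(x, y). u y * k (x - y))"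
    using lborel_pair.integrable_product_swap[OF prod] by (simp add: case_prod_beta)
  show int: "integrable lborel (convolution u k)"
    using lborel_pair.integrable_fst'[OF prod'] by (simp add: convolution_def[abs_def])
  have "(\<integral>x. \<bar>convolution u k x\<bar> \<partial>lborel) \<le> (\<integral>x. (\<integral>y. \<bar>u y\<bar> * k (x - y) \<partial>lborel) \<partial>lborel)"
  proof (rule integral_mono)
    have "integrable (lborel \<Otimes>\<^sub>M lborel) (\<lambda>(x, y). \<bar>u y\<bar> * k (x - y))"
      using integrable_norm[OF prod'] k_nonneg unfolding case_prod_beta by (simp add: abs_mult)
    from lborel_pair.integrable_fst'[OF this]
    show "integrable lborel (\<lambda>x. \<integral>y. \<bar>u y\<bar> * k (x - y) \<partial>lborel)" by simp
    show "\<bar>convolution u k x\<bar> \<le> (\<integral>y. \<bar>u y\<bar> * k (x - y) \<partial>lborel)" for x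
      using integral_norm_bound[of lborel "\<lambda>y. u y * k (x - y)"] k_nonneg
      by (simp add: convolution_def abs_mult)
  qed (use int in simp)
  also have "\<dots> = (\<integral>y. (\<integral>x. \<bar>u y\<bar> * k (x - y) \<partial>lborel) \<partial>lborel)"
  proof (rule lborel_pair.Fubini_integral)
    show "integrable (lborel \<Otimes>\<^sub>M lborel) (\<lambda>(y, x). \<bar>u y\<bar> * k (x - y))"
      using integrable_norm[OF prod] k_nonneg unfolding case_prod_beta by (simp add: abs_mult)
  qed
  also have "\<dots> = (\<integral>x. k x \<partial>lborel) * (\<integral>x. \<bar>u x\<bar> \<partial>lborel)"
    by (simp add: kI)
  finally show "(\<integral>x. \<bar>convolution u k x\<bar> \<partial>lborel) \<le> (\<integral>x. k x \<partial>lborel) * (\<integral>x. \<bar>u x\<bar> \<partial>lborel)" .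
qed

end

lemma integral_pos_continuous:
  fixes f :: "'a::euclidean_space \<Rightarrow> real"
  assumes "integrable lborel f" "continuous_on UNIV f" "\<And>x. f x \<ge> 0" "f a > 0"
  shows "(\<integral>x. f x \<partial>lborel) > 0"
proof -
  have op: "open {x. f x \<noteq> 0}"
    using open_Collect_neq[OF assms(2) continuous_on_const[of UNIV 0]] by simp
  have "(\<integral>x. f x \<partial>lborel) \<noteq> 0"
  proof
    assume "(\<integral>x. f x \<partial>lborel) = 0"
    then have "AE x in lborel. f x = 0"
      using integral_nonneg_eq_0_iff_AE[of lborel f] assms by simp
    then have "{x. f x \<noteq> 0} \<in> null_sets lborel"
      using AE_iff_null_sets[of "{x. f x \<noteq> 0}" lborel] op by auto
    then have "negligible {x. f x \<noteq> 0}"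
      by (simp add: negligible_iff_null_sets null_sets_completionI)
    then show False using open_not_negligible[OF op] assms(4) by force
  qed
  moreover have "(\<integral>x. f x \<partial>lborel) \<ge> 0" using assms by (intro integral_nonneg_AE) auto
  ultimately show ?thesis by linarith
qed

text \<open>The type argument carries the dimension.\<close>

definition bump_mass :: "'n::finite itself \<Rightarrow> real \<Rightarrow> real" where
  "bump_mass _ r = (\<integral>x. bump (0 :: real ^ 'n) r x \<partial>lborel)"

lemma bump_nonneg: "bump y r x \<ge> 0"
  by (simp add: bump_def exp_cutoff_nonneg)

lemma integrable_bump_term:
  fixes y :: "real ^ 'n::finite"
  shows "bump_term y r f \<Longrightarrow> r > 0 \<Longrightarrow> integrable lborel f"
proof (rule integrable_continuous_support[where r="norm y + r"])
  fix x :: "real ^ 'n" assume a: "bump_term y r f" "r > 0" "norm x > norm y + r"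
  then have "norm (y - x) > r" using norm_triangle_ineq2[of x y] by (simp add: norm_minus_commute)
  then show "f x = 0" using bump_term_outside[OF a(1,2)] by (simp add: dist_norm)
qed (rule bump_term_continuous)

lemma bump_mass_pos: "r > 0 \<Longrightarrow> bump_mass TYPE('n::finite) r > 0"
  unfolding bump_mass_def
  by (rule integral_pos_continuous[where a=0])
    (auto intro!: integrable_bump_term[OF bump_term_bump] bump_term_continuous[OF bump_term_bump] bump_nonneg,
      simp add: bump_def exp_cutoff_pos ball_profile_pos)

definition mollify :: "real \<Rightarrow> (real ^ 'n::finite \<Rightarrow> real) \<Rightarrow> real ^ 'n \<Rightarrow> real" where
  "mollify r u x = convolution u (bump 0 r) x / bump_mass TYPE('n) r"

lemma
  assumes "integrable lborel u" "r > 0"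
  shows integrable_mollify: "integrable lborel (mollify r u)"
    and integral_abs_mollify_le: "(\<integral>x. \<bar>mollify r u x\<bar> \<partial>lborel) \<le> (\<integral>x. \<bar>u x\<bar> \<partial>lborel)"
  using integrable_convolution[OF assms(1) bump_term_bump assms(2) bump_nonneg]
    integral_abs_convolution_le[OF assms(1) bump_term_bump assms(2) bump_nonneg]
    bump_mass_pos[OF assms(2), where 'n='a]
  by (auto simp: mollify_def[abs_def] bump_mass_def field_simps)

lemma mollify_diff:
  assumes "integrable lborel u" "integrable lborel v" "r > 0"
  shows "mollify r (\<lambda>x. u x - v x) x = mollify r u x - mollify r v x"
  using integrable_convolution_kernel[OF assms(1) bump_term_bump assms(3)]
    integrable_convolution_kernel[OF assms(2) bump_term_bump assms(3)]
  by (simp add: mollify_def convolution_def left_diff_distrib diff_divide_distrib)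

lemma integral_bump_reflect: "r > 0 \<Longrightarrow> (\<integral>y. bump (0 :: real ^ 'n::finite) r (x - y) \<partial>lborel) = bump_mass TYPE('n) r"
  using integral_affine[of "-1" "bump (0 :: real ^ 'n) r" x]
    borel_measurable_integrable[OF integrable_bump_term[OF bump_term_bump, of r "0 :: real ^ 'n"]]
  by (simp add: bump_mass_def)

lemma integrable_bump_reflect: "r > 0 \<Longrightarrow> integrable lborel (\<lambda>y. bump (0 :: real ^ 'n::finite) r (x - y))"
  using integrable_affine[of "-1" "bump (0 :: real ^ 'n) r" x] integrable_bump_term[OF bump_term_bump, of r "0 :: real ^ 'n"]
  by simp

text \<open>Uniform continuity makes the mollification uniformly close, and both functions vanish outside a ball of finite
  measure that does not depend on \<open>r\<close>.\<close>

lemma mollify_continuous_approx: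
  fixes h :: "real ^ 'n::finite \<Rightarrow> real"
  assumes h: "continuous_on UNIV h" "\<And>x. norm x > R \<Longrightarrow> h x = 0" and "e > 0"
  shows "\<exists>\<delta>>0. \<forall>r. 0 < r \<and> r < \<delta> \<longrightarrow> (\<integral>x. \<bar>mollify r h x - h x\<bar> \<partial>lborel) \<le> e"
proof -
  define M where "M = measure lborel (cball 0 (R + 1) :: (real ^ 'n) set)"
  have M: "M \<ge> 0" by (simp add: M_def)
  define e' where "e' = e / (M + 1)"
  have e': "e' > 0" using assms M by (simp add: e'_def)
  have hi: "integrable lborel h" by (rule integrable_continuous_support[OF h])
  have "uniformly_continuous_on (cball 0 (R + 2)) h"
    by (rule compact_uniformly_continuous) (auto intro: continuous_on_subset[OF h(1)])
  then obtain d where d: "d > 0" "\<And>x y. x \<in> cball 0 (R + 2) \<Longrightarrow> y \<in> cball 0 (R + 2) \<Longrightarrow> dist y x < d \<Longrightarrow> dist (h y) (h x) < e'"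
    using e' unfolding uniformly_continuous_on_def by metis
  have osc: "\<bar>h y - h x\<bar> \<le> e'" if "dist y x < min d 1" for x y
  proof (cases "norm x \<le> R + 1")
    case True
    then have "norm y \<le> R + 2" using that norm_triangle_ineq2[of y x] by (simp add: dist_norm)
    then show ?thesis using d(2)[of x y] True that by (simp add: dist_norm)
  next
    case False
    then have "norm y > R" "norm x > R" using that norm_triangle_ineq2[of x y] by (auto simp: dist_norm norm_minus_commute)
    then show ?thesis using h e' by simp
  qed
  show ?thesis
  proof (intro exI[of _ "min d 1"] conjI allI impI)
    show "min d 1 > 0" using d by simp
    fix r assume r: "0 < r \<and> r < min d 1"
    then have r0: "r > 0" by simp
    have diff: "\<bar>mollify r h x - h x\<bar> \<le> e'" for x
    proof -
      have "convolution h (bump 0 r) x - h x * bump_mass TYPE('n) r = (\<integral>y. (h y - h x) * bump 0 r (x - y) \<partial>lborel)"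
        using integrable_convolution_kernel[OF hi bump_term_bump r0, of x] integrable_bump_reflect[OF r0, of x]
        by (simp add: convolution_def left_diff_distrib integral_bump_reflect[OF r0])
      also have "\<bar>\<dots>\<bar> \<le> (\<integral>y. e' * bump 0 r (x - y) \<partial>lborel)"
      proof (rule abs_integral_le)
        show "integrable lborel (\<lambda>y. (h y - h x) * bump 0 r (x - y))"
          using integrable_convolution_kernel[OF hi bump_term_bump r0, of x] integrable_bump_reflect[OF r0, of x]
          by (simp add: left_diff_distrib)
        show "integrable lborel (\<lambda>y. e' * bump 0 r (x - y))"
          using integrable_bump_reflect[OF r0, of x] by simp
        show "\<bar>(h y - h x) * bump 0 r (x - y)\<bar> \<le> e' * bump 0 r (x - y)" for y
        proof (cases "dist y x < r")
          case True
          then show ?thesis using osc[of y x] r by (simp add: abs_mult bump_nonneg mult_right_mono)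
        next
          case False
          then have "bump 0 r (x - y) = 0"
            by (intro bump_term_outside[OF bump_term_bump r0]) (simp add: dist_norm norm_minus_commute)
          then show ?thesis by simp
        qed
      qed
      also have "\<dots> = e' * bump_mass TYPE('n) r" by (simp add: integral_bump_reflect[OF r0])
      finally show ?thesis
        using bump_mass_pos[OF r0, where 'n='n]
        by (simp add: mollify_def field_simps abs_le_iff)
    qed
    have outside: "mollify r h x - h x = 0" if "norm x > R + 1" for x
      using convolution_outside[OF hi bump_term_bump r0, of R x] h(2) that r h(2)[of x] by (simp add: mollify_def)
    have "(\<integral>x. \<bar>mollify r h x - h x\<bar> \<partial>lborel) \<le> (\<integral>x. e' * indicator (cball (0 :: real ^ 'n) (R + 1)) x \<partial>lborel)"
    proof (rule integral_mono)
      show "integrable lborel (\<lambda>x. \<bar>mollify r h x - h x\<bar>)"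
        using integrable_mollify[OF hi r0] hi by simp
      show "integrable lborel (\<lambda>x. e' * indicator (cball (0 :: real ^ 'n) (R + 1)) x :: real)"
        by (intro integrable_mult_right integrable_real_indicator) 
          (use emeasure_bounded_finite[OF bounded_cball] in \<open>auto simp: infinity_ennreal_def\<close>)
      show "\<bar>mollify r h x - h x\<bar> \<le> e' * indicator (cball 0 (R + 1)) x" for x
        using diff[of x] outside[of x] by (simp split: split_indicator)
    qed
    also have "\<dots> = e' * M" by (simp add: M_def)
    also have "\<dots> \<le> e" using M assms(3) by (simp add: e'_def field_simps)
    finally show "(\<integral>x. \<bar>mollify r h x - h x\<bar> \<partial>lborel) \<le> e" .
  qed
qed

lemma indicator_continuous_approx:
  fixes A :: "'a::euclidean_space set" and e :: real
  assumes A: "A \<in> sets lborel" "A \<subseteq> cball 0 R" and "e > 0"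
  shows "\<exists>h. continuous_on UNIV h \<and> (\<forall>x. norm x > R + 1 \<longrightarrow> h x = 0) \<and> (\<integral>x. \<bar>indicator A x - h x\<bar> \<partial>lborel) \<le> e"
proof -
  have AL: "A \<in> sets lebesgue" using A by simp
  obtain T where T: "closed T" "T \<subseteq> A" "A - T \<in> lmeasurable" "emeasure lebesgue (A - T) < ennreal (e/2)"
    using sets_lebesgue_inner_closed[OF AL, of "e/2"] assms by auto
  obtain G where G: "open G" "A \<subseteq> G" "G - A \<in> lmeasurable" "emeasure lebesgue (G - A) < ennreal (e/2)"
    using sets_lebesgue_outer_open[OF AL, of "e/2"] assms by auto
  define G' where "G' = G \<inter> ball 0 (R + 1)"
  have "T \<inter> (- G') = {}" using T G A by (auto simp: G'_def)
  moreover have "closed (- G')" using G by (auto simp: G'_def closed_def intro!: open_Int)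
  ultimately obtain h :: "'a \<Rightarrow> real" where h: "continuous_on UNIV h" "\<And>x. h x \<in> closed_segment 1 0"
     "\<And>x. x \<in> T \<Longrightarrow> h x = 1" "\<And>x. x \<in> - G' \<Longrightarrow> h x = 0"
    using Urysohn[OF T(1)] by blast
  have h01: "0 \<le> h x" "h x \<le> 1" for x
    using h(2)[of x] by (auto simp: closed_segment_eq_real_ivl)
  have supp: "h x = 0" if "norm x > R + 1" for x using that by (intro h(4)) (auto simp: G'_def)
  have hi: "integrable lborel h" by (rule integrable_continuous_support[OF h(1) supp])
  have fin: "emeasure lborel A < \<infinity>"
    using emeasure_bounded_finite[of A] A bounded_subset[OF bounded_cball] by blast
  have Ai: "integrable lborel (indicator A :: 'a \<Rightarrow> real)" using A fin by simp
  have Ai': "integrable lebesgue (\<lambda>x. \<bar>indicator A x - h x\<bar> :: real)"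
    using Ai hi by (subst integrable_completion) auto
  have "(\<integral>x. \<bar>indicator A x - h x\<bar> \<partial>lborel) = (\<integral>x. \<bar>indicator A x - h x\<bar> \<partial>lebesgue)"
    using borel_measurable_integrable[OF Ai] borel_measurable_integrable[OF hi]
    by (subst integral_completion) auto
  also have "\<dots> \<le> (\<integral>x. indicator (A - T) x + indicator (G - A) x \<partial>lebesgue)"
  proof (rule integral_mono[OF Ai'])
    show "integrable lebesgue (\<lambda>x. indicator (A - T) x + indicator (G - A) x :: real)"
      using T(3) G(3) by (intro Bochner_Integration.integrable_add integrable_real_indicator) (auto simp: fmeasurable_def)
    show "\<bar>indicator A x - h x\<bar> \<le> indicator (A - T) x + indicator (G - A) x" for x
      using h01[of x] h(3)[of x] h(4)[of x] T(2) G(2) by (auto simp: G'_def split: split_indicator)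
  qed
  also have "\<dots> = measure lebesgue (A - T) + measure lebesgue (G - A)"
    using T(3) G(3) by (subst Bochner_Integration.integral_add) (auto simp: fmeasurable_def)
  also have "\<dots> \<le> e / 2 + e / 2"
    using T(3,4) G(3,4) assms(3) emeasure_eq_measure2[OF T(3)] emeasure_eq_measure2[OF G(3)]
    by (intro add_mono) (auto simp: ennreal_less_iff)
  finally show ?thesis using h(1) supp by auto
qed

text \<open>Density of compactly supported continuous functions in \<open>L\<^sup>1\<close> of a ball. Cutting off with the ball keeps the
  sets that occur in the induction bounded, so that the supports stay compact.\<close>

lemma integrable_continuous_approx:
  fixes u :: "'a::euclidean_space \<Rightarrow> real"
  assumes "integrable lborel u" "e > 0"
  shows "\<exists>h. continuous_on UNIV h \<and> (\<forall>x. norm x > R + 1 \<longrightarrow> h x = 0)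
    \<and> (\<integral>x. \<bar>indicator (cball 0 R) x * u x - h x\<bar> \<partial>lborel) \<le> e"
  using assms
proof (induction arbitrary: e rule: integrable_induct)
  case (base A c)
  define c' where "c' = \<bar>c\<bar> + 1"
  have c': "c' > 0" "\<bar>c\<bar> \<le> c'" by (auto simp: c'_def)
  have "A \<inter> cball 0 R \<in> sets lborel" using base by auto
  from indicator_continuous_approx[OF this, of R "e / c'"] base c'
  obtain h where h: "continuous_on UNIV h" "\<forall>x. norm x > R + 1 \<longrightarrow> h x = 0"
    "(\<integral>x. \<bar>indicator (A \<inter> cball 0 R) x - h x\<bar> \<partial>lborel) \<le> e / c'" by auto
  have "(\<integral>x. \<bar>indicator (cball 0 R) x * (indicator A x *\<^sub>R c) - c * h x\<bar> \<partial>lborel)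
     = (\<integral>x. \<bar>c\<bar> * \<bar>indicator (A \<inter> cball 0 R) x - h x\<bar> \<partial>lborel)"
    by (rule Bochner_Integration.integral_cong) (auto simp: abs_mult[symmetric] algebra_simps split: split_indicator)
  also have "\<dots> = \<bar>c\<bar> * (\<integral>x. \<bar>indicator (A \<inter> cball 0 R) x - h x\<bar> \<partial>lborel)" by simp
  also have "\<dots> \<le> c' * (e / c')" using h(3) c' by (intro mult_mono) auto
  finally show ?case using h c' by (intro exI[of _ "\<lambda>x. c * h x"]) (auto intro!: continuous_intros)
next
  case (add f g)
  obtain h1 where h1: "continuous_on UNIV h1" "\<forall>x. norm x > R + 1 \<longrightarrow> h1 x = 0"
    "(\<integral>x. \<bar>indicator (cball 0 R) x * f x - h1 x\<bar> \<partial>lborel) \<le> e / 2"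
    using add(3)[of "e/2"] add.prems by auto
  obtain h2 where h2: "continuous_on UNIV h2" "\<forall>x. norm x > R + 1 \<longrightarrow> h2 x = 0"
    "(\<integral>x. \<bar>indicator (cball 0 R) x * g x - h2 x\<bar> \<partial>lborel) \<le> e / 2"
    using add(4)[of "e/2"] add.prems by auto
  have i: "integrable lborel h1" "integrable lborel h2"
    using integrable_continuous_support[of h1 "R + 1"] integrable_continuous_support[of h2 "R + 1"] h1 h2 by auto
  have j: "integrable lborel (\<lambda>x. indicator (cball 0 R) x * f x)" "integrable lborel (\<lambda>x. indicator (cball 0 R) x * g x)"
    using integrable_mult_indicator[OF _ add(1), of "cball 0 R"] integrable_mult_indicator[OF _ add(2), of "cball 0 R"] by auto
  have "(\<integral>x. \<bar>indicator (cball 0 R) x * (f x + g x) - (h1 x + h2 x)\<bar> \<partial>lborel)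
     \<le> (\<integral>x. \<bar>indicator (cball 0 R) x * f x - h1 x\<bar> + \<bar>indicator (cball 0 R) x * g x - h2 x\<bar> \<partial>lborel)"
    using i j by (intro integral_mono) (auto simp: distrib_left)
  also have "\<dots> \<le> e" using i j h1(3) h2(3) by (subst Bochner_Integration.integral_add) auto
  finally show ?case using h1 h2 by (intro exI[of _ "\<lambda>x. h1 x + h2 x"]) (auto intro!: continuous_intros)
next
  case (lim f s)
  have "(\<lambda>i. \<integral>x. \<bar>f x - s i x\<bar> \<partial>lborel) \<longlonglongrightarrow> (\<integral>x. (0::real) \<partial>(lborel :: 'a measure))"
  proof (rule integral_dominated_convergence[where w="\<lambda>x. 3 * \<bar>f x\<bar>"])
    show "AE x in lborel. (\<lambda>i. \<bar>f x - s i x\<bar>) \<longlonglongrightarrow> 0"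
    proof (rule AE_I2)
      fix x :: 'a
      have "(\<lambda>i. \<bar>f x - s i x\<bar>) \<longlonglongrightarrow> \<bar>f x - f x\<bar>" by (intro tendsto_intros lim(2)) simp
      then show "(\<lambda>i. \<bar>f x - s i x\<bar>) \<longlonglongrightarrow> 0" by simp
    qed
    show "AE x in lborel. norm \<bar>f x - s i x\<bar> \<le> 3 * \<bar>f x\<bar>" for i
    proof (rule AE_I2)
      fix x show "norm \<bar>f x - s i x\<bar> \<le> 3 * \<bar>f x\<bar>" using lim(3)[of x i] by simp
    qed
  qed (use lim in auto)
  then have "\<exists>i. (\<integral>x. \<bar>f x - s i x\<bar> \<partial>lborel) < e / 2"
    using lim.prems order_tendstoD(2)[of _ 0 sequentially "e/2"] by (auto simp: eventually_sequentially)
  then obtain i where i: "(\<integral>x. \<bar>f x - s i x\<bar> \<partial>lborel) < e / 2" by blast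
  obtain h where h: "continuous_on UNIV h" "\<forall>x. norm x > R + 1 \<longrightarrow> h x = 0"
    "(\<integral>x. \<bar>indicator (cball 0 R) x * s i x - h x\<bar> \<partial>lborel) \<le> e / 2"
    using lim(5)[of "e/2" i] lim.prems by auto
  have hi: "integrable lborel h" using integrable_continuous_support[of h "R + 1"] h by auto
  have j: "integrable lborel (\<lambda>x. indicator (cball 0 R) x * f x)" "integrable lborel (\<lambda>x. indicator (cball 0 R) x * s i x)"
    using integrable_mult_indicator[OF _ lim(4), of "cball 0 R"] integrable_mult_indicator[OF _ lim(1), of "cball 0 R"] by auto
  have "(\<integral>x. \<bar>indicator (cball 0 R) x * f x - h x\<bar> \<partial>lborel)
     \<le> (\<integral>x. \<bar>f x - s i x\<bar> + \<bar>indicator (cball 0 R) x * s i x - h x\<bar> \<partial>lborel)"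
    using hi j lim(1,4) by (intro integral_mono) (auto split: split_indicator)
  also have "\<dots> \<le> e" using hi j lim(1,4) h(3) i by (subst Bochner_Integration.integral_add) auto
  finally show ?case using h by auto
qed

text \<open>Mollification does not increase the \<open>L\<^sup>1\<close> norm, so it suffices to have convergence on a dense set.\<close>

lemma mollify_L1_convergence:
  fixes u :: "real ^ 'n::finite \<Rightarrow> real"
  assumes u: "integrable lborel u" "\<And>x. norm x > R \<Longrightarrow> u x = 0" and "e > 0"
  shows "\<exists>\<delta>>0. \<forall>r. 0 < r \<and> r < \<delta> \<longrightarrow> (\<integral>x. \<bar>mollify r u x - u x\<bar> \<partial>lborel) \<le> e"
proof -
  have cut: "indicator (cball 0 R) x * u x = u x" for x using u(2)[of x] by (auto split: split_indicator)
  obtain h where h: "continuous_on UNIV h" "\<forall>x. norm x > R + 1 \<longrightarrow> h x = 0"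
    "(\<integral>x. \<bar>u x - h x\<bar> \<partial>lborel) \<le> e / 3"
    using integrable_continuous_approx[OF u(1), of "e/3" R] assms(3) unfolding cut by auto
  have hi: "integrable lborel h" using integrable_continuous_support[of h "R + 1"] h by auto
  obtain \<delta> where \<delta>: "\<delta> > 0" "\<And>r. 0 < r \<Longrightarrow> r < \<delta> \<Longrightarrow> (\<integral>x. \<bar>mollify r h x - h x\<bar> \<partial>lborel) \<le> e / 3"
    using mollify_continuous_approx[of h "R + 1" "e/3"] h assms(3) by auto
  show ?thesis
  proof (intro exI[of _ \<delta>] conjI allI impI \<delta>(1))
    fix r assume r: "0 < r \<and> r < \<delta>"
    then have r0: "r > 0" by simp
    have i: "integrable lborel (mollify r u)" "integrable lborel (mollify r h)"
      using integrable_mollify[OF _ r0] u hi by auto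
    have uh: "integrable lborel (\<lambda>x. u x - h x)" using u hi by simp
    have c: "(\<integral>x. \<bar>mollify r u x - mollify r h x\<bar> \<partial>lborel) \<le> e / 3"
      using integral_abs_mollify_le[OF uh r0] h(3) by (simp add: mollify_diff[OF u(1) hi r0])
    have "(\<integral>x. \<bar>mollify r u x - u x\<bar> \<partial>lborel)
      \<le> (\<integral>x. \<bar>mollify r u x - mollify r h x\<bar> + (\<bar>mollify r h x - h x\<bar> + \<bar>u x - h x\<bar>) \<partial>lborel)"
      using i hi u(1) by (intro integral_mono) auto
    also have "\<dots> = (\<integral>x. \<bar>mollify r u x - mollify r h x\<bar> \<partial>lborel) + ((\<integral>x. \<bar>mollify r h x - h x\<bar> \<partial>lborel) + (\<integral>x. \<bar>u x - h x\<bar> \<partial>lborel))"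
      using i hi u(1) by simp
    also have "\<dots> \<le> e" using c h(3) \<delta>(2)[of r] r by simp
    finally show "(\<integral>x. \<bar>mollify r u x - u x\<bar> \<partial>lborel) \<le> e" .
  qed
qed

lemma ball_profile_shift: "ball_profile 0 r (x - y) = ball_profile y r x"
  by (simp add: ball_profile_def)

lemma bump_shift: "bump 0 r (x - y) = bump x r y"
  using bump_commute[of y r x] by (simp add: bump_def ball_profile_shift)

lemma bump2_shift: "bump2 i j 0 r (x - y) = bump2 i j x r y"
  using bump2_commute[of i j y r x] by (simp add: bump2_def ball_profile_shift)

text \<open>Derivatives of a mollification fall on the kernel.\<close>

lemma compact_C2_mollify:
  fixes u :: "real ^ 'n::finite \<Rightarrow> real"
  assumes u: "integrable lborel u" "\<And>x. norm x > R \<Longrightarrow> u x = 0" and r: "r > 0"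
  shows "compact_C2 (mollify r u) (\<lambda>i x. convolution u (bump1 i 0 r) x / bump_mass TYPE('n) r)
     (\<lambda>i j x. convolution u (bump2 i j 0 r) x / bump_mass TYPE('n) r) (R + r)"
proof
  let ?m = "bump_mass TYPE('n) r"
  note conv0 = convolution_has_derivative[OF u(1) bump_term_bump r has_derivative_bump0 bump_term_bump1
     integrable_convolution_kernel[OF u(1) bump_term_bump1 r]]
  note conv1 = convolution_has_derivative[OF u(1) bump_term_bump1 r has_derivative_bump1 bump_term_bump2
     integrable_convolution_kernel[OF u(1) bump_term_bump2 r]]
  fix x :: "real ^ 'n" and i j :: 'n
  show "(mollify r u has_derivative (\<lambda>h. \<Sum>i\<in>UNIV. convolution u (bump1 i 0 r) x / ?m * h $ i)) (at x)"
    unfolding mollify_def[abs_def]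
    by (rule has_derivative_eq_rhs[OF has_derivative_divide'[OF conv0 has_derivative_const]]) 
       (use bump_mass_pos[OF r, where 'n='n] in \<open>simp_all add: fun_eq_iff sum_divide_distrib field_simps\<close>)
  show "((\<lambda>x. convolution u (bump1 i 0 r) x / ?m) has_derivative
      (\<lambda>h. \<Sum>j\<in>UNIV. convolution u (bump2 i j 0 r) x / ?m * h $ j)) (at x)"
    by (rule has_derivative_eq_rhs[OF has_derivative_divide'[OF conv1 has_derivative_const]]) 
       (use bump_mass_pos[OF r, where 'n='n] in \<open>simp_all add: fun_eq_iff sum_divide_distrib field_simps\<close>)
  show "continuous_on UNIV (\<lambda>x. convolution u (bump2 i j 0 r) x / ?m)"
    using bump_mass_pos[OF r, where 'n='n]
    by (intro continuous_intros convolution_continuous[OF u(1) bump_term_bump2 r]) auto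
  show "convolution u (bump2 i j 0 r) x / ?m = convolution u (bump2 j i 0 r) x / ?m"
    by (simp add: convolution_def bump2_sym[of i j])
  assume x: "norm x > R + r"
  show "mollify r u x = 0" "convolution u (bump1 i 0 r) x / ?m = 0" "convolution u (bump2 i j 0 r) x / ?m = 0"
    using convolution_outside[OF u(1) bump_term_bump r, of R x] convolution_outside[OF u(1) bump_term_bump1 r, of R x]
     convolution_outside[OF u(1) bump_term_bump2 r, of R x] u(2) x by (simp_all add: mollify_def)
qed

text \<open>The Laplacian of the mollification at \<open>x\<close> is the pairing of \<open>u\<close> with the Laplacian of a bump function about
  \<open>x\<close>. This is where a weak equation for \<open>u\<close> turns into a classical one for its mollification.\<close>

lemma lap_mollify:
  fixes u :: "real ^ 'n::finite \<Rightarrow> real"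
  assumes u: "integrable lborel u" "\<And>x. norm x > R \<Longrightarrow> u x = 0" and r: "r > 0"
  shows "compact_C2.lap (\<lambda>i j x. convolution u (bump2 i j 0 r) x / bump_mass TYPE('n) r) x
     = (\<integral>y. u y * laplacian (bump x r) y \<partial>lborel) / bump_mass TYPE('n) r"
proof -
  have "(\<integral>y. u y * laplacian (bump x r) y \<partial>lborel) = (\<integral>y. (\<Sum>i\<in>UNIV. u y * bump2 i i 0 r (x - y)) \<partial>lborel)"
    by (simp add: laplacian_bump bump2_shift sum_distrib_left)
  also have "\<dots> = (\<Sum>i\<in>UNIV. convolution u (bump2 i i 0 r) x)"
    unfolding convolution_def
    by (rule Bochner_Integration.integral_sum) (rule integrable_convolution_kernel[OF u(1) bump_term_bump2 r])
  finally show ?thesis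
    by (simp add: compact_C2.lap_def[OF compact_C2_mollify[OF u r]] sum_divide_distrib)
qed

lemma mollify_eq: "mollify r u x = (\<integral>y. u y * bump x r y \<partial>lborel) / bump_mass TYPE('n) r"
  for u :: "real ^ 'n::finite \<Rightarrow> real"
  by (simp add: mollify_def convolution_def bump_shift)

lemma abs_mollify_le:
  fixes u :: "real ^ 'n::finite \<Rightarrow> real"
  assumes u: "integrable lborel u" "\<And>x. \<bar>u x\<bar> \<le> M" and r: "r > 0"
  shows "\<bar>mollify r u x\<bar> \<le> M"
proof -
  have "\<bar>\<integral>y. u y * bump 0 r (x - y) \<partial>lborel\<bar> \<le> (\<integral>y. M * bump 0 r (x - y) \<partial>lborel)"
    by (rule abs_integral_le)
      (use integrable_convolution_kernel[OF u(1) bump_term_bump r] integrable_bump_reflect[OF r] u(2) in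
        \<open>auto simp: abs_mult bump_nonneg intro!: mult_right_mono\<close>)
  also have "\<dots> = M * bump_mass TYPE('n) r" by (simp add: integral_bump_reflect[OF r])
  finally show ?thesis
    using bump_mass_pos[OF r, where 'n='n] by (simp add: mollify_def convolution_def field_simps abs_le_iff)
qed

text \<open>A sequence of mollification radii in the open unit interval that tends to \<open>0\<close>.\<close>

definition eps :: "nat \<Rightarrow> real" where "eps k = inverse (real (Suc (Suc k)))"

lemma eps: "0 < eps k" "eps k < 1"
  by (auto simp: eps_def inverse_less_1_iff)

lemma eps_LIMSEQ: "eps \<longlonglongrightarrow> 0"
  unfolding eps_def[abs_def] using LIMSEQ_inverse_real_of_nat[THEN LIMSEQ_Suc] by simp

lemma mollify_L1_LIMSEQ:
  fixes u :: "real ^ 'n::finite \<Rightarrow> real"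
  assumes u: "integrable lborel u" "\<And>x. norm x > R \<Longrightarrow> u x = 0"
  shows "(\<lambda>k. \<integral>x. \<bar>mollify (eps k) u x - u x\<bar> \<partial>lborel) \<longlonglongrightarrow> 0"
proof (rule tendstoI)
  fix e :: real assume "e > 0"
  then obtain \<delta> where \<delta>: "\<delta> > 0" "\<And>r. 0 < r \<Longrightarrow> r < \<delta> \<Longrightarrow> (\<integral>x. \<bar>mollify r u x - u x\<bar> \<partial>lborel) \<le> e / 2"
    using mollify_L1_convergence[OF u, of R "e/2"] by auto
  have "\<forall>\<^sub>F k in sequentially. eps k < \<delta>" using order_tendstoD(2)[OF eps_LIMSEQ \<delta>(1)] .
  then show "\<forall>\<^sub>F k in sequentially. dist (\<integral>x. \<bar>mollify (eps k) u x - u x\<bar> \<partial>lborel) 0 < e"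
  proof eventually_elim
    case (elim k)
    then have "(\<integral>x. \<bar>mollify (eps k) u x - u x\<bar> \<partial>lborel) \<le> e / 2" using \<delta>(2) eps by simp
    then show ?case using \<open>e > 0\<close> by (simp add: dist_norm)
  qed
qed

lemma integral_weighted_LIMSEQ:
  fixes u :: "real ^ 'n::finite \<Rightarrow> real"
  assumes u: "integrable lborel u" "\<And>x. norm x > R \<Longrightarrow> u x = 0"
    and int: "\<And>k. integrable lborel (F k)" "integrable lborel F'"
    and bound: "\<And>k x. \<bar>F k x - F' x\<bar> \<le> K * \<bar>mollify (eps k) u x - u x\<bar>"
  shows "(\<lambda>k. \<integral>x. F k x \<partial>lborel) \<longlonglongrightarrow> (\<integral>x. F' x \<partial>lborel)"
proof (rule LIM_zero_cancel, rule Lim_null_comparison)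
  show "\<forall>\<^sub>F k in sequentially. norm ((\<integral>x. F k x \<partial>lborel) - (\<integral>x. F' x \<partial>lborel))
      \<le> K * (\<integral>x. \<bar>mollify (eps k) u x - u x\<bar> \<partial>lborel)"
  proof (rule always_eventually, rule allI)
    fix k
    have "\<bar>\<integral>x. F k x - F' x \<partial>lborel\<bar> \<le> (\<integral>x. K * \<bar>mollify (eps k) u x - u x\<bar> \<partial>lborel)"
      using int bound u(1) integrable_mollify[OF u(1) eps(1)]
      by (intro abs_integral_le) auto
    then show "norm ((\<integral>x. F k x \<partial>lborel) - (\<integral>x. F' x \<partial>lborel))
        \<le> K * (\<integral>x. \<bar>mollify (eps k) u x - u x\<bar> \<partial>lborel)"
      using int by simp
  qed
  show "(\<lambda>k. K * (\<integral>x. \<bar>mollify (eps k) u x - u x\<bar> \<partial>lborel)) \<longlonglongrightarrow> 0"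
  proof -
    have "(\<lambda>k. \<integral>x. \<bar>mollify (eps k) u x - u x\<bar> \<partial>lborel) \<longlonglongrightarrow> 0"
      by (rule mollify_L1_LIMSEQ[OF u])
    from tendsto_mult_left[OF this, of K] show ?thesis by simp
  qed
qed

text \<open>Dilating the unit bump: its mass scales like the volume of the ball.\<close>

lemma bump_mass_scale:
  assumes "r > 0" shows "bump_mass TYPE('n::finite) r = r ^ CARD('n) * bump_mass TYPE('n) 1"
proof -
  have "(\<integral>x. bump (0 :: real ^ 'n) r (0 + r *\<^sub>R x) \<partial>lborel) = bump_mass TYPE('n) r / \<bar>r\<bar> ^ DIM(real ^ 'n)"
    unfolding bump_mass_def using assms borel_measurable_integrable[OF integrable_bump_term[OF bump_term_bump assms]]
    by (intro integral_affine) auto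
  moreover have "bump (0 :: real ^ 'n) r (0 + r *\<^sub>R x) = bump 0 1 x" for x
    using assms by (simp add: bump_def ball_profile_def power2_eq_square)
  ultimately show ?thesis using assms by (simp add: bump_mass_def field_simps)
qed

lemma bump_le_1: "bump y r x \<le> 1"
  by (simp add: bump_def exp_cutoff_def)

section \<open>Solutions with compact support\<close>

text \<open>The function \<open>g = V u\<close> may be unbounded at the origin, but \<open>|y|\<^sup>j g\<close> is bounded for large \<open>j\<close>. On the support
  of the kernel \<open>|x|\<^sup>j \<le> 2\<^sup>j (r\<^sup>j + |y|\<^sup>j)\<close>. The contribution of \<open>|y|\<^sup>j\<close> is controlled by the bound for \<open>|y|\<^sup>j g\<close>, and that of \<open>r\<^sup>j\<close> by
  the \<open>L\<^sup>1\<close> norm of \<open>g\<close>: the normalised kernel is at most of order \<open>r^(-n)\<close> in dimension \<open>n\<close>, and \<open>j \<ge> n\<close>.\<close>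

lemma weighted_mollify_bound:
  fixes g :: "real ^ 'n::finite \<Rightarrow> real"
  assumes g: "integrable lborel g" and j: "CARD('n) \<le> j" and M: "\<And>y. norm y ^ j * \<bar>g y\<bar> \<le> M"
    and r: "0 < r" "r \<le> 1"
  shows "norm x ^ j * \<bar>mollify r g x\<bar> \<le> 2 ^ j * ((\<integral>y. \<bar>g y\<bar> \<partial>lborel) / bump_mass TYPE('n) 1 + M)"
proof -
  let ?m = "bump_mass TYPE('n) r" and ?G = "\<integral>y. \<bar>g y\<bar> \<partial>lborel"
  have m: "?m > 0" using bump_mass_pos[OF r(1)] .
  have "norm x ^ j * \<bar>convolution g (bump 0 r) x\<bar> = \<bar>\<integral>y. norm x ^ j * (g y * bump 0 r (x - y)) \<partial>lborel\<bar>"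
    by (simp add: convolution_def abs_mult)
  also have "\<dots> \<le> (\<integral>y. 2 ^ j * (r ^ j * \<bar>g y\<bar> + M * bump 0 r (x - y)) \<partial>lborel)"
  proof (rule abs_integral_le)
    show "integrable lborel (\<lambda>y. norm x ^ j * (g y * bump 0 r (x - y)))"
      using integrable_convolution_kernel[OF g bump_term_bump r(1)] by simp
    show "integrable lborel (\<lambda>y. 2 ^ j * (r ^ j * \<bar>g y\<bar> + M * bump 0 r (x - y)))"
      by (intro integrable_mult_right Bochner_Integration.integrable_add integrable_abs g integrable_bump_reflect r)
    fix y
    let ?b = "bump 0 r (x - y)"
    have b: "0 \<le> ?b" "?b \<le> 1" by (simp_all add: bump_nonneg bump_le_1)
    have M0: "M \<ge> 0" using M[of y] by (meson order_trans abs_ge_zero mult_nonneg_nonneg norm_ge_zero zero_le_power)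
    show "\<bar>norm x ^ j * (g y * ?b)\<bar> \<le> 2 ^ j * (r ^ j * \<bar>g y\<bar> + M * ?b)"
    proof (cases "norm (x - y) < r")
      case True
      have "norm x \<le> norm (x - y) + norm y" by (metis add.commute norm_triangle_sub)
      then have "norm x \<le> 2 * max r (norm y)" using True by linarith
      then have "norm x ^ j \<le> (2 * max r (norm y)) ^ j" by (intro power_mono) auto
      also have "\<dots> = 2 ^ j * (max r (norm y)) ^ j" by (simp add: power_mult_distrib)
      also have "(max r (norm y)) ^ j \<le> r ^ j + norm y ^ j" using r by (simp add: max_def)
      finally have "norm x ^ j \<le> 2 ^ j * (r ^ j + norm y ^ j)" by simp
      then have "norm x ^ j * (\<bar>g y\<bar> * ?b) \<le> 2 ^ j * (r ^ j + norm y ^ j) * (\<bar>g y\<bar> * ?b)"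
        using b by (intro mult_right_mono) auto
      also have "\<dots> = 2 ^ j * (r ^ j * \<bar>g y\<bar> * ?b + (norm y ^ j * \<bar>g y\<bar>) * ?b)" by (simp add: algebra_simps)
      also have "\<dots> \<le> 2 ^ j * (r ^ j * \<bar>g y\<bar> * 1 + M * ?b)"
        using b M r by (intro mult_left_mono add_mono mult_right_mono) auto
      finally show ?thesis using b by (simp add: abs_mult)
    next
      case False
      then have "?b = 0" using bump_term_outside[OF bump_term_bump r(1), of "x - y" 0] by simp
      then show ?thesis using r by simp
    qed
  qed
  also have "\<dots> = 2 ^ j * (r ^ j * ?G + M * ?m)"
    using g integrable_bump_reflect[OF r(1), of x] by (simp add: integral_bump_reflect[OF r(1)])
  finally have "norm x ^ j * \<bar>mollify r g x\<bar> \<le> 2 ^ j * (r ^ j * ?G + M * ?m) / ?m"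
    using m by (simp add: mollify_def divide_right_mono)
  also have "\<dots> = 2 ^ j * (r ^ j / ?m * ?G + M)" using m by (simp add: field_simps)
  also have "\<dots> \<le> 2 ^ j * (1 / bump_mass TYPE('n) 1 * ?G + M)"
  proof -
    have "r ^ j \<le> r ^ CARD('n)" using r j by (intro power_decreasing) auto
    then have "r ^ j / ?m \<le> r ^ CARD('n) / ?m" using m by (simp add: divide_right_mono)
    also have "\<dots> = 1 / bump_mass TYPE('n) 1" using r by (simp add: bump_mass_scale[OF r(1)])
    finally show ?thesis by (intro mult_left_mono add_right_mono mult_right_mono) auto
  qed
  finally show ?thesis by simp
qed

text \<open>The Carleman estimate holds for the mollifications of \<open>u\<close>, and both of its sides converge: on the left the
  integrands are bounded, on the right the high power of \<open>|x|\<close> absorbs the singularity of \<open>g\<close> at the origin. The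
  limiting inequality for \<open>N = \<integral> |x|^(s + 2\<kappa>) u\<^sup>2\<close> is \<open>(\<kappa> (s + 2))\<^sup>2 N \<le> (R + 1)^(2\<kappa>) C\<^sup>2 N\<close>, because the exponents match:
  \<open>s + 4 + 2 \<alpha> = s + 2 \<kappa>\<close>. A large \<open>s\<close> leaves only \<open>N = 0\<close>.\<close>

lemma compactly_supported_solution_eq_0:
  fixes u g :: "real ^ 'n::finite \<Rightarrow> real"
  assumes u: "integrable lborel u" "\<And>x. norm x > R \<Longrightarrow> u x = 0" "\<And>x. \<bar>u x\<bar> \<le> M" and R: "R > 0"
    and g: "integrable lborel g" "\<And>x. \<bar>g x\<bar> \<le> C * norm x powr \<alpha> * \<bar>u x\<bar>" and \<alpha>: "\<alpha> > -2"
    and weak: "\<And>x r. r > 0 \<Longrightarrow>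
      - (\<integral>y. u y * laplacian (bump x r) y \<partial>lborel) = (\<integral>y. g y * bump x r y \<partial>lborel)"
  shows "AE x in lborel. u x = 0"
proof -
  define \<kappa> where "\<kappa> = \<alpha> + 2"
  have \<kappa>: "\<kappa> > 0" using \<alpha> by (simp add: \<kappa>_def)
  (* With this j the function |y|^j g is bounded, and j is at least the dimension. *)
  define j where "j = CARD('n) + 2"
  have ja: "real j + \<alpha> > 0" using \<alpha> by (simp add: j_def)
  have M0: "M \<ge> 0" using u(3)[of 0] by linarith
  define C' where "C' = \<bar>C\<bar>"
  have C': "C' \<ge> 0" by (simp add: C'_def)
  have g': "\<bar>g x\<bar> \<le> C' * norm x powr \<alpha> * \<bar>u x\<bar>" for x
    by (rule order_trans[OF g(2)]) (auto intro!: mult_right_mono simp: C'_def)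
  have g_supp: "g x = 0" if "norm x > R" for x using g(2)[of x] u(2)[OF that] by simp
  (* s \<ge> 2 j absorbs the singularity of g, s \<ge> 4 meets the smoothness condition of the Carleman
     estimate, and the last lower bound makes its constant win. *)
  define s where "s = max (2 * real j) (max 4 ((R + 1) powr \<kappa> * (C' + 1) / \<kappa>))"
  have s: "s \<ge> 2 * real j" "s \<ge> 4" "s \<ge> (R + 1) powr \<kappa> * (C' + 1) / \<kappa>" by (auto simp: s_def)
  let ?f = "\<lambda>k. mollify (eps k) u" and ?g = "\<lambda>k. mollify (eps k) g"
  have f_supp: "?f k x = 0" and gk_supp: "?g k x = 0" if "norm x > R + 1" for k x
    using convolution_outside[OF u(1) bump_term_bump eps(1), of R k x]
      convolution_outside[OF g(1) bump_term_bump eps(1), of R k x] eps(2)[of k] that u(2) g_supp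
    by (simp_all add: mollify_def)
  define W where "W t x = norm x powr t" for t and x :: "real ^ 'n"
  have W: "W t x \<ge> 0" for t x by (simp add: W_def)
  have [measurable]: "W t \<in> borel_measurable borel" for t unfolding W_def[abs_def] by measurable
  have [measurable]: "u \<in> borel_measurable borel" "g \<in> borel_measurable borel"
    "?f k \<in> borel_measurable borel" "?g k \<in> borel_measurable borel" for k
    using borel_measurable_integrable[OF u(1)] borel_measurable_integrable[OF g(1)]
     borel_measurable_integrable[OF integrable_mollify[OF u(1) eps(1)]]
     borel_measurable_integrable[OF integrable_mollify[OF g(1) eps(1)]] by auto
  have bounded_int: "integrable lborel h" if h: "h \<in> borel_measurable borel" "\<And>x. norm x > R + 1 \<Longrightarrow> h x = 0" "\<And>x. \<bar>h x\<bar> \<le> B"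
    for h :: "real ^ 'n \<Rightarrow> real" and B
  proof (rule Bochner_Integration.integrable_bound[of _ "\<lambda>x. B * indicator (cball 0 (R + 1)) x"])
    show "integrable lborel (\<lambda>x. B * indicator (cball (0 :: real ^ 'n) (R + 1)) x :: real)"
      by (intro integrable_mult_right integrable_real_indicator) 
        (use emeasure_bounded_finite[OF bounded_cball] in \<open>auto simp: infinity_ennreal_def\<close>)
    have "norm (h x) \<le> norm (B * indicator (cball 0 (R + 1)) x)" for x
      using h(2)[of x] h(3)[of x] by (auto split: split_indicator)
    then show "AE x in lborel. norm (h x) \<le> norm (B * indicator (cball 0 (R + 1)) x)" by simp
  qed (use h in auto)
  define N where "N = (\<integral>x. W (s + 2 * \<kappa>) x * (u x)\<^sup>2 \<partial>lborel)"
  let ?K1 = "(R + 1) powr (s + 2 * \<kappa>) * (2 * M)"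
  have Wle: "W t x \<le> (R + 1) powr t" if "norm x \<le> R + 1" "t \<ge> 0" for t x
    unfolding W_def using that by (intro powr_mono2) auto
  have b: "\<bar>W (s + 2 * \<kappa>) x * h\<^sup>2\<bar> \<le> (R + 1) powr (s + 2 * \<kappa>) * M\<^sup>2" if "norm x \<le> R + 1 \<or> h = 0" "\<bar>h\<bar> \<le> M" for x h
  proof (cases "h = 0")
    case False
    have "W (s + 2 * \<kappa>) x * h\<^sup>2 \<le> (R + 1) powr (s + 2 * \<kappa>) * M\<^sup>2"
      using that False \<kappa> s(2) by (intro mult_mono Wle) (auto simp: abs_le_square_iff[symmetric])
    then show ?thesis using W by simp
  qed simp
  have u_int2: "integrable lborel (\<lambda>x. W (s + 2 * \<kappa>) x * (u x)\<^sup>2)"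
  proof (rule bounded_int)
    show "\<bar>W (s + 2 * \<kappa>) x * (u x)\<^sup>2\<bar> \<le> (R + 1) powr (s + 2 * \<kappa>) * M\<^sup>2" for x
      using u(2)[of x] u(3)[of x] by (cases "norm x \<le> R + 1"; intro b; auto)
  qed (auto simp: u(2))
  have A_lim: "(\<lambda>k. \<integral>x. W (s + 2 * \<kappa>) x * (?f k x)\<^sup>2 \<partial>lborel) \<longlonglongrightarrow> N"
    unfolding N_def
  proof (rule integral_weighted_LIMSEQ[OF u(1,2), where K="?K1"])
    show "integrable lborel (\<lambda>x. W (s + 2 * \<kappa>) x * (?f k x)\<^sup>2)" for k
    proof (rule bounded_int)
      show "\<bar>W (s + 2 * \<kappa>) x * (?f k x)\<^sup>2\<bar> \<le> (R + 1) powr (s + 2 * \<kappa>) * M\<^sup>2" for x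
        using f_supp[of x k] abs_mollify_le[OF u(1,3) eps(1), of k x] by (cases "norm x \<le> R + 1"; intro b; auto)
    qed (auto simp: f_supp)
    show "integrable lborel (\<lambda>x. W (s + 2 * \<kappa>) x * (u x)\<^sup>2)" by (rule u_int2)
    fix k x
    show "\<bar>W (s + 2 * \<kappa>) x * (?f k x)\<^sup>2 - W (s + 2 * \<kappa>) x * (u x)\<^sup>2\<bar> \<le> ?K1 * \<bar>?f k x - u x\<bar>"
    proof (cases "norm x > R + 1")
      case False
      have "W (s + 2 * \<kappa>) x * (?f k x)\<^sup>2 - W (s + 2 * \<kappa>) x * (u x)\<^sup>2 = W (s + 2 * \<kappa>) x * (?f k x + u x) * (?f k x - u x)"
        by (simp add: power2_eq_square algebra_simps)
      then have "\<bar>W (s + 2 * \<kappa>) x * (?f k x)\<^sup>2 - W (s + 2 * \<kappa>) x * (u x)\<^sup>2\<bar> = W (s + 2 * \<kappa>) x * \<bar>?f k x + u x\<bar> * \<bar>?f k x - u x\<bar>"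
        by (simp add: abs_mult W)
      also have "\<dots> \<le> ?K1 * \<bar>?f k x - u x\<bar>"
      proof -
        have "\<bar>?f k x + u x\<bar> \<le> 2 * M" using u(3)[of x] abs_mollify_le[OF u(1,3) eps(1), of k x] by linarith
        then show ?thesis using False \<kappa> s(2) W by (intro mult_right_mono mult_mono Wle) auto
      qed
      finally show ?thesis .
    qed (simp add: f_supp u(2))
  qed
  define M' where "M' = C' * (R powr (real j + \<alpha>)) * M"
  have M': "norm y ^ j * \<bar>g y\<bar> \<le> M'" for y
  proof (cases "y = 0 \<or> norm y > R")
    case True
    then have "g y = 0" using g_supp g'[of 0] by auto
    then show ?thesis using C' M0 by (simp add: M'_def)
  next
    case False
    have "norm y ^ j * \<bar>g y\<bar> \<le> norm y ^ j * (C' * norm y powr \<alpha> * \<bar>u y\<bar>)"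
      by (intro mult_left_mono g') auto
    also have "\<dots> = C' * norm y powr (real j + \<alpha>) * \<bar>u y\<bar>"
      using False by (simp add: powr_add powr_realpow)
    also have "\<dots> \<le> C' * R powr (real j + \<alpha>) * M"
      using False ja C' u(3) by (intro mult_mono powr_mono2) auto
    finally show ?thesis by (simp add: M'_def)
  qed
  define Q where "Q = 2 ^ j * ((\<integral>y. \<bar>g y\<bar> \<partial>lborel) / bump_mass TYPE('n) 1 + M')"
  have Q: "norm x ^ j * \<bar>?g k x\<bar> \<le> Q" for k x
    unfolding Q_def using eps[of k] by (intro weighted_mollify_bound g(1) M') (auto simp: j_def)
  have M'0: "M' \<ge> 0" using C' M0 by (simp add: M'_def)
  have Q0: "Q \<ge> 0" using Q[of 0 0] by (auto simp: j_def)
  define P where "P = (R + 1) powr (s + 4 - j)"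
  have P0: "P \<ge> 0" by (simp add: P_def)
  have WP: "W (s + 4) x \<le> P * norm x ^ j" if "norm x \<le> R + 1" for x
  proof (cases "x = 0")
    case False
    have "W (s + 4) x = W (s + 4 - j) x * norm x ^ j"
      using False by (simp add: W_def powr_diff powr_realpow)
    also have "\<dots> \<le> P * norm x ^ j" unfolding P_def using s that by (intro mult_right_mono Wle) auto
    finally show ?thesis .
  qed (simp add: W_def P_def j_def)
  define P2 where "P2 = (R + 1) powr (s + 4 - 2 * real j)"
  have WP2: "W (s + 4) x \<le> P2 * (norm x ^ j)\<^sup>2" if "norm x \<le> R + 1" for x
  proof (cases "x = 0")
    case False
    have e: "norm x powr (2 * real j) = (norm x ^ j)\<^sup>2"
      using False powr_realpow[of "norm x" "2 * j"] by (simp add: power_mult[symmetric] mult.commute)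
    have "W (s + 4) x = W (s + 4 - 2 * real j) x * (norm x ^ j)\<^sup>2"
      using False by (simp add: W_def powr_diff e)
    also have "\<dots> \<le> P2 * (norm x ^ j)\<^sup>2" unfolding P2_def using s that by (intro mult_right_mono Wle) auto
    finally show ?thesis .
  qed (simp add: W_def j_def)
  have B_bound: "\<bar>W (s + 4) x * h\<^sup>2\<bar> \<le> P2 * L\<^sup>2" if "norm x \<le> R + 1 \<or> h = 0" "norm x ^ j * \<bar>h\<bar> \<le> L" for x h L
  proof (cases "h = 0")
    case False
    have "W (s + 4) x * h\<^sup>2 \<le> P2 * (norm x ^ j)\<^sup>2 * h\<^sup>2"
      using WP2[of x] that False by (intro mult_right_mono) auto
    also have "\<dots> = P2 * (norm x ^ j * \<bar>h\<bar>)\<^sup>2" by (simp add: power_mult_distrib)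
    also have "\<dots> \<le> P2 * L\<^sup>2" using that by (intro mult_left_mono power_mono) (auto simp: P2_def)
    finally show ?thesis using W by simp
  qed (simp add: P2_def)
  have g_int2: "integrable lborel (\<lambda>x. W (s + 4) x * (g x)\<^sup>2)"
  proof (rule bounded_int)
    show "\<bar>W (s + 4) x * (g x)\<^sup>2\<bar> \<le> P2 * M'\<^sup>2" for x
      using g_supp[of x] M'[of x] by (cases "norm x \<le> R + 1"; intro B_bound; auto)
  qed (auto simp: g_supp)
  let ?K2 = "P * (Q + M')"
  have B_lim: "(\<lambda>k. \<integral>x. W (s + 4) x * (?g k x)\<^sup>2 \<partial>lborel) \<longlonglongrightarrow> (\<integral>x. W (s + 4) x * (g x)\<^sup>2 \<partial>lborel)"
  proof (rule integral_weighted_LIMSEQ[OF g(1) g_supp _ g_int2, where K="?K2"])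
    show "integrable lborel (\<lambda>x. W (s + 4) x * (?g k x)\<^sup>2)" for k
    proof (rule bounded_int)
      show "\<bar>W (s + 4) x * (?g k x)\<^sup>2\<bar> \<le> P2 * Q\<^sup>2" for x
        using gk_supp[of x k] Q[of x k] by (cases "norm x \<le> R + 1"; intro B_bound; auto)
    qed (auto simp: gk_supp)
    fix k x
    show "\<bar>W (s + 4) x * (?g k x)\<^sup>2 - W (s + 4) x * (g x)\<^sup>2\<bar> \<le> ?K2 * \<bar>?g k x - g x\<bar>"
    proof (cases "norm x > R + 1")
      case False
      have "W (s + 4) x * (?g k x)\<^sup>2 - W (s + 4) x * (g x)\<^sup>2 = W (s + 4) x * (?g k x + g x) * (?g k x - g x)"
        by (simp add: power2_eq_square algebra_simps)
      then have "\<bar>W (s + 4) x * (?g k x)\<^sup>2 - W (s + 4) x * (g x)\<^sup>2\<bar> = W (s + 4) x * \<bar>?g k x + g x\<bar> * \<bar>?g k x - g x\<bar>"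
        by (simp add: abs_mult W)
      also have "\<dots> \<le> ?K2 * \<bar>?g k x - g x\<bar>"
      proof (rule mult_right_mono)
        have "W (s + 4) x * \<bar>?g k x + g x\<bar> \<le> P * norm x ^ j * (\<bar>?g k x\<bar> + \<bar>g x\<bar>)"
          using WP[of x] False P0 by (intro mult_mono) auto
        also have "\<dots> = P * (norm x ^ j * \<bar>?g k x\<bar> + norm x ^ j * \<bar>g x\<bar>)" by (simp add: algebra_simps)
        also have "\<dots> \<le> P * (Q + M')" using Q M' P0 by (intro mult_left_mono add_mono) auto
        finally show "W (s + 4) x * \<bar>?g k x + g x\<bar> \<le> P * (Q + M')" .
      qed simp
      finally show ?thesis .
    qed (use R in \<open>simp add: gk_supp g_supp\<close>)
  qed
  have carleman: "(\<kappa> * (s + 2))\<^sup>2 * (\<integral>x. W (s + 2 * \<kappa>) x * (?f k x)\<^sup>2 \<partial>lborel)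
     \<le> (R + 1) powr (2 * \<kappa>) * (\<integral>x. W (s + 4) x * (?g k x)\<^sup>2 \<partial>lborel)" for k
  proof -
    let ?r = "eps k"
    interpret f: compact_C2 "?f k" "\<lambda>i x. convolution u (bump1 i 0 ?r) x / bump_mass TYPE('n) ?r"
     "\<lambda>i j x. convolution u (bump2 i j 0 ?r) x / bump_mass TYPE('n) ?r" "R + ?r"
      by (rule compact_C2_mollify[OF u(1,2) eps(1)])
    have lap: "f.lap x = - ?g k x" for x
      using weak[OF eps(1), of x k, symmetric] by (simp add: lap_mollify[OF u(1,2) eps(1)] mollify_eq)
    have "(\<kappa> * (s + 2))\<^sup>2 * (\<integral>x. W (s + 2 * \<kappa>) x * (?f k x)\<^sup>2 \<partial>lborel)
       \<le> (R + ?r) powr (2 * \<kappa>) * (\<integral>x. W (s + 4) x * (?g k x)\<^sup>2 \<partial>lborel)"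
      using f.carleman_estimate[of s \<kappa>] s(2) \<kappa> by (simp add: W_def lap)
    also have "\<dots> \<le> (R + 1) powr (2 * \<kappa>) * (\<integral>x. W (s + 4) x * (?g k x)\<^sup>2 \<partial>lborel)"
      using eps[of k] R \<kappa> W by (intro mult_right_mono powr_mono2 integral_nonneg_AE) auto
    finally show ?thesis .
  qed
  have "(\<kappa> * (s + 2))\<^sup>2 * N \<le> (R + 1) powr (2 * \<kappa>) * (\<integral>x. W (s + 4) x * (g x)\<^sup>2 \<partial>lborel)"
    by (rule LIMSEQ_le[OF tendsto_mult_left[OF A_lim] tendsto_mult_left[OF B_lim]]) (use carleman in auto)
  also have "(\<integral>x. W (s + 4) x * (g x)\<^sup>2 \<partial>lborel) \<le> (\<integral>x. C'\<^sup>2 * (W (s + 2 * \<kappa>) x * (u x)\<^sup>2) \<partial>lborel)"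
  proof (rule integral_mono[OF g_int2])
    show "integrable lborel (\<lambda>x. C'\<^sup>2 * (W (s + 2 * \<kappa>) x * (u x)\<^sup>2))" using u_int2 by simp
    fix x
    have "(g x)\<^sup>2 \<le> (C' * W \<alpha> x * \<bar>u x\<bar>)\<^sup>2"
      using g'[of x] C' W by (intro power2_le_iff_abs_le[THEN iffD2]) (auto simp: W_def)
    then have "W (s + 4) x * (g x)\<^sup>2 \<le> W (s + 4) x * (C' * W \<alpha> x * \<bar>u x\<bar>)\<^sup>2"
      using W by (intro mult_left_mono) auto
    also have "\<dots> = C'\<^sup>2 * (W (s + 4) x * (W \<alpha> x * W \<alpha> x)) * (u x)\<^sup>2" by (simp add: power2_eq_square mult_ac)
    also have "W (s + 4) x * (W \<alpha> x * W \<alpha> x) = W (s + 2 * \<kappa>) x"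
      unfolding W_def by (cases "x = 0") (simp_all add: powr_add[symmetric] \<kappa>_def add_ac)
    finally show "W (s + 4) x * (g x)\<^sup>2 \<le> C'\<^sup>2 * (W (s + 2 * \<kappa>) x * (u x)\<^sup>2)" by (simp add: mult_ac)
  qed
  also have "\<dots> = C'\<^sup>2 * N" by (simp add: N_def)
  finally have main: "(\<kappa> * (s + 2))\<^sup>2 * N \<le> (R + 1) powr (2 * \<kappa>) * (C'\<^sup>2 * N)"
    using R by (simp add: mult_left_mono)
  have N0: "N \<ge> 0" unfolding N_def using W by (intro integral_nonneg_AE) auto
  have big: "(R + 1) powr (2 * \<kappa>) * C'\<^sup>2 < (\<kappa> * (s + 2))\<^sup>2"
  proof -
    let ?a = "(R + 1) powr \<kappa>"
    have a: "?a > 0" using R by simp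
    have "?a * C' < ?a * (C' + 1)" using a by simp
    also have "\<dots> \<le> \<kappa> * s" using s(3) \<kappa> by (simp add: field_simps)
    also have "\<dots> \<le> \<kappa> * (s + 2)" using \<kappa> by simp
    finally have "(?a * C')\<^sup>2 < (\<kappa> * (s + 2))\<^sup>2" using a C' by (intro power_strict_mono) auto
    moreover have "(R + 1) powr (2 * \<kappa>) = ?a\<^sup>2" using R by (simp add: powr_powr[symmetric] powr_numeral mult.commute[of 2])
    ultimately show ?thesis by (simp add: power_mult_distrib)
  qed
  have "N = 0"
  proof (rule ccontr)
    assume "N \<noteq> 0"
    then have "N > 0" using N0 by simp
    then show False using main mult_strict_right_mono[OF big] by (simp add: mult.assoc)
  qed
  then have "AE x in lborel. W (s + 2 * \<kappa>) x * (u x)\<^sup>2 = 0"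
    using integral_nonneg_eq_0_iff_AE[OF u_int2] W by (simp add: N_def)
  moreover have "AE x in lborel. x \<noteq> (0 :: real ^ 'n)" by (rule AE_lborel_singleton)
  ultimately show ?thesis by eventually_elim (auto simp: W_def)
qed


section \<open>Nonnegative solutions on a ball\<close>

text \<open>By scaling: the bump on a ball of radius \<open>r\<close> is a dilated unit bump, and two derivatives cost \<open>r^(-2)\<close>.\<close>

lemma laplacian_bump_le:
  obtains L where "L > 0" "\<And>(y :: real ^ 'n::finite) r x. r > 0 \<Longrightarrow> \<bar>laplacian (bump y r) x\<bar> \<le> L / r\<^sup>2"
proof -
  have "\<exists>B. B \<ge> 0 \<and> (\<forall>x. \<bar>bump2 i i (0 :: real ^ 'n) 1 x\<bar> \<le> B)" for i
    using bump_term_bounded[OF bump_term_bump2 zero_less_one, of i i "0 :: real ^ 'n"] by metis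
  then obtain B where B: "\<And>i. B i \<ge> 0" "\<And>i x. \<bar>bump2 i i (0 :: real ^ 'n) 1 x\<bar> \<le> B i" by metis
  define L where "L = (\<Sum>i\<in>UNIV. B i) + 1"
  have L: "L > 0" using B(1) by (simp add: L_def sum_nonneg add_nonneg_pos)
  have "\<bar>laplacian (bump y r) x\<bar> \<le> L / r\<^sup>2" if r: "r > 0" for y x :: "real ^ 'n" and r
  proof -
    define z where "z = (1 / r) *\<^sub>R (x - y)"
    have p: "ball_profile y r x = ball_profile 0 1 z"
      using r by (simp add: ball_profile_def z_def power2_eq_square)
    have "bump2 i i y r x = bump2 i i 0 1 z / r\<^sup>2" for i
      unfolding bump2_def p using r by (simp add: z_def field_simps power2_eq_square)
    then have "\<bar>laplacian (bump y r) x\<bar> \<le> (\<Sum>i\<in>UNIV. B i / r\<^sup>2)"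
      unfolding laplacian_bump using B(2)[of _ z] 
      by (intro order_trans[OF sum_abs] sum_mono) (simp add: divide_right_mono)
    also have "\<dots> \<le> L / r\<^sup>2" using r by (simp add: L_def sum_divide_distrib[symmetric] divide_right_mono)
    finally show ?thesis .
  qed
  then show ?thesis using that L by blast
qed

text \<open>The total mass of the weight in the mean value inequality.\<close>

definition eta_mass :: "'n::finite itself \<Rightarrow> real" where
  "eta_mass _ = (\<integral>z. exp_cutoff 2 (ball_profile 0 1 (z :: real ^ 'n)) \<partial>lborel)"

text \<open>Testing the equation with the bump \<open>\<phi>\<close> on the ball \<open>B\<close> of radius \<open>r\<close> gives \<open>\<integral> V u \<phi> = - \<integral> u \<Delta>\<phi> \<le> L r^(-2) \<integral>\<^sub>B u\<close>. On the
  other hand \<open>u\<close> is superharmonic on a larger ball, so on \<open>B\<close> it is bounded below by its average, up to a constant,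
  and \<open>\<integral> V u \<phi>\<close> is at least a multiple of \<open>r^(-n) \<integral> V \<phi> \<integral>\<^sub>B u\<close>. The second estimate is proved for mollifications, whose radii
  are less than \<open>1 < r\<close>, and passes to the limit because \<open>V \<phi>\<close> is bounded.\<close>

lemma supersolution_on_ball:
  fixes u V :: "real ^ 'n::finite \<Rightarrow> real"
  assumes u: "integrable lborel u" "\<And>x. norm x > R \<Longrightarrow> u x = 0" and r: "r > 1"
    and [measurable]: "V \<in> borel_measurable borel" and V: "\<And>x. x \<in> ball y r \<Longrightarrow> 0 \<le> V x \<and> V x \<le> K"
    and Vu: "\<And>x. x \<in> ball y (6 * r) \<Longrightarrow> V x * u x \<ge> 0" and u0: "\<And>x. x \<in> ball y (6 * r) \<Longrightarrow> u x \<ge> 0"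
    and weak: "\<And>x \<rho>. \<rho> > 0 \<Longrightarrow> ball x \<rho> \<subseteq> ball y (6 * r) \<Longrightarrow>
      - (\<integral>z. u z * laplacian (bump x \<rho>) z \<partial>lborel) = (\<integral>z. V z * u z * bump x \<rho> z \<partial>lborel)"
    and L: "\<And>x. \<bar>laplacian (bump y r) x\<bar> \<le> L / r\<^sup>2"
  shows "(exp (- 4 / 3) / (4 * r) ^ CARD('n) * (\<integral>x. V x * bump y r x \<partial>lborel)) * (\<integral>x. indicator (ball y r) x * u x \<partial>lborel)
     \<le> (eta_mass TYPE('n) * (L / r\<^sup>2)) * (\<integral>x. indicator (ball y r) x * u x \<partial>lborel)"
proof -
  let ?B = "ball y r" and ?E = "eta_mass TYPE('n)"
  let ?c = "exp (- 4 / 3) / (4 * r) ^ CARD('n)"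
  let ?f = "\<lambda>k. mollify (eps k) u"
  have r0: "r > 0" using r by simp
  have [measurable]: "u \<in> borel_measurable borel" "?f k \<in> borel_measurable borel" "bump y r \<in> borel_measurable borel" for k
    using borel_measurable_integrable[OF u(1)] borel_measurable_integrable[OF integrable_mollify[OF u(1) eps(1)]]
      borel_measurable_integrable[OF integrable_bump_term[OF bump_term_bump r0]] by auto
  have E0: "?E \<ge> 0" unfolding eta_mass_def by (intro integral_nonneg_AE) (simp add: exp_cutoff_nonneg)
  have c0: "?c \<ge> 0" using r by simp
  have K: "K \<ge> 0" using V[of y] r by force
  have \<phi>: "0 \<le> V x * bump y r x" "V x * bump y r x \<le> K" for x
  proof -
    show "0 \<le> V x * bump y r x" "V x * bump y r x \<le> K"
      using V[of x] bump_term_outside[OF bump_term_bump r0, of x y] bump_nonneg[of y r x] bump_le_1[of y r x] K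
        mult_mono[of "V x" K "bump y r x" 1]
      by (cases "x \<in> ball y r"; simp)+
  qed
  have \<phi>i: "integrable lborel (\<lambda>x. V x * bump y r x * h x)" if "integrable lborel h" for h
  proof (rule Bochner_Integration.integrable_bound[of _ "\<lambda>x. K * h x"])
    have "norm (V x * bump y r x * h x) \<le> norm (K * h x)" for x
      unfolding real_norm_def abs_mult[of "V x * bump y r x"] abs_mult[of K] abs_of_nonneg[OF \<phi>(1)] abs_of_nonneg[OF K]
      by (rule mult_right_mono[OF \<phi>(2)]) simp
    then show "AE x in lborel. norm (V x * bump y r x * h x) \<le> norm (K * h x)" by simp
    show "(\<lambda>x. V x * bump y r x * h x) \<in> borel_measurable lborel"
      using borel_measurable_integrable[OF that] by simp
  qed (use that in simp)
  have \<phi>1: "integrable lborel (\<lambda>x. V x * bump y r x)"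
  proof (rule Bochner_Integration.integrable_bound[of _ "\<lambda>x. K * indicator ?B x"])
    show "integrable lborel (\<lambda>x. K * indicator ?B x :: real)"
      by (intro integrable_mult_right integrable_real_indicator) 
        (use emeasure_bounded_finite[OF bounded_ball] in \<open>auto simp: infinity_ennreal_def\<close>)
    have "norm (V x * bump y r x) \<le> norm (K * indicator ?B x)" for x
      using \<phi>[of x] bump_term_outside[OF bump_term_bump r0, of x y] K by (auto split: split_indicator)
    then show "AE x in lborel. norm (V x * bump y r x) \<le> norm (K * indicator ?B x)" by simp
  qed simp
  have Bi: "integrable lborel (\<lambda>x. indicator ?B x * h x)" if "integrable lborel h" for h :: "real ^ 'n \<Rightarrow> real"
    using integrable_mult_indicator[of ?B lborel h] that by simp
  have lower: "(?c * (\<integral>x. V x * bump y r x \<partial>lborel)) * (\<integral>x. indicator ?B x * ?f k x \<partial>lborel)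
      \<le> ?E * (\<integral>x. V x * bump y r x * ?f k x \<partial>lborel)" for k
  proof -
    let ?r = "eps k"
    have m: "bump_mass TYPE('n) ?r > 0" by (rule bump_mass_pos[OF eps(1)])
    interpret f: compact_C2 "?f k" "\<lambda>i x. convolution u (bump1 i 0 ?r) x / bump_mass TYPE('n) ?r"
     "\<lambda>i j x. convolution u (bump2 i j 0 ?r) x / bump_mass TYPE('n) ?r" "R + ?r"
      by (rule compact_C2_mollify[OF u eps(1)])
    have near: "ball x ?r \<subseteq> ball y (6 * r)" if "x \<in> ball y (5 * r)" for x
    proof
      fix z assume "z \<in> ball x ?r"
      then show "z \<in> ball y (6 * r)"
        using that eps(2)[of k] r dist_triangle[of y z x] by simp
    qed
    have nn: "0 \<le> (\<integral>z. h z * bump x ?r z \<partial>lborel)" if "x \<in> ball y (5 * r)" "\<And>z. z \<in> ball y (6 * r) \<Longrightarrow> h z \<ge> 0" for h x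
    proof (rule integral_nonneg_AE, rule AE_I2)
      fix z
      show "0 \<le> h z * bump x ?r z"
        using near[OF that(1)] that(2)[of z] bump_term_outside[OF bump_term_bump eps(1), of z x k] bump_nonneg[of x ?r z]
        by (cases "z \<in> ball x ?r") auto
    qed
    have pos: "?f k x \<ge> 0" if "x \<in> ball y (5 * r)" for x
      using nn[OF that, of u] u0 m by (simp add: mollify_eq)
    have lap: "f.lap x \<le> 0" if "x \<in> ball y (5 * r)" for x
      using nn[OF that, of "\<lambda>z. V z * u z"] Vu weak[OF eps(1) near[OF that]] m
      by (simp add: lap_mollify[OF u eps(1)] divide_nonpos_pos)
    let ?I = "\<integral>x. indicator ?B x * ?f k x \<partial>lborel"
    have "(?c * (\<integral>x. V x * bump y r x \<partial>lborel)) * ?I = (\<integral>x. V x * bump y r x * (?c * ?I) \<partial>lborel)"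
      by simp
    also have "\<dots> \<le> (\<integral>x. V x * bump y r x * (?f k x * ?E) \<partial>lborel)"
    proof (rule integral_mono)
      show "integrable lborel (\<lambda>x. V x * bump y r x * (?c * ?I))" using \<phi>1 by simp
      show "integrable lborel (\<lambda>x. V x * bump y r x * (?f k x * ?E))"
        by (intro \<phi>i integrable_mult_left integrable_mollify u(1) eps(1))
      fix x
      show "V x * bump y r x * (?c * ?I) \<le> V x * bump y r x * (?f k x * ?E)"
      proof (cases "x \<in> ?B")
        case True
        have "?c * ?I \<le> ?f k x * ?E"
          unfolding eta_mass_def by (rule f.superharmonic_lower_bound[OF r0 lap pos True])
        then show ?thesis using \<phi>(1) by (intro mult_left_mono)
      next
        case False
        then show ?thesis using bump_term_outside[OF bump_term_bump r0, of x y] by simp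
      qed
    qed
    also have "\<dots> = (\<integral>x. ?E * (V x * bump y r x * ?f k x) \<partial>lborel)" by (simp add: mult_ac)
    also have "\<dots> = ?E * (\<integral>x. V x * bump y r x * ?f k x \<partial>lborel)" by simp
    finally show ?thesis .
  qed
  have limI: "(\<lambda>k. \<integral>x. indicator ?B x * ?f k x \<partial>lborel) \<longlonglongrightarrow> (\<integral>x. indicator ?B x * u x \<partial>lborel)"
    by (rule integral_weighted_LIMSEQ[OF u, where K=1])
      (auto intro!: Bi u(1) integrable_mollify eps(1) split: split_indicator)
  have lim\<phi>: "(\<lambda>k. \<integral>x. V x * bump y r x * ?f k x \<partial>lborel) \<longlonglongrightarrow> (\<integral>x. V x * bump y r x * u x \<partial>lborel)"
  proof (rule integral_weighted_LIMSEQ[OF u, where K=K])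
    fix k x
    have "\<bar>V x * bump y r x * ?f k x - V x * bump y r x * u x\<bar> = (V x * bump y r x) * \<bar>?f k x - u x\<bar>"
      unfolding right_diff_distrib[symmetric] abs_mult[of "V x * bump y r x"] abs_of_nonneg[OF \<phi>(1)] ..
    also have "\<dots> \<le> K * \<bar>?f k x - u x\<bar>" using \<phi>(2) by (intro mult_right_mono) auto
    finally show "\<bar>V x * bump y r x * ?f k x - V x * bump y r x * u x\<bar> \<le> K * \<bar>?f k x - u x\<bar>" .
  qed (auto intro!: \<phi>i u(1) integrable_mollify eps(1))
  have "(?c * (\<integral>x. V x * bump y r x \<partial>lborel)) * (\<integral>x. indicator ?B x * u x \<partial>lborel)
     \<le> ?E * (\<integral>x. V x * bump y r x * u x \<partial>lborel)"
    by (rule LIMSEQ_le[OF tendsto_mult_left[OF limI] tendsto_mult_left[OF lim\<phi>]]) (use lower in auto)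
  also have "(\<integral>x. V x * bump y r x * u x \<partial>lborel) = - (\<integral>z. u z * laplacian (bump y r) z \<partial>lborel)"
    using weak[OF r0, of y] r by (simp add: subset_ball mult_ac)
  also have "\<dots> \<le> (\<integral>x. L / r\<^sup>2 * (indicator ?B x * u x) \<partial>lborel)"
  proof -
    have b: "\<bar>u z * laplacian (bump y r) z\<bar> \<le> L / r\<^sup>2 * (indicator ?B z * u z)" for z
    proof (cases "z \<in> ?B")
      case True
      then have "u z \<ge> 0" using r by (intro u0) auto
      then show ?thesis using True mult_right_mono[OF L[of z], of "u z"] by (simp add: abs_mult mult_ac)
    next
      case False
      then have "laplacian (bump y r) z = 0"
        using bump_term_outside[OF bump_term_bump2 r0, of z y] by (simp add: laplacian_bump)
      then show ?thesis using False by simp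
    qed
    have i: "integrable lborel (\<lambda>x. L / r\<^sup>2 * (indicator ?B x * u x))" using Bi[OF u(1)] by simp
    have "continuous_on UNIV (\<lambda>z. laplacian (bump y r) z)"
      unfolding laplacian_bump by (intro continuous_intros bump_term_continuous[OF bump_term_bump2])
    then have [measurable]: "(\<lambda>z. laplacian (bump y r) z) \<in> borel_measurable borel"
      by (rule borel_measurable_continuous_onI)
    have i2: "integrable lborel (\<lambda>z. u z * laplacian (bump y r) z)"
    proof (rule Bochner_Integration.integrable_bound[OF i])
      have "norm (u z * laplacian (bump y r) z) \<le> norm (L / r\<^sup>2 * (indicator ?B z * u z))" for z
        unfolding real_norm_def by (rule order_trans[OF b abs_ge_self])
      then show "AE z in lborel. norm (u z * laplacian (bump y r) z) \<le> norm (L / r\<^sup>2 * (indicator ?B z * u z))" by simp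
    qed simp
    show ?thesis using abs_integral_le[OF i2 i b] by linarith
  qed
  finally show ?thesis using E0 by (simp add: mult_left_mono mult.assoc)
qed

section \<open>Solutions of constant sign near infinity\<close>

lemma AE_lborel_scale:
  fixes P :: "'a::euclidean_space \<Rightarrow> bool"
  assumes "AE x in lborel. P x" "c \<noteq> 0"
  shows "AE x in lborel. P (c *\<^sub>R x)"
proof -
  obtain N where N: "N \<in> null_sets lborel" "{x. \<not> P x} \<subseteq> N"
    using assms(1) by (auto simp: eventually_ae_filter)
  have Nb: "N \<in> sets borel" using N by auto
  have "AE x in lborel. x \<notin> N" using AE_not_in[OF N(1)] .
  then have "AE x in density (distr lborel borel (\<lambda>x. 0 + c *\<^sub>R x)) (\<lambda>_. \<bar>c\<bar> ^ DIM('a)). x \<notin> N"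
    by (subst lborel_affine[OF assms(2), of 0, symmetric])
  then have "AE x in distr lborel borel (\<lambda>x. 0 + c *\<^sub>R x). x \<notin> N"
    using assms(2) by (subst (asm) AE_density) auto
  then have "AE x in lborel. c *\<^sub>R x \<notin> N"
    using Nb by (subst (asm) AE_distr_iff) auto
  then show ?thesis using N(2) by (auto elim: eventually_mono)
qed

lemma integral_pos_AE:
  fixes f :: "'a \<Rightarrow> real"
  assumes "integrable M f" "AE x in M. f x \<ge> 0" "\<not> (AE x in M. f x = 0)"
  shows "(\<integral>x. f x \<partial>M) > 0"
  using integral_nonneg_AE[OF assms(2)] integral_nonneg_eq_0_iff_AE[OF assms(1,2)] assms(3) by linarith

lemma not_AE_notin_ball:
  assumes "r > 0" shows "\<not> (AE x in lborel. x \<notin> ball (y :: 'a::euclidean_space) r)"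
proof
  assume "AE x in lborel. x \<notin> ball y r"
  then have "ball y r \<in> null_sets lborel"
    using AE_iff_null_sets[of "ball y r" "lborel :: 'a measure"] by simp
  then have "negligible (ball y r)"
    by (simp add: negligible_iff_null_sets null_sets_completionI)
  then show False using open_not_negligible[of "ball y r"] assms by simp
qed

text \<open>The equation for Borel representatives \<open>u\<close> and \<open>V\<close>. Bounds and signs hold everywhere, which a modification on a null
  set achieves; homogeneity and positivity of \<open>V\<close> then only survive almost everywhere. The weak equation is recorded
  only for bump functions.\<close>

locale homogeneous_equation =
  fixes u V :: "real ^ 'n::finite \<Rightarrow> real" and \<alpha> C M R :: real
  assumes u_meas [measurable]: "u \<in> borel_measurable borel"
    and V_meas [measurable]: "V \<in> borel_measurable borel"
    and u_bounded: "\<bar>u x\<bar> \<le> M"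
    and V_nonneg: "0 \<le> V x" and V_bounded: "V x \<le> C * norm x powr \<alpha>"
    and V_pos: "AE x in lborel. V x > 0"
    and V_homogeneous: "t > 0 \<Longrightarrow> AE x in lborel. V (t *\<^sub>R x) = t powr \<alpha> * V x"
    and Vu_integrable: "integrable lborel (\<lambda>x. indicator (cball 0 \<rho>) x * (V x * u x))"
    and weak: "r > 0 \<Longrightarrow> - (\<integral>x. u x * laplacian (bump y r) x \<partial>lborel) = (\<integral>x. V x * u x * bump y r x \<partial>lborel)"
    and alpha: "\<alpha> > -2"
    and R_pos: "R > 0" and u_nonneg: "norm x > R \<Longrightarrow> u x \<ge> 0"
begin

lemma C_nonneg: "C \<ge> 0"
proof -
  have "0 \<le> C * norm (axis undefined 1 :: real ^ 'n) powr \<alpha>"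
    using V_nonneg V_bounded order_trans by blast
  then show ?thesis by simp
qed

lemma u_cut_integrable: "integrable lborel (\<lambda>x. indicator (cball 0 \<rho>) x * u x)"
proof (rule Bochner_Integration.integrable_bound[of _ "\<lambda>x. M * indicator (cball 0 \<rho>) x"])
  show "integrable lborel (\<lambda>x. M * indicator (cball (0 :: real ^ 'n) \<rho>) x :: real)"
    by (intro integrable_mult_right integrable_real_indicator) 
      (use emeasure_bounded_finite[OF bounded_cball] in \<open>auto simp: infinity_ennreal_def\<close>)
  have "norm (indicator (cball 0 \<rho>) x * u x) \<le> norm (M * indicator (cball 0 \<rho>) x)" for x
    using u_bounded[of x] by (auto split: split_indicator)
  then show "AE x in lborel. norm (indicator (cball 0 \<rho>) x * u x) \<le> norm (M * indicator (cball 0 \<rho>) x)"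
    by simp
  show "(\<lambda>x. indicator (cball 0 \<rho>) x * u x) \<in> borel_measurable lborel"
    by (intro borel_measurable_times borel_measurable_indicator) (use u_meas in auto)
qed

lemma V_bound_ball:
  assumes "r > 0" "norm y \<ge> 2 * r"
  obtains K where "\<And>x. x \<in> ball y r \<Longrightarrow> V x \<le> K"
proof -
  have "V x \<le> C * ((norm y + r) powr \<bar>\<alpha>\<bar> + r powr (- \<bar>\<alpha>\<bar>))" if "x \<in> ball y r" for x
  proof -
    have n: "r \<le> norm x" "norm x \<le> norm y + r"
      using that assms norm_triangle_ineq2[of y x] norm_triangle_ineq2[of x y]
      by (auto simp: dist_norm norm_minus_commute)
    have "norm x powr \<alpha> \<le> (norm y + r) powr \<bar>\<alpha>\<bar> + r powr (- \<bar>\<alpha>\<bar>)"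
    proof (cases "\<alpha> \<ge> 0")
      case True
      then have "norm x powr \<alpha> \<le> (norm y + r) powr \<alpha>" using n assms by (intro powr_mono2) auto
      then show ?thesis using True by (simp add: add_increasing2)
    next
      case False
      then have "norm x powr \<alpha> \<le> r powr \<alpha>" using n assms by (intro powr_mono2') auto
      then show ?thesis using False by (simp add: add_increasing)
    qed
    then show ?thesis using V_bounded[of x] C_nonneg mult_left_mono order_trans by blast
  qed
  then show ?thesis using that by blast
qed

lemma integrable_V_bump:
  assumes "r > 0" "norm y \<ge> 2 * r"
  shows "integrable lborel (\<lambda>x. V x * bump y r x)"
proof -
  obtain K where K: "\<And>x. x \<in> ball y r \<Longrightarrow> V x \<le> K" using V_bound_ball[OF assms] by blast
  have "continuous_on UNIV (bump y r)" by (rule bump_term_continuous[OF bump_term_bump])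
  then have [measurable]: "bump y r \<in> borel_measurable borel" by (rule borel_measurable_continuous_onI)
  show ?thesis
  proof (rule Bochner_Integration.integrable_bound[of _ "\<lambda>x. K * bump y r x"])
    show "integrable lborel (\<lambda>x. K * bump y r x)" 
      by (intro integrable_mult_right integrable_bump_term[OF bump_term_bump assms(1)])
    have "norm (V x * bump y r x) \<le> norm (K * bump y r x)" for x
    proof (cases "x \<in> ball y r")
      case True
      then show ?thesis using K[OF True] V_nonneg[of x] bump_nonneg[of y r x]
        by (simp add: abs_mult mult_right_mono)
    next
      case False
      then show ?thesis using bump_term_outside[OF bump_term_bump assms(1) False] by simp
    qed
    then show "AE x in lborel. norm (V x * bump y r x) \<le> norm (K * bump y r x)" by simp
  qed simp
qed

lemma integral_V_bump_pos:
  assumes "r > 0" "norm y \<ge> 2 * r"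
  shows "(\<integral>x. V x * bump y r x \<partial>lborel) > 0"
proof (rule integral_pos_AE[OF integrable_V_bump[OF assms]])
  show "AE x in lborel. 0 \<le> V x * bump y r x" by (simp add: V_nonneg bump_nonneg)
  show "\<not> (AE x in lborel. V x * bump y r x = 0)"
  proof
    assume "AE x in lborel. V x * bump y r x = 0"
    with V_pos have "AE x in lborel. x \<notin> ball y r"
      by eventually_elim (use assms in \<open>auto simp: bump_def exp_cutoff_pos ball_profile_pos less_imp_neq[symmetric]\<close>)
    then show False using not_AE_notin_ball[OF assms(1)] by blast
  qed
qed

lemma integral_V_bump_scale:
  assumes "t > 0"
  shows "(\<integral>x. V x * bump (t *\<^sub>R y) t x \<partial>lborel) = t ^ CARD('n) * t powr \<alpha> * (\<integral>x. V x * bump y 1 x \<partial>lborel)"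
proof -
  have "continuous_on UNIV (bump (t *\<^sub>R y) t)" "continuous_on UNIV (bump y 1)" by (rule bump_term_continuous[OF bump_term_bump])+
  then have [measurable]: "bump (t *\<^sub>R y) t \<in> borel_measurable borel" "bump y 1 \<in> borel_measurable borel"
    by (auto intro: borel_measurable_continuous_onI)
  have b: "bump (t *\<^sub>R y) t (t *\<^sub>R x) = bump y 1 x" for x
    using assms by (simp add: bump_def ball_profile_def scaleR_diff_right[symmetric] power2_eq_square)
  have "(\<integral>x. V x * bump (t *\<^sub>R y) t x \<partial>lborel) / \<bar>t\<bar> ^ DIM(real ^ 'n)
     = (\<integral>x. V (0 + t *\<^sub>R x) * bump (t *\<^sub>R y) t (0 + t *\<^sub>R x) \<partial>lborel)"
    using assms by (subst integral_affine) auto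
  also have "\<dots> = (\<integral>x. t powr \<alpha> * (V x * bump y 1 x) \<partial>lborel)"
    using V_homogeneous[OF assms] by (intro integral_cong_AE) (auto simp: b mult_ac elim: eventually_mono)
  also have "\<dots> = t powr \<alpha> * (\<integral>x. V x * bump y 1 x \<partial>lborel)" by simp
  finally show ?thesis using assms by (simp add: field_simps)
qed

text \<open>Since \<open>|y| = 7\<close>, the ball of radius \<open>6 t\<close> about \<open>t y\<close> stays in \<open>|x| > t\<close>, where \<open>u \<ge> 0\<close> for large \<open>t\<close>. By
  homogeneity the factor of \<open>\<integral> u\<close> on the left of \<open>supersolution_on_ball\<close> is a constant times \<open>t\<^sup>\<alpha>\<close>, the one on the right a
  constant times \<open>t^(-2)\<close>. As \<open>\<alpha> > - 2\<close>, the integral has to be \<open>0\<close> for large \<open>t\<close>.\<close>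

lemma vanishes_on_far_balls:
  assumes y: "norm y = 7"
  obtains T where "T > 0" "\<And>t. t \<ge> T \<Longrightarrow> AE x in lborel. x \<in> ball (t *\<^sub>R y) t \<longrightarrow> u x = 0"
proof -
  obtain L where L: "L > 0" "\<And>(y :: real ^ 'n) r x. r > 0 \<Longrightarrow> \<bar>laplacian (bump y r) x\<bar> \<le> L / r\<^sup>2"
    using laplacian_bump_le by metis
  define P where "P = (\<integral>x. V x * bump y 1 x \<partial>lborel)"
  have P: "P > 0" unfolding P_def using y by (intro integral_V_bump_pos) auto
  define c where "c = exp (- 4 / 3) / 4 ^ CARD('n) * P"
  have c: "c > 0" using P by (simp add: c_def)
  define E where "E = eta_mass TYPE('n)"
  have E: "E \<ge> 0" unfolding E_def eta_mass_def by (intro integral_nonneg_AE) (simp add: exp_cutoff_nonneg)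
  define T where "T = max (R + 1) (max 2 ((E * L / c + 1) powr (1 / (\<alpha> + 2))))"
  have vanish: "AE x in lborel. x \<in> ball (t *\<^sub>R y) t \<longrightarrow> u x = 0" if t: "t \<ge> T" for t
  proof -
    have t': "t \<ge> R + 1" "t \<ge> 2" "t \<ge> (E * L / c + 1) powr (1 / (\<alpha> + 2))"
      using t by (auto simp: T_def)
    have t0: "t > 0" using t' by simp
    (* |x| \<le> 13 t on the ball of radius 6 t about t y, so cutting off at R0 keeps u there
       and makes it integrable. *)
    define R0 where "R0 = 13 * t"
    define U where "U x = indicator (cball 0 R0) x * u x" for x
    have far: "norm x > R" "norm x \<le> R0" if "x \<in> ball (t *\<^sub>R y) (6 * t)" for x
    proof -
      have n: "norm (t *\<^sub>R y) = 7 * t" using y t0 by simp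
      have d: "norm (t *\<^sub>R y - x) < 6 * t" using that by (simp add: dist_norm)
      show "norm x > R" using norm_triangle_ineq2[of "t *\<^sub>R y" x] d n t'(1) by linarith
      show "norm x \<le> R0" using norm_triangle_ineq2[of x "t *\<^sub>R y"] d n by (simp add: R0_def norm_minus_commute)
    qed
    have U: "U x = u x" if "x \<in> ball (t *\<^sub>R y) (6 * t)" for x
      using far(2)[OF that] by (simp add: U_def)
    have Ui: "integrable lborel U" unfolding U_def[abs_def] by (rule u_cut_integrable)
    have ny: "norm (t *\<^sub>R y) \<ge> 2 * t" using y t0 by simp
    obtain K where K: "\<And>x. x \<in> ball (t *\<^sub>R y) t \<Longrightarrow> V x \<le> K" using V_bound_ball[OF t0 ny] by blast
    have sub: "x \<in> ball (t *\<^sub>R y) (6 * t)" if "x \<in> ball (t *\<^sub>R y) t" for x using that t0 by simp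
    let ?I = "\<integral>x. indicator (ball (t *\<^sub>R y) t) x * U x \<partial>lborel"
    have main: "(exp (- 4 / 3) / (4 * t) ^ CARD('n) * (\<integral>x. V x * bump (t *\<^sub>R y) t x \<partial>lborel)) * ?I
       \<le> (eta_mass TYPE('n) * (L / t\<^sup>2)) * ?I"
    proof (rule supersolution_on_ball[of U R0 t V "t *\<^sub>R y" K L])
      show "0 \<le> V x * U x" "0 \<le> U x" if "x \<in> ball (t *\<^sub>R y) (6 * t)" for x
        using U[OF that] u_nonneg[OF far(1)[OF that]] V_nonneg[of x] by auto
      show "- (\<integral>z. U z * laplacian (bump x \<rho>) z \<partial>lborel) = (\<integral>z. V z * U z * bump x \<rho> z \<partial>lborel)"
        if \<rho>: "\<rho> > 0" "ball x \<rho> \<subseteq> ball (t *\<^sub>R y) (6 * t)" for x \<rho>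
      proof -
        have e: "U z * laplacian (bump x \<rho>) z = u z * laplacian (bump x \<rho>) z"
          and e2: "V z * U z * bump x \<rho> z = V z * u z * bump x \<rho> z" for z
          using U[of z] \<rho> bump_term_outside[OF bump_term_bump2 \<rho>(1), of z x] bump_term_outside[OF bump_term_bump \<rho>(1), of z x]
          by (cases "z \<in> ball x \<rho>"; force simp: laplacian_bump)+
        show ?thesis using weak[OF \<rho>(1), of x] by (simp only: e e2)
      qed
    qed (use Ui t' K V_nonneg L(2)[OF t0] in \<open>auto simp: U_def\<close>)
    have Inn: "AE x in lborel. 0 \<le> indicator (ball (t *\<^sub>R y) t) x * U x"
      using U[OF sub] u_nonneg[OF far(1)[OF sub]] by (auto split: split_indicator)
    have Ii: "integrable lborel (\<lambda>x. indicator (ball (t *\<^sub>R y) t) x * U x)"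
      using integrable_mult_indicator[OF _ Ui, of "ball (t *\<^sub>R y) t"] by simp
    have "?I = 0"
    proof (rule ccontr)
      assume "?I \<noteq> 0"
      then have Ipos: "?I > 0" using integral_nonneg_AE[OF Inn] by simp
      have "exp (- 4 / 3) / (4 * t) ^ CARD('n) * (\<integral>x. V x * bump (t *\<^sub>R y) t x \<partial>lborel) \<le> E * (L / t\<^sup>2)"
        unfolding E_def by (rule mult_right_le_imp_le[OF main Ipos])
      also have "exp (- 4 / 3) / (4 * t) ^ CARD('n) * (\<integral>x. V x * bump (t *\<^sub>R y) t x \<partial>lborel) = c * t powr \<alpha>"
        using t0 by (simp add: integral_V_bump_scale[OF t0] P_def[symmetric] c_def power_mult_distrib)
      finally have "c * (t powr \<alpha> * t\<^sup>2) \<le> E * L" using t0 by (simp add: field_simps)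
      also have "t powr \<alpha> * t\<^sup>2 = t powr (\<alpha> + 2)" using t0 by (simp add: powr_add powr_numeral)
      finally have "t powr (\<alpha> + 2) \<le> E * L / c" using c by (simp add: field_simps)
      moreover have "E * L / c + 1 \<le> t powr (\<alpha> + 2)"
      proof -
        have nn: "E * L / c \<ge> 0" using E L(1) c by simp
        have "E * L / c + 1 = ((E * L / c + 1) powr (1 / (\<alpha> + 2))) powr (\<alpha> + 2)"
          using alpha nn by (simp add: powr_powr)
        also have "\<dots> \<le> t powr (\<alpha> + 2)" using t'(3) alpha by (intro powr_mono2) auto
        finally show ?thesis .
      qed
      ultimately show False by simp
    qed
    then have "AE x in lborel. indicator (ball (t *\<^sub>R y) t) x * U x = 0"
      using integral_nonneg_eq_0_iff_AE[OF Ii Inn] by simp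
    then show ?thesis by eventually_elim (use U[OF sub] in \<open>auto split: split_indicator_asm\<close>)
  qed
  have "T > 0" by (simp add: T_def)
  then show ?thesis using that vanish by blast
qed

text \<open>The threshold in \<open>vanishes_on_far_balls\<close> depends on the direction \<open>y\<close>; compactness of the sphere reduces to finitely many
  directions. The remaining union over all \<open>t\<close> is uncountable, and Lindeloef's theorem replaces it by a countable one.\<close>

lemma vanishes_near_infinity: obtains R' where "R' > 0" "AE x in lborel. norm x > R' \<longrightarrow> u x = 0"
proof -
  have "\<exists>T. norm y = 7 \<longrightarrow> T > 0 \<and> (\<forall>t\<ge>T. AE x in lborel. x \<in> ball (t *\<^sub>R y) t \<longrightarrow> u x = 0)" for y :: "real ^ 'n"
    using vanishes_on_far_balls[of y] by metis
  then obtain T where T: "\<And>y :: real ^ 'n. norm y = 7 \<Longrightarrow> T y > 0"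
     "\<And>y t. norm y = 7 \<Longrightarrow> t \<ge> T y \<Longrightarrow> AE x in lborel. x \<in> ball (t *\<^sub>R y) t \<longrightarrow> u x = 0" by metis
  have "compact (sphere (0 :: real ^ 'n) 7)" by simp
  moreover have "sphere (0 :: real ^ 'n) 7 \<subseteq> (\<Union>y\<in>sphere 0 7. ball y 1)" by force
  ultimately obtain Y where Y: "Y \<subseteq> sphere (0 :: real ^ 'n) 7" "finite Y" "sphere 0 7 \<subseteq> (\<Union>y\<in>Y. ball y 1)"
    using compactE_image[of "sphere (0 :: real ^ 'n) 7" "sphere 0 7" "\<lambda>y. ball y 1"] by (metis open_ball)
  define T0 where "T0 = 1 + (\<Sum>y\<in>Y. T y)"
  have sum_nn: "(\<Sum>y\<in>Y. T y) \<ge> 0" using T(1) Y(1) by (intro sum_nonneg) (auto simp: less_imp_le subset_iff)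
  have T0: "T y \<le> T0" if "y \<in> Y" for y
  proof -
    have "T y \<le> (\<Sum>y\<in>Y. T y)" using T(1) Y that by (intro member_le_sum) (auto simp: less_imp_le subset_iff)
    then show ?thesis by (simp add: T0_def)
  qed
  define F where "F = {ball (t *\<^sub>R y) t | t y. y \<in> Y \<and> t \<ge> T0}"
  obtain F' where F': "F' \<subseteq> F" "countable F'" "\<Union>F' = \<Union>F"
    by (rule Lindelof[of F]) (auto simp: F_def)
  have "AE x in lborel. \<forall>B\<in>F'. x \<in> B \<longrightarrow> u x = 0"
  proof (rule AE_ball_countable'[OF _ F'(2)])
    fix B assume "B \<in> F'"
    then obtain t y where "B = ball (t *\<^sub>R y) t" "y \<in> Y" "t \<ge> T0" using F'(1) by (auto simp: F_def)
    then show "AE x in lborel. x \<in> B \<longrightarrow> u x = 0" using T(2)[of y t] T0[of y] Y(1) by (auto simp: subset_iff)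
  qed
  moreover have "x \<in> \<Union>F'" if "norm x > 7 * T0" for x
  proof -
    define t where "t = norm x / 7"
    have t: "t > T0" "t > 0" using that sum_nn by (auto simp: t_def T0_def)
    have "(1 / t) *\<^sub>R x \<in> sphere 0 7" using t by (simp add: t_def)
    then obtain y where y: "y \<in> Y" "(1 / t) *\<^sub>R x \<in> ball y 1" using Y(3) by blast
    have "norm (t *\<^sub>R (y - (1 / t) *\<^sub>R x)) < t"
      using y(2) t by (simp add: dist_norm)
    then have "x \<in> ball (t *\<^sub>R y) t" using t by (simp add: dist_norm scaleR_diff_right)
    moreover have "ball (t *\<^sub>R y) t \<in> F" unfolding F_def using y(1) less_imp_le[OF t(1)] by blast
    ultimately show ?thesis unfolding F'(3) by blast
  qed
  ultimately have "AE x in lborel. norm x > 7 * T0 \<longrightarrow> u x = 0" by (auto elim!: eventually_mono)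
  then show ?thesis using that[of "7 * T0"] sum_nn by (simp add: T0_def)
qed

theorem solution_eq_0: "AE x in lborel. u x = 0"
proof -
  obtain R' where R': "R' > 0" "AE x in lborel. norm x > R' \<longrightarrow> u x = 0" by (rule vanishes_near_infinity)
  define U where "U x = indicator (cball 0 R') x * u x" for x
  have UU: "AE x in lborel. U x = u x"
    using R'(2) by eventually_elim (auto simp: U_def split: split_indicator)
  have [measurable]: "U \<in> borel_measurable borel"
    unfolding U_def[abs_def] by (intro borel_measurable_times borel_measurable_indicator) (use u_meas in auto)
  have lap_cont: "continuous_on UNIV (\<lambda>z. laplacian (bump y r) z)" for y :: "real ^ 'n" and r
    unfolding laplacian_bump by (intro continuous_intros bump_term_continuous[OF bump_term_bump2])
  have [measurable]: "laplacian (bump y r) \<in> borel_measurable borel" for y :: "real ^ 'n" and r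
    using borel_measurable_continuous_onI[OF lap_cont] .
  have [measurable]: "bump y r \<in> borel_measurable borel" for y :: "real ^ 'n" and r
    using borel_measurable_continuous_onI[OF bump_term_continuous[OF bump_term_bump]] .
  have "AE x in lborel. U x = 0"
  proof (rule compactly_supported_solution_eq_0[of U R' M "\<lambda>x. V x * U x" C \<alpha>])
    show "integrable lborel U" unfolding U_def[abs_def] by (rule u_cut_integrable)
    show "integrable lborel (\<lambda>x. V x * U x)"
      using Vu_integrable[of R'] by (simp add: U_def mult_ac)
    have "M \<ge> 0" using u_bounded[of 0] by linarith
    then show "\<bar>U x\<bar> \<le> M" for x using u_bounded[of x] by (auto simp: U_def split: split_indicator)
    show "\<bar>V x * U x\<bar> \<le> C * norm x powr \<alpha> * \<bar>U x\<bar>" for x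
      using mult_right_mono[OF V_bounded[of x], of "\<bar>U x\<bar>"] V_nonneg[of x] by (simp add: abs_mult)
    show "- (\<integral>y. U y * laplacian (bump x r) y \<partial>lborel) = (\<integral>y. V y * U y * bump x r y \<partial>lborel)" if "r > 0" for x r
    proof -
      have "(\<integral>y. U y * laplacian (bump x r) y \<partial>lborel) = (\<integral>y. u y * laplacian (bump x r) y \<partial>lborel)"
        using UU by (intro integral_cong_AE) (auto elim: eventually_mono)
      moreover have "(\<integral>y. V y * U y * bump x r y \<partial>lborel) = (\<integral>y. V y * u y * bump x r y \<partial>lborel)"
        using UU by (intro integral_cong_AE) (auto elim: eventually_mono)
      ultimately show ?thesis using weak[OF that, of x] by simp
    qed
  qed (use R' alpha in \<open>auto simp: U_def\<close>)
  with UU show ?thesis by eventually_elim simp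
qed

end

section \<open>From Lebesgue to Borel functions\<close>

text \<open>The essential bound on the shell \<open>1 \<le> |x| \<le> 2\<close> spreads to all dyadic dilates by homogeneity. There are countably many
  of them, and dilations preserve null sets.\<close>

lemma homogeneous_essential_bound:
  fixes V :: "real ^ 'n::finite \<Rightarrow> real"
  assumes V: "locally_essentially_bounded_on (UNIV - {0}) V" and hom: "positive_homogeneous \<alpha> V"
  obtains C where "C \<ge> 0" "AE x in lborel. x \<noteq> 0 \<longrightarrow> V x \<le> C * norm x powr \<alpha>"
proof -
  let ?A = "cball 0 2 - ball 0 1 :: (real ^ 'n) set"
  have "compact ?A" "?A \<subseteq> UNIV - {0}" by (auto intro: compact_diff)
  then obtain C0 where C0: "AE x in lebesgue. x \<in> ?A \<longrightarrow> \<bar>V x\<bar> \<le> C0"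
    using V unfolding locally_essentially_bounded_on_def by blast
  then have C0': "AE x in lborel. x \<in> ?A \<longrightarrow> \<bar>V x\<bar> \<le> \<bar>C0\<bar>"
    unfolding AE_completion_iff by eventually_elim auto
  define s where "s k = (2::real) powr (- real_of_int k)" for k :: int
  have s: "s k > 0" for k by (simp add: s_def)
  have all: "AE x in lborel. \<forall>k. s k *\<^sub>R x \<in> ?A \<longrightarrow> \<bar>V (s k *\<^sub>R x)\<bar> \<le> \<bar>C0\<bar>"
    unfolding AE_all_countable
  proof
    fix k show "AE x in lborel. s k *\<^sub>R x \<in> ?A \<longrightarrow> \<bar>V (s k *\<^sub>R x)\<bar> \<le> \<bar>C0\<bar>"
      using AE_lborel_scale[OF C0', of "s k"] s[of k] by simp
  qed
  define C where "C = \<bar>C0\<bar> * 2 powr \<bar>\<alpha>\<bar>"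
  have "AE x in lborel. x \<noteq> 0 \<longrightarrow> V x \<le> C * norm x powr \<alpha>"
    using all
  proof eventually_elim
    case (elim x)
    show ?case
    proof
      assume x: "x \<noteq> 0"
      define k where "k = \<lfloor>log 2 (norm x)\<rfloor>"
      define a where "a = s k * norm x"
      have lg: "norm x = 2 powr log 2 (norm x)" using x by simp
      have "a = 2 powr (log 2 (norm x) - real_of_int k)"
        unfolding a_def s_def by (subst lg, subst powr_add[symmetric]) simp
      moreover have "0 \<le> log 2 (norm x) - real_of_int k" "log 2 (norm x) - real_of_int k \<le> 1"
        unfolding k_def by linarith+
      ultimately have a: "1 \<le> a" "a \<le> 2"
        using powr_mono[of 0 "log 2 (norm x) - real_of_int k" 2] powr_mono[of "log 2 (norm x) - real_of_int k" 1 2] by auto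
      have "s k *\<^sub>R x \<in> ?A" using a s[of k] by (simp add: a_def)
      then have "V (s k *\<^sub>R x) \<le> \<bar>C0\<bar>" using elim by force
      then have b: "s k powr \<alpha> * V x \<le> \<bar>C0\<bar>"
        using hom x s[of k] by (simp add: positive_homogeneous_def)
      have "s k powr \<alpha> * norm x powr \<alpha> = a powr \<alpha>"
        using s[of k] by (simp add: a_def powr_mult)
      then have sk: "s k powr \<alpha> = a powr \<alpha> / norm x powr \<alpha>" using x by (simp add: field_simps)
      have "V x \<le> \<bar>C0\<bar> * a powr (- \<alpha>) * norm x powr \<alpha>"
        using b a x unfolding sk by (simp add: powr_minus field_simps)
      also have "a powr (- \<alpha>) \<le> 2 powr \<bar>\<alpha>\<bar>"
      proof -
        have "a powr (- \<alpha>) \<le> a powr \<bar>\<alpha>\<bar>" using a by (intro powr_mono) auto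
        also have "\<dots> \<le> 2 powr \<bar>\<alpha>\<bar>" using a by (intro powr_mono2) auto
        finally show ?thesis .
      qed
      finally show "V x \<le> C * norm x powr \<alpha>" by (simp add: C_def mult_left_mono mult_right_mono)
    qed
  qed
  then show ?thesis using that[of C] by (simp add: C_def)
qed

text \<open>Off a Borel null set \<open>N\<close> the functions \<open>u\<close> and \<open>V\<close> agree with Borel functions and satisfy all bounds pointwise. Setting the
  Borel functions to \<open>0\<close> on \<open>N\<close> gives representatives to which the preceding results apply, and no integral changes.\<close>

lemma eventually_nonneg_solution_eq_0:
  fixes V u :: "real ^ 'n::finite \<Rightarrow> real"
  assumes V: "locally_essentially_bounded_on (UNIV - {0}) V" and hom: "positive_homogeneous \<alpha> V"
    and u: "essentially_bounded u" and weak: "weak_solution V u" and \<alpha>: "\<alpha> > -2"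
    and R: "R > 0" and nonneg: "AE x in lebesgue. norm x > R \<longrightarrow> u x \<ge> 0"
  shows "AE x in lebesgue. u x = 0"
proof -
  have u_meas: "u \<in> borel_measurable lebesgue" using u by (simp add: essentially_bounded_def)
  obtain M0 where "AE x in lebesgue. \<bar>u x\<bar> \<le> M0" using u unfolding essentially_bounded_def by blast
  then have M0: "AE x in lborel. \<bar>u x\<bar> \<le> \<bar>M0\<bar>" unfolding AE_completion_iff by eventually_elim auto
  obtain C where C: "C \<ge> 0" "AE x in lborel. x \<noteq> 0 \<longrightarrow> V x \<le> C * norm x powr \<alpha>"
    using homogeneous_essential_bound[OF V hom] by blast
  have "(\<lambda>x. if x \<in> UNIV - {0} then V x else 0) \<in> borel_measurable lebesgue"
    using V by (subst borel_measurable_if) (auto simp: locally_essentially_bounded_on_def)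
  then obtain V1 where V1: "V1 \<in> borel_measurable lborel" "AE x in lborel. (if x \<in> UNIV - {0} then V x else 0) = V1 x"
    using completion_ex_borel_measurable_real by blast
  obtain u1 where u1: "u1 \<in> borel_measurable lborel" "AE x in lborel. u x = u1 x"
    using completion_ex_borel_measurable_real[OF u_meas] by blast
  have nn: "AE x in lborel. norm x > R \<longrightarrow> u x \<ge> 0" using nonneg by (simp add: AE_completion_iff)
  have ne: "AE x in lborel. x \<noteq> (0 :: real ^ 'n)" by (rule AE_lborel_singleton)
  define G where "G x \<longleftrightarrow> x \<noteq> 0 \<and> V x = V1 x \<and> u x = u1 x \<and> \<bar>u x\<bar> \<le> \<bar>M0\<bar> \<and> V x \<le> C * norm x powr \<alpha>
      \<and> (norm x > R \<longrightarrow> u x \<ge> 0)" for x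
  have "AE x in lborel. G x"
    using nn ne M0 C(2) V1(2) u1(2) by eventually_elim (auto simp: G_def)
  then obtain N where N: "N \<in> null_sets lborel" and "\<And>x. x \<notin> N \<Longrightarrow> G x"
    by (auto simp: eventually_ae_filter)
  then have good: "\<And>x. x \<notin> N \<Longrightarrow> x \<noteq> 0 \<and> V x = V1 x \<and> u x = u1 x
      \<and> \<bar>u x\<bar> \<le> \<bar>M0\<bar> \<and> V x \<le> C * norm x powr \<alpha> \<and> (norm x > R \<longrightarrow> u x \<ge> 0)"
    unfolding G_def by blast
  have Nb: "- N \<in> sets borel" using N by auto
  define u0 where "u0 x = indicator (- N) x * u1 x" for x
  define V0 where "V0 x = indicator (- N) x * V1 x" for x
  have [measurable]: "u0 \<in> borel_measurable borel" "V0 \<in> borel_measurable borel"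
    unfolding u0_def[abs_def] V0_def[abs_def] using u1(1) V1(1) Nb by auto
  have AEN: "AE x in lborel. x \<notin> N" using AE_not_in[OF N] .
  have eq: "V0 x = V x" "u0 x = u x" if "x \<notin> N" for x
    using good[OF that] that by (auto simp: u0_def V0_def)
  have off: "V0 x = 0" "u0 x = 0" if "x \<in> N" for x using that by (auto simp: u0_def V0_def)
  have Vpos: "V x > 0" if "x \<noteq> 0" for x using hom that by (simp add: positive_homogeneous_def)
  have bump_meas [measurable]: "bump y r \<in> borel_measurable borel" for y :: "real ^ 'n" and r
    using borel_measurable_continuous_onI[OF bump_term_continuous[OF bump_term_bump]] .
  have lap_cont: "continuous_on UNIV (\<lambda>z. laplacian (bump y r) z)" for y :: "real ^ 'n" and r
    unfolding laplacian_bump by (intro continuous_intros bump_term_continuous[OF bump_term_bump2])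
  have lap_meas [measurable]: "laplacian (bump y r) \<in> borel_measurable borel" for y :: "real ^ 'n" and r
    using borel_measurable_continuous_onI[OF lap_cont] .
  have AENl: "AE x in lebesgue. x \<notin> N" using AEN by (simp add: AE_completion_iff)
  interpret homogeneous_equation u0 V0 \<alpha> C "\<bar>M0\<bar>" R
  proof
    show "\<bar>u0 x\<bar> \<le> \<bar>M0\<bar>" for x using eq[of x] off[of x] good[of x] by (cases "x \<in> N") auto
    show "0 \<le> V0 x" for x using eq[of x] off[of x] good[of x] Vpos[of x] by (cases "x \<in> N") auto
    show "V0 x \<le> C * norm x powr \<alpha>" for x
      using eq[of x] off[of x] good[of x] C(1) by (cases "x \<in> N") auto
    show "AE x in lborel. V0 x > 0"
      using AEN by eventually_elim (metis eq(1) good Vpos)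
    show "AE x in lborel. V0 (t *\<^sub>R x) = t powr \<alpha> * V0 x" if "t > 0" for t
    proof -
      have "AE x in lborel. t *\<^sub>R x \<notin> N" using AE_lborel_scale[OF AEN, of t] that by simp
      then show ?thesis using AEN
      proof eventually_elim
        case (elim x)
        then show ?case using eq(1)[of x] eq(1)[of "t *\<^sub>R x"] good[of x] hom that
          by (simp add: positive_homogeneous_def)
      qed
    qed
    show "integrable lborel (\<lambda>x. indicator (cball 0 \<rho>) x * (V0 x * u0 x))" for \<rho>
    proof -
      have m: "(\<lambda>x. indicator (cball 0 \<rho>) x * (V0 x * u0 x)) \<in> borel_measurable lborel"
        by (intro borel_measurable_times borel_measurable_indicator) auto
      have i: "integrable lebesgue (\<lambda>x. indicator (cball 0 \<rho>) x *\<^sub>R (V x * u x))"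
        using weak compact_cball[of "0 :: real ^ 'n" \<rho>]
        unfolding weak_solution_def locally_integrable_def set_integrable_def by blast
      have "integrable lebesgue (\<lambda>x. indicator (cball 0 \<rho>) x * (V0 x * u0 x))"
      proof (rule integrable_cong_AE_imp[OF i])
        show "(\<lambda>x. indicator (cball 0 \<rho>) x * (V0 x * u0 x)) \<in> borel_measurable lebesgue"
          using m by (rule measurable_completion)
        show "AE x in lebesgue. indicator (cball 0 \<rho>) x *\<^sub>R (V x * u x) = indicator (cball 0 \<rho>) x * (V0 x * u0 x)"
          using AENl by eventually_elim (simp add: eq)
      qed
      then show ?thesis using m by (simp add: integrable_completion)
    qed
    show "- (\<integral>x. u0 x * laplacian (bump y r) x \<partial>lborel) = (\<integral>x. V0 x * u0 x * bump y r x \<partial>lborel)" if "r > 0" for y r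
    proof -
      have 1: "(\<integral>x. u0 x * laplacian (bump y r) x \<partial>lborel) = (\<integral>x. u x * laplacian (bump y r) x \<partial>lebesgue)"
      proof -
        have "(\<integral>x. u0 x * laplacian (bump y r) x \<partial>lborel) = (\<integral>x. u0 x * laplacian (bump y r) x \<partial>lebesgue)"
          by (rule integral_completion[symmetric]) simp
        also have "\<dots> = (\<integral>x. u x * laplacian (bump y r) x \<partial>lebesgue)"
        proof (rule integral_cong_AE)
          show "(\<lambda>x. u0 x * laplacian (bump y r) x) \<in> borel_measurable lebesgue"
            by (rule measurable_completion) simp
          show "(\<lambda>x. u x * laplacian (bump y r) x) \<in> borel_measurable lebesgue"
            by (intro borel_measurable_times u_meas measurable_completion) simp
          show "AE x in lebesgue. u0 x * laplacian (bump y r) x = u x * laplacian (bump y r) x"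
            using AENl by eventually_elim (simp add: eq)
        qed
        finally show ?thesis .
      qed
      have 2: "(\<integral>x. V0 x * u0 x * bump y r x \<partial>lborel) = (\<integral>x. V x * u x * bump y r x \<partial>lebesgue)"
      proof -
        define \<rho> where "\<rho> = norm y + r"
        have cut: "V x * u x * bump y r x = (indicator (cball 0 \<rho>) x *\<^sub>R (V x * u x)) * bump y r x" for x
        proof (cases "x \<in> ball y r")
          case True
          then have "norm x \<le> \<rho>"
            using norm_triangle_ineq2[of x y] by (simp add: \<rho>_def dist_norm norm_minus_commute)
          then show ?thesis by simp
        qed (simp add: bump_term_outside[OF bump_term_bump that])
        have "integrable lebesgue (\<lambda>x. indicator (cball 0 \<rho>) x *\<^sub>R (V x * u x))"
          using weak compact_cball[of "0 :: real ^ 'n" \<rho>]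
          unfolding weak_solution_def locally_integrable_def set_integrable_def by blast
        then have m: "(\<lambda>x. V x * u x * bump y r x) \<in> borel_measurable lebesgue"
          unfolding cut by (intro borel_measurable_times borel_measurable_integrable[of lebesgue "\<lambda>x. _ x *\<^sub>R _ x"]
              measurable_completion) simp_all
        have m0: "(\<lambda>x. V0 x * u0 x * bump y r x) \<in> borel_measurable lborel" by simp
        have "(\<integral>x. V0 x * u0 x * bump y r x \<partial>lborel) = (\<integral>x. V0 x * u0 x * bump y r x \<partial>lebesgue)"
          by (rule integral_completion[OF m0, symmetric])
        also have "\<dots> = (\<integral>x. V x * u x * bump y r x \<partial>lebesgue)"
          by (rule integral_cong_AE[OF measurable_completion[OF m0] m])
            (use AENl in \<open>eventually_elim, simp add: eq\<close>)
        finally show ?thesis .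
      qed
      show ?thesis
        using weak bump_term_test_function[OF bump_term_bump that, of y]
        unfolding weak_solution_def 1 2 by blast
    qed
    show "u0 x \<ge> 0" if "norm x > R" for x
      using eq[of x] off[of x] good[of x] that by (cases "x \<in> N") auto
  qed (use \<alpha> R in auto)
  have "AE x in lborel. u x = 0"
    using solution_eq_0 AEN by eventually_elim (simp add: eq)
  then show ?thesis by (simp add: AE_completion_iff)
qed

lemma weak_solution_uminus:
  assumes "weak_solution V u" shows "weak_solution V (\<lambda>x. - u x)"
proof -
  have "locally_integrable (\<lambda>x. - f x)" if "locally_integrable f" for f :: "real ^ 'a \<Rightarrow> real"
    using that by (auto simp: locally_integrable_def set_integrable_def)
  then show ?thesis using assms by (simp add: weak_solution_def)
qed

theorem corollary1p7:
  fixes V u :: "real ^ 'n::finite \<Rightarrow> real" and \<alpha> :: real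
  assumes "CARD('n) \<ge> 2"
    and "locally_essentially_bounded_on (UNIV - {0}) V"
    and "positive_homogeneous \<alpha> V"
    and "essentially_bounded u"
    and "\<not> (AE x in lebesgue. u x = 0)"
    and "weak_solution V u"
    and "(CARD('n) = 2 \<and> \<alpha> > -2) \<or> (CARD('n) \<ge> 3 \<and> \<alpha> \<ge> real CARD('n) - 4)"
  shows "changes_sign_near_infinity u"
proof (rule ccontr)
  have \<alpha>: "\<alpha> > -2" using assms(7) by auto
  assume "\<not> changes_sign_near_infinity u"
  then obtain R where "R > 0" and sign: "(AE x in lebesgue. norm x > R \<longrightarrow> u x \<ge> 0) \<or>
      (AE x in lebesgue. norm x > R \<longrightarrow> u x \<le> 0)"
    unfolding changes_sign_near_infinity_def by blast
  from sign have "AE x in lebesgue. u x = 0"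
  proof
    assume "AE x in lebesgue. norm x > R \<longrightarrow> u x \<ge> 0"
    then show ?thesis
      by (rule eventually_nonneg_solution_eq_0[OF assms(2-4,6) \<alpha> \<open>R > 0\<close>])
  next
    assume "AE x in lebesgue. norm x > R \<longrightarrow> u x \<le> 0"
    then have "AE x in lebesgue. norm x > R \<longrightarrow> - u x \<ge> 0" by simp
    moreover have "essentially_bounded (\<lambda>x. - u x)"
      using assms(4) by (simp add: essentially_bounded_def)
    ultimately have "AE x in lebesgue. - u x = 0"
      by (intro eventually_nonneg_solution_eq_0[OF assms(2,3) _ weak_solution_uminus[OF assms(6)] \<alpha> \<open>R > 0\<close>])
    then show ?thesis by simp
  qed
  then show False using assms(5) by simp
qed

end
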